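(* Let $G$ be a Lie group with Lie algebra $\mathfrak{g}$ and a positive-definite bi-invariant metric $\kappa(\cdot,\cdot)$. Let $\Lambda\colon\mathfrak{g}\to\mathfrak{g}$ be a positive-definite operator that is symmetric with respect to $\kappa$, and let $G$ carry the left-invariant metric defined on $\mathfrak{g}$ by $\langle u,v\rangle=\kappa(u,\Lambda v)$. For any $u_0\in\mathfrak{g}$, let $\gamma$ be the geodesic of the left-invariant metric $\langle\cdot,\cdot\rangle$ with $\gamma(0)=\mathrm{id}$ and $\gamma'(0)=u_0$. Then $\gamma$ has a conjugate point if and only if $\Lambda u_0$ is not in the center of $\mathfrak{g}$. Furthermore, if $\gamma$ has a conjugate point, then the first conjugate time $\tau>0$ satisfies $$\frac{2\pi\lambda_m}{\lVert \mathrm{ad}_{\Lambda u_0}\rVert_{\mathrm{op}}}\le \tau\le \frac{2\pi\lambda_M}{\lVert \mathrm{ad}_{\Lambda u_0}\rVert_{\mathrm{op}}},$$ where $\lambda_m$ and $\lambda_M$ are the smallest and largest eigenvalues of $\Lambda$, and the operator norm is computed using $\kappa(\cdot,\cdot)$.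
   Context: $\mathrm{ad}_u v=[u,v]$. "$\gamma$ has a conjugate point" means that for some $\tau>0$ there is a nontrivial Jacobi field along $\gamma$ vanishing at $t=0$ and $t=\tau$; such a $\tau$ is a conjugate time, and the first conjugate time is the smallest such $\tau$. *)

theory Defs
  imports "HOL-Analysis.Analysis"
begin

section \<open>Smooth functions\<close>

text \<open>Meant only for open sets \<open>S\<close>, since derivatives are taken with respect to full
  neighbourhoods.\<close>

primrec Ck_on :: "nat \<Rightarrow> 'a::real_normed_vector set \<Rightarrow> ('a \<Rightarrow> 'b::real_normed_vector) \<Rightarrow> bool" where
  "Ck_on 0 S f \<longleftrightarrow> continuous_on S f"
| "Ck_on (Suc k) S f \<longleftrightarrow> (\<forall>x\<in>S. f differentiable (at x)) \<and>
     (\<forall>v. Ck_on k S (\<lambda>x. frechet_derivative f (at x) v))"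

definition smooth_on :: "'a::real_normed_vector set \<Rightarrow> ('a \<Rightarrow> 'b::real_normed_vector) \<Rightarrow> bool" where
  "smooth_on S f \<longleftrightarrow> (\<forall>k. Ck_on k S f)"

section \<open>Smooth manifolds\<close>

text \<open>A chart is a pair of a domain and a coordinate map; the values of the coordinate map
  outside the domain are irrelevant.\<close>

type_synonym ('m, 'e) chart = "'m set \<times> ('m \<Rightarrow> 'e)"

abbreviation cdom :: "('m, 'e) chart \<Rightarrow> 'm set" where
  "cdom c \<equiv> fst c"

abbreviation cmap :: "('m, 'e) chart \<Rightarrow> 'm \<Rightarrow> 'e" where
  "cmap c \<equiv> snd c"

abbreviation cimg :: "('m, 'e) chart \<Rightarrow> 'e set" where
  "cimg c \<equiv> cmap c ` cdom c"

abbreviation cinv :: "('m, 'e) chart \<Rightarrow> 'e \<Rightarrow> 'm" where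
  "cinv c \<equiv> inv_into (cdom c) (cmap c)"

definition smooth_atlas ::
    "('m::{t2_space, second_countable_topology}, 'e::euclidean_space) chart set \<Rightarrow> bool" where
  "smooth_atlas A \<longleftrightarrow>
     (\<forall>c\<in>A. open (cdom c) \<and> open (cimg c) \<and> homeomorphism (cdom c) (cimg c) (cmap c) (cinv c)) \<and>
     (\<Union>c\<in>A. cdom c) = UNIV \<and>
     (\<forall>c\<in>A. \<forall>d\<in>A. smooth_on (cmap c ` (cdom c \<inter> cdom d)) (cmap d \<circ> cinv c))"

definition smooth_map ::
    "('m::topological_space, 'e::real_normed_vector) chart set \<Rightarrow>
     ('n::topological_space, 'f::real_normed_vector) chart set \<Rightarrow> ('m \<Rightarrow> 'n) \<Rightarrow> bool" where
  "smooth_map A B f \<longleftrightarrow> continuous_on UNIV f \<and>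
     (\<forall>c\<in>A. \<forall>d\<in>B. smooth_on (cmap c ` (cdom c \<inter> f -` cdom d)) (cmap d \<circ> f \<circ> cinv c))"

definition vs_atlas :: "('e, 'e) chart set" where
  "vs_atlas = {(UNIV, \<lambda>x. x)}"

definition prod_atlas ::
    "('m, 'e) chart set \<Rightarrow> ('n, 'f) chart set \<Rightarrow> ('m \<times> 'n, 'e \<times> 'f) chart set" where
  "prod_atlas A B = {(cdom c \<times> cdom d, map_prod (cmap c) (cmap d)) | c d. c \<in> A \<and> d \<in> B}"

text \<open>At every point a chart of the atlas is chosen, and the tangent space at \<open>p\<close> is identified
  with the model space \<open>'e\<close> by taking components in the chart chosen at \<open>p\<close>.  Hence a vector field
  on the manifold is a function \<open>'m \<Rightarrow> 'e\<close> and a vector field along a curve a function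
  \<open>real \<Rightarrow> 'e\<close>; neither need be continuous as a function into \<open>'e\<close> when it is smooth as a vector
  field, because the chosen chart varies with the point.\<close>

definition chart_at :: "('m, 'e) chart set \<Rightarrow> 'm \<Rightarrow> ('m, 'e) chart" where
  "chart_at A p = (SOME c. c \<in> A \<and> p \<in> cdom c)"

definition coord_change ::
    "('m, 'e::real_normed_vector) chart \<Rightarrow> ('m, 'e) chart \<Rightarrow> 'm \<Rightarrow> 'e \<Rightarrow> 'e" where
  "coord_change c d p = frechet_derivative (cmap d \<circ> cinv c) (at (cmap c p))"

text \<open>The components in the chart \<open>c\<close> of a tangent vector at \<open>p\<close>, and conversely the tangent
  vector at \<open>p\<close> with given components in the chart \<open>c\<close>.\<close>

definition to_chart ::
    "('m, 'e::real_normed_vector) chart set \<Rightarrow> ('m, 'e) chart \<Rightarrow> 'm \<Rightarrow> 'e \<Rightarrow> 'e" where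
  "to_chart A c p v = coord_change (chart_at A p) c p v"

definition from_chart ::
    "('m, 'e::real_normed_vector) chart set \<Rightarrow> ('m, 'e) chart \<Rightarrow> 'm \<Rightarrow> 'e \<Rightarrow> 'e" where
  "from_chart A c p v = coord_change c (chart_at A p) p v"

definition tangent_map ::
    "('m, 'e::real_normed_vector) chart set \<Rightarrow> ('n, 'f::real_normed_vector) chart set \<Rightarrow>
     ('m \<Rightarrow> 'n) \<Rightarrow> 'm \<Rightarrow> 'e \<Rightarrow> 'f" where
  "tangent_map A B f p =
     frechet_derivative (cmap (chart_at B (f p)) \<circ> f \<circ> cinv (chart_at A p)) (at (cmap (chart_at A p) p))"

definition velocity ::
    "('m, 'e::real_normed_vector) chart set \<Rightarrow> (real \<Rightarrow> 'm) \<Rightarrow> real \<Rightarrow> 'e" where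
  "velocity A \<gamma> t = vector_derivative (cmap (chart_at A (\<gamma> t)) \<circ> \<gamma>) (at t)"

definition field_in_chart ::
    "('m, 'e::real_normed_vector) chart set \<Rightarrow> ('m \<Rightarrow> 'e) \<Rightarrow> ('m, 'e) chart \<Rightarrow> 'e \<Rightarrow> 'e" where
  "field_in_chart A X c x = to_chart A c (cinv c x) (X (cinv c x))"

definition vf_bracket ::
    "('m, 'e::real_normed_vector) chart set \<Rightarrow> ('m \<Rightarrow> 'e) \<Rightarrow> ('m \<Rightarrow> 'e) \<Rightarrow> 'm \<Rightarrow> 'e" where
  "vf_bracket A X Y p = (let c = chart_at A p; x = cmap c p in
     frechet_derivative (field_in_chart A Y c) (at x) (X p)
     - frechet_derivative (field_in_chart A X c) (at x) (Y p))"

section \<open>Riemannian metrics, geodesics and Jacobi fields\<close>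

type_synonym ('m, 'e) metric_field = "'m \<Rightarrow> 'e \<Rightarrow> 'e \<Rightarrow> real"

definition inner_product :: "('e::real_vector \<Rightarrow> 'e \<Rightarrow> real) \<Rightarrow> bool" where
  "inner_product B \<longleftrightarrow> (\<forall>u. linear (B u)) \<and> (\<forall>u v. B u v = B v u) \<and> (\<forall>v. v \<noteq> 0 \<longrightarrow> B v v > 0)"

definition metric_in_chart ::
    "('m, 'e::real_normed_vector) chart set \<Rightarrow> ('m, 'e) metric_field \<Rightarrow>
     ('m, 'e) chart \<Rightarrow> 'e \<Rightarrow> 'e \<Rightarrow> 'e \<Rightarrow> real" where
  "metric_in_chart A h c x v w =
     h (cinv c x) (from_chart A c (cinv c x) v) (from_chart A c (cinv c x) w)"

definition riemannian_metric ::
    "('m, 'e::real_normed_vector) chart set \<Rightarrow> ('m, 'e) metric_field \<Rightarrow> bool" where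
  "riemannian_metric A h \<longleftrightarrow> (\<forall>p. inner_product (h p)) \<and>
     (\<forall>c\<in>A. \<forall>v w. smooth_on (cimg c) (\<lambda>x. metric_in_chart A h c x v w))"

text \<open>\<open>christoffel A h c x v w\<close> is \<open>\<Gamma>\<^sup>k\<^sub>i\<^sub>j v\<^sup>i w\<^sup>j\<close> for the Levi-Civita connection in the chart \<open>c\<close> at
  the coordinate point \<open>x\<close>.\<close>

definition christoffel ::
    "('m, 'e::real_normed_vector) chart set \<Rightarrow> ('m, 'e) metric_field \<Rightarrow>
     ('m, 'e) chart \<Rightarrow> 'e \<Rightarrow> 'e \<Rightarrow> 'e \<Rightarrow> 'e" where
  "christoffel A h c x v w =
     (let D = (\<lambda>a b d. frechet_derivative (\<lambda>y. metric_in_chart A h c y b d) (at x) a) in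
      THE z. \<forall>y. metric_in_chart A h c x z y = (D v w y + D w v y - D y v w) / 2)"

text \<open>The covariant derivative of a vector field \<open>V\<close> along \<open>\<gamma>\<close>, evaluated at time \<open>t\<close> in the chart
  chosen at \<open>\<gamma> t\<close>; in that chart the components of \<open>V t\<close> are \<open>V t\<close> itself.\<close>

definition cov_deriv ::
    "('m, 'e::real_normed_vector) chart set \<Rightarrow> ('m, 'e) metric_field \<Rightarrow>
     (real \<Rightarrow> 'm) \<Rightarrow> (real \<Rightarrow> 'e) \<Rightarrow> real \<Rightarrow> 'e" where
  "cov_deriv A h \<gamma> V t = (let c = chart_at A (\<gamma> t) in
     vector_derivative (\<lambda>s. to_chart A c (\<gamma> s) (V s)) (at t)
     + christoffel A h c (cmap c (\<gamma> t)) (velocity A \<gamma> t) (V t))"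

text \<open>Sign convention: \<open>R(u,v)w = \<nabla>\<^sub>u\<nabla>\<^sub>v w - \<nabla>\<^sub>v\<nabla>\<^sub>u w - \<nabla>\<^bsub>[u,v]\<^esub> w\<close>.\<close>

definition curvature ::
    "('m, 'e::real_normed_vector) chart set \<Rightarrow> ('m, 'e) metric_field \<Rightarrow> 'm \<Rightarrow> 'e \<Rightarrow> 'e \<Rightarrow> 'e \<Rightarrow> 'e" where
  "curvature A h p u v w =
     (let c = chart_at A p; x = cmap c p; \<Gamma> = christoffel A h c in
      frechet_derivative (\<lambda>y. \<Gamma> y v w) (at x) u - frechet_derivative (\<lambda>y. \<Gamma> y u w) (at x) v
      + \<Gamma> x u (\<Gamma> x v w) - \<Gamma> x v (\<Gamma> x u w))"

definition smooth_field_along ::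
    "('m, 'e::real_normed_vector) chart set \<Rightarrow> (real \<Rightarrow> 'm) \<Rightarrow> (real \<Rightarrow> 'e) \<Rightarrow> bool" where
  "smooth_field_along A \<gamma> V \<longleftrightarrow> (\<forall>c\<in>A. smooth_on (\<gamma> -` cdom c) (\<lambda>t. to_chart A c (\<gamma> t) (V t)))"

definition geodesic ::
    "('m::topological_space, 'e::real_normed_vector) chart set \<Rightarrow> ('m, 'e) metric_field \<Rightarrow>
     (real \<Rightarrow> 'm) \<Rightarrow> bool" where
  "geodesic A h \<gamma> \<longleftrightarrow> smooth_map vs_atlas A \<gamma> \<and> (\<forall>t. cov_deriv A h \<gamma> (velocity A \<gamma>) t = 0)"

definition jacobi_field ::
    "('m, 'e::real_normed_vector) chart set \<Rightarrow> ('m, 'e) metric_field \<Rightarrow>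
     (real \<Rightarrow> 'm) \<Rightarrow> (real \<Rightarrow> 'e) \<Rightarrow> bool" where
  "jacobi_field A h \<gamma> J \<longleftrightarrow> smooth_field_along A \<gamma> J \<and>
     (\<forall>t. cov_deriv A h \<gamma> (cov_deriv A h \<gamma> J) t
          + curvature A h (\<gamma> t) (J t) (velocity A \<gamma> t) (velocity A \<gamma> t) = 0)"

definition conjugate_time ::
    "('m, 'e::real_normed_vector) chart set \<Rightarrow> ('m, 'e) metric_field \<Rightarrow> (real \<Rightarrow> 'm) \<Rightarrow> real \<Rightarrow> bool" where
  "conjugate_time A h \<gamma> \<tau> \<longleftrightarrow> \<tau> > 0 \<and>
     (\<exists>J. jacobi_field A h \<gamma> J \<and> (\<exists>t. J t \<noteq> 0) \<and> J 0 = 0 \<and> J \<tau> = 0)"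

definition has_conjugate_point ::
    "('m, 'e::real_normed_vector) chart set \<Rightarrow> ('m, 'e) metric_field \<Rightarrow> (real \<Rightarrow> 'm) \<Rightarrow> bool" where
  "has_conjugate_point A h \<gamma> \<longleftrightarrow> (\<exists>\<tau>. conjugate_time A h \<gamma> \<tau>)"

definition first_conjugate_time ::
    "('m, 'e::real_normed_vector) chart set \<Rightarrow> ('m, 'e) metric_field \<Rightarrow> (real \<Rightarrow> 'm) \<Rightarrow> real \<Rightarrow> bool" where
  "first_conjugate_time A h \<gamma> \<tau> \<longleftrightarrow>
     conjugate_time A h \<gamma> \<tau> \<and> (\<forall>\<sigma>. conjugate_time A h \<gamma> \<sigma> \<longrightarrow> \<tau> \<le> \<sigma>)"

section \<open>Lie groups\<close>

locale lie_group = group mul e iv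
  for mul :: "'g \<Rightarrow> 'g \<Rightarrow> 'g::{t2_space, second_countable_topology}"
    and e :: 'g and iv :: "'g \<Rightarrow> 'g" +
  fixes A :: "('g, 'e::euclidean_space) chart set"
  assumes atlas: "smooth_atlas A"
    and smooth_mult: "smooth_map (prod_atlas A A) A (\<lambda>(p, q). mul p q)"
    and smooth_inverse: "smooth_map A A iv"

definition left_invariant ::
    "('g \<Rightarrow> 'g \<Rightarrow> 'g) \<Rightarrow> ('g, 'e::real_normed_vector) chart set \<Rightarrow> ('g, 'e) metric_field \<Rightarrow> bool" where
  "left_invariant mul A h \<longleftrightarrow> (\<forall>a p v w.
     h (mul a p) (tangent_map A A (\<lambda>q. mul a q) p v) (tangent_map A A (\<lambda>q. mul a q) p w) = h p v w)"

definition right_invariant ::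
    "('g \<Rightarrow> 'g \<Rightarrow> 'g) \<Rightarrow> ('g, 'e::real_normed_vector) chart set \<Rightarrow> ('g, 'e) metric_field \<Rightarrow> bool" where
  "right_invariant mul A h \<longleftrightarrow> (\<forall>a p v w.
     h (mul p a) (tangent_map A A (\<lambda>q. mul q a) p v) (tangent_map A A (\<lambda>q. mul q a) p w) = h p v w)"

text \<open>The Lie algebra is the tangent space at the identity \<open>e\<close>, that is, the type \<open>'e\<close> with the
  following bracket.\<close>

definition left_invariant_field ::
    "('g \<Rightarrow> 'g \<Rightarrow> 'g) \<Rightarrow> 'g \<Rightarrow> ('g, 'e::real_normed_vector) chart set \<Rightarrow> 'e \<Rightarrow> 'g \<Rightarrow> 'e" where
  "left_invariant_field mul e A u p = tangent_map A A (\<lambda>q. mul p q) e u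
     \<comment> \<open>a tangent vector at \<open>mul p e = p\<close>\<close>"

definition lie_bracket ::
    "('g \<Rightarrow> 'g \<Rightarrow> 'g) \<Rightarrow> 'g \<Rightarrow> ('g, 'e::real_normed_vector) chart set \<Rightarrow> 'e \<Rightarrow> 'e \<Rightarrow> 'e" where
  "lie_bracket mul e A u v =
     vf_bracket A (left_invariant_field mul e A u) (left_invariant_field mul e A v) e"

definition lie_center ::
    "('g \<Rightarrow> 'g \<Rightarrow> 'g) \<Rightarrow> 'g \<Rightarrow> ('g, 'e::real_normed_vector) chart set \<Rightarrow> 'e set" where
  "lie_center mul e A = {u. \<forall>v. lie_bracket mul e A u v = 0}"

section \<open>Operators on an inner product space\<close>

definition symmetric_positive_definite ::
    "('e::real_vector \<Rightarrow> 'e \<Rightarrow> real) \<Rightarrow> ('e \<Rightarrow> 'e) \<Rightarrow> bool" where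
  "symmetric_positive_definite \<kappa> \<Lambda> \<longleftrightarrow> linear \<Lambda> \<and> (\<forall>u v. \<kappa> (\<Lambda> u) v = \<kappa> u (\<Lambda> v)) \<and>
     (\<forall>u. u \<noteq> 0 \<longrightarrow> \<kappa> u (\<Lambda> u) > 0)"

definition eigenvalues :: "('e::real_vector \<Rightarrow> 'e) \<Rightarrow> real set" where
  "eigenvalues \<Lambda> = {l. \<exists>v. v \<noteq> 0 \<and> \<Lambda> v = l *\<^sub>R v}"

text \<open>The analogue of \<^const>\<open>onorm\<close> for the norm of an arbitrary inner product.\<close>

definition op_norm :: "('e::real_vector \<Rightarrow> 'e \<Rightarrow> real) \<Rightarrow> ('e \<Rightarrow> 'e) \<Rightarrow> real" where
  "op_norm \<kappa> f = (SUP v. sqrt (\<kappa> (f v) (f v)) / sqrt (\<kappa> v v))"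

end

theory Submission
  imports Defs
begin

text \<open>Let \<open>E\<^sub>u\<close> be the left-invariant field of \<open>u\<close> and \<open>\<gamma>' = E\<^sub>u\<close>.  In the left-invariant frame the
  connection has constant coefficients, the geodesic equation says that the momentum
  \<open>m = \<Lambda> u\<close> satisfies \<open>m' = [m, u]\<close>, and \<open>E\<^sub>v\<close> is a Jacobi field iff \<open>w = v' + [u, v]\<close> satisfies
  \<open>\<Lambda> w' = [m, w] + [\<Lambda> w, u]\<close>.  Hence \<open>p = \<Lambda> w - [m, v]\<close> is parallel for \<open>d/dt + ad u\<close>; since \<open>\<kappa>\<close> is
  \<open>ad\<close>-invariant, this gives \<open>\<kappa>(p, v)' = \<kappa>(\<Lambda> w, w) - \<kappa>([m, v], w)\<close>, the integrand of the index
  form.  As \<open>m\<close> is parallel too, \<open>ad m\<close> is conjugate to \<open>ad (\<Lambda> u\<^sub>0)\<close> by an isometry, so only the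
  spectra of \<open>\<Lambda>\<close> and \<open>ad (\<Lambda> u\<^sub>0)\<close> enter.  The two bounds come from comparing with the problem in
  which \<open>\<Lambda>\<close> is a scalar, where the fields are circles of period \<open>2 \<pi> \<lambda> / \<parallel>ad (\<Lambda> u\<^sub>0)\<parallel>\<close>.\<close>

text \<open>Tangent vectors are components in a chart chosen separately at each point, so a smooth
  field along the geodesic need not be a continuous function into the model space. Left-invariant
  components repair this and leave a linear ODE on the Lie algebra. The obstacle in both bounds is
  the first-order term \<open>br (m t)\<close>, skew and of size \<mu>. For the lower bound it is
  absorbed into the completed square at the cost of \<mu>^2 / (4 l) times
  \<open>\<kappa> v v\<close>; the comparison is thus an oscillator of frequency K = \<mu> / (2 l),
  whose Riccati solution K tan survives on intervals shorter than pi / K = 2 pi l / \<mu>. For the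
  upper bound it makes the index form of a circle run through once at angular speed \<omega> at most
  l \<omega>^2 - \<mu> \<omega> times the length of the interval, negative once \<omega> < \<mu> /
  l. The index argument inverts the fundamental solution, which vanishes at time 0, so the circle
  starts at a small positive time. A least conjugate time exists because the lower bound keeps
  conjugate times away from 0 and injectivity of the fundamental solution is an open
  condition.\<close>

abbreviation fd :: "('a::real_normed_vector \<Rightarrow> 'b::real_normed_vector) \<Rightarrow> 'a \<Rightarrow> 'a \<Rightarrow> 'b" where
  "fd f x \<equiv> frechet_derivative f (at x)"

section \<open>Calculus of \<open>C\<^sup>k\<close> functions\<close>

lemma fd_eqI: "(f has_derivative D) (at x) \<Longrightarrow> fd f x = D"
  by (simp add: frechet_derivative_at [symmetric])

lemma has_derivative_fd: "f differentiable (at x) \<Longrightarrow> (f has_derivative fd f x) (at x)"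
  by (simp add: frechet_derivative_works)

lemma linear_fd: "f differentiable (at x) \<Longrightarrow> linear (fd f x)"
  by (simp add: linear_frechet_derivative)

lemma has_derivative_fd_compose:
  assumes "(f has_derivative f') (at x)" "g differentiable (at (f x))"
  shows "((\<lambda>x. g (f x)) has_derivative (\<lambda>v. fd g (f x) (f' v))) (at x)"
  using has_derivative_compose[of f f' x UNIV g "fd g (f x)"] assms has_derivative_fd by blast

lemma Ck_on_cong:
  assumes "open S" "\<And>x. x \<in> S \<Longrightarrow> f x = g x" "Ck_on k S f"
  shows "Ck_on k S g"
  using assms(2,3)
proof (induction k arbitrary: f g)
  case 0
  then show ?case by (simp cong: continuous_on_cong)
next
  case (Suc k)
  have d: "f differentiable (at x)" if "x \<in> S" for x
    using Suc.prems that by simp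
  have "g differentiable (at x)" if "x \<in> S" for x
    using has_derivative_transform_within_open[of f _ x UNIV S g] d[OF that] \<open>open S\<close> that Suc.prems(1)
    unfolding differentiable_def by blast
  moreover have "Ck_on k S (\<lambda>x. fd g x v)" for v
  proof (rule Suc.IH)
    show "Ck_on k S (\<lambda>x. fd f x v)" using Suc.prems by simp
    show "fd f x v = fd g x v" if "x \<in> S" for x
      using frechet_derivative_transform_within_open[OF d[OF that] \<open>open S\<close> that Suc.prems(1)]
      by metis
  qed
  ultimately show ?case by simp
qed

lemma differentiable_continuous_on:
  "(\<And>x. x \<in> S \<Longrightarrow> f differentiable (at x)) \<Longrightarrow> continuous_on S f"
  by (meson continuous_at_imp_continuous_on differentiable_imp_continuous_within)

lemma Ck_on_SucD: "Ck_on (Suc k) S f \<Longrightarrow> Ck_on k S f"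
  by (induction k arbitrary: f) (auto intro: differentiable_continuous_on)

lemma Ck_on_subset: "Ck_on k S f \<Longrightarrow> T \<subseteq> S \<Longrightarrow> Ck_on k T f"
  by (induction k arbitrary: f) (auto intro: continuous_on_subset)

text \<open>Serves to check smoothness of left-invariant components in whichever chart covers a
  given time.\<close>

lemma Ck_on_local:
  assumes "\<And>x. x \<in> S \<Longrightarrow> \<exists>T. open T \<and> x \<in> T \<and> Ck_on k T f"
  shows "Ck_on k S f"
  using assms
proof (induction k arbitrary: f)
  case 0
  have "isCont f x" if "x \<in> S" for x
    using 0[OF that] by (auto simp: continuous_on_eq_continuous_at)
  then show ?case by (simp add: continuous_at_imp_continuous_on)
next
  case (Suc k)
  have "f differentiable (at x)" if "x \<in> S" for x
    using Suc.prems[OF that] by auto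
  moreover have "Ck_on k S (\<lambda>x. fd f x v)" for v
    by (rule Suc.IH) (use Suc.prems in fastforce)
  ultimately show ?case by simp
qed

lemma Ck_on_const: "Ck_on k S (\<lambda>x. c)"
  by (induction k arbitrary: c) (auto intro: continuous_on_const)

lemma Ck_on_linear: "bounded_linear h \<Longrightarrow> Ck_on k S h"
  by (cases k) (auto simp: linear_continuous_on bounded_linear_imp_differentiable Ck_on_const
      fd_eqI[OF bounded_linear_imp_has_derivative])

lemma Ck_on_linear_comp:
  assumes "bounded_linear h" "open S" "Ck_on k S f"
  shows "Ck_on k S (\<lambda>x. h (f x))"
  using assms(3)
proof (induction k arbitrary: f)
  case 0
  then show ?case
    using assms(1) by (auto intro: continuous_on_compose2 linear_continuous_on)
next
  case (Suc k)
  have d: "((\<lambda>x. h (f x)) has_derivative (\<lambda>v. h (fd f x v))) (at x)" if "x \<in> S" for x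
    by (rule bounded_linear.has_derivative[OF assms(1)]) (use Suc.prems that in \<open>simp add: has_derivative_fd\<close>)
  have "Ck_on k S (\<lambda>x. fd (\<lambda>x. h (f x)) x v)" for v
    by (rule Ck_on_cong[OF assms(2) _ Suc.IH[of "\<lambda>x. fd f x v"]])
      (use Suc.prems in \<open>simp_all add: fd_eqI[OF d]\<close>)
  then show ?case using d by (auto simp: differentiable_def)
qed

lemma Ck_on_add:
  assumes "open S" "Ck_on k S f" "Ck_on k S g"
  shows "Ck_on k S (\<lambda>x. f x + g x)"
  using assms(2,3)
proof (induction k arbitrary: f g)
  case 0
  then show ?case by (simp add: continuous_on_add)
next
  case (Suc k)
  have d: "((\<lambda>x. f x + g x) has_derivative (\<lambda>v. fd f x v + fd g x v)) (at x)" if "x \<in> S" for x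
    by (rule has_derivative_add) (use Suc.prems that in \<open>simp_all add: has_derivative_fd\<close>)
  have "Ck_on k S (\<lambda>x. fd (\<lambda>x. f x + g x) x v)" for v
    by (rule Ck_on_cong[OF assms(1) _ Suc.IH[of "\<lambda>x. fd f x v" "\<lambda>x. fd g x v"]])
      (use Suc.prems in \<open>simp_all add: fd_eqI[OF d]\<close>)
  then show ?case using d by (auto simp: differentiable_def)
qed

lemma Ck_on_sum:
  assumes "open S" "\<And>i. i \<in> I \<Longrightarrow> Ck_on k S (f i)"
  shows "Ck_on k S (\<lambda>x. \<Sum>i\<in>I. f i x)"
  using assms(2)
  by (induction I rule: infinite_finite_induct) (auto intro: Ck_on_const Ck_on_add[OF assms(1)])

lemma Ck_on_bilinear:
  assumes "bounded_bilinear b" "open S" "Ck_on k S f" "Ck_on k S g"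
  shows "Ck_on k S (\<lambda>x. b (f x) (g x))"
  using assms(3,4)
proof (induction k arbitrary: f g)
  case 0
  then show ?case by (simp add: bounded_bilinear.continuous_on[OF assms(1)])
next
  case (Suc k)
  have d: "((\<lambda>x. b (f x) (g x)) has_derivative (\<lambda>v. b (f x) (fd g x v) + b (fd f x v) (g x))) (at x)"
    if "x \<in> S" for x
    by (rule bounded_bilinear.FDERIV[OF assms(1)])
      (use Suc.prems that in \<open>simp_all add: has_derivative_fd\<close>)
  have "Ck_on k S (\<lambda>x. fd (\<lambda>x. b (f x) (g x)) x v)" for v
  proof (rule Ck_on_cong[OF assms(2)])
    show "Ck_on k S (\<lambda>x. b (f x) (fd g x v) + b (fd f x v) (g x))"
      using Suc.prems Suc.prems[THEN Ck_on_SucD]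
      by (intro Ck_on_add Suc.IH assms) simp_all
  qed (simp add: fd_eqI[OF d])
  then show ?case using d by (auto simp: differentiable_def)
qed

lemmas Ck_on_scaleR = Ck_on_bilinear[OF bounded_bilinear_scaleR]

lemma Ck_on_inner_left: "open S \<Longrightarrow> Ck_on k S f \<Longrightarrow> Ck_on k S (\<lambda>x. f x \<bullet> b)"
  by (rule Ck_on_linear_comp[OF bounded_linear_inner_left])

lemma linear_basis_expand:
  fixes x :: "'a::euclidean_space"
  assumes "linear f"
  shows "f x = (\<Sum>b\<in>Basis. (x \<bullet> b) *\<^sub>R f b)"
proof -
  have "f x = f (\<Sum>b\<in>Basis. (x \<bullet> b) *\<^sub>R b)"
    by (simp add: euclidean_representation)
  then show ?thesis
    by (simp add: linear_sum[OF assms] linear_cmul[OF assms])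
qed

text \<open>The family \<open>E\<close> of linear maps is only known to be C^k after application to
  a fixed vector. Expanding the argument in the finite basis turns the application into a sum of
  products, so no norm on a space of linear maps is needed.\<close>

lemma Ck_on_apply:
  fixes g :: "'a::real_normed_vector \<Rightarrow> 'b::euclidean_space"
  assumes "open S" "\<And>x. x \<in> S \<Longrightarrow> linear (E x)" "\<And>b. Ck_on k S (\<lambda>x. E x b)" "Ck_on k S g"
  shows "Ck_on k S (\<lambda>x. E x (g x))"
proof (rule Ck_on_cong[OF assms(1)])
  show "Ck_on k S (\<lambda>x. \<Sum>b\<in>Basis. (g x \<bullet> b) *\<^sub>R E x b)"
    by (intro Ck_on_sum Ck_on_scaleR Ck_on_inner_left assms)
  show "(\<Sum>b\<in>Basis. (g x \<bullet> b) *\<^sub>R E x b) = E x (g x)" if "x \<in> S" for x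
    using linear_basis_expand[OF assms(2)[OF that], of "g x"] by simp
qed

text \<open>The product rule for a family of linear maps, by the same basis expansion.
  \<open>E' b\<close> is the derivative with the argument frozen at \<open>b\<close>; its linearity
  in \<open>b\<close> reassembles the sum.\<close>

lemma has_derivative_apply:
  fixes g :: "'a::real_normed_vector \<Rightarrow> 'b::euclidean_space"
  assumes "open S" "x \<in> S" "\<And>y. y \<in> S \<Longrightarrow> linear (E y)"
    and E: "\<And>b. ((\<lambda>y. E y b) has_derivative E' b) (at x)" and "linear (\<lambda>b. E' b v)"
    and g: "(g has_derivative g') (at x)"
  shows "fd (\<lambda>y. E y (g y)) x v = E x (g' v) + E' (g x) v"
    and "(\<lambda>y. E y (g y)) differentiable (at x)"
proof -
  let ?D = "\<lambda>v. \<Sum>b\<in>Basis. (g x \<bullet> b) *\<^sub>R E' b v + (g' v \<bullet> b) *\<^sub>R E x b"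
  have "((\<lambda>y. \<Sum>b\<in>Basis. (g y \<bullet> b) *\<^sub>R E y b) has_derivative ?D) (at x)"
    by (intro has_derivative_sum has_derivative_scaleR has_derivative_inner_left g E)
  then have d: "((\<lambda>y. E y (g y)) has_derivative ?D) (at x)"
    by (rule has_derivative_transform_within_open[OF _ assms(1,2)])
      (rule linear_basis_expand[OF assms(3), symmetric])
  then show "(\<lambda>y. E y (g y)) differentiable (at x)" by (auto simp: differentiable_def)
  show "fd (\<lambda>y. E y (g y)) x v = E x (g' v) + E' (g x) v"
    unfolding fd_eqI[OF d] sum.distrib
    using linear_basis_expand[OF assms(3)[OF assms(2)], of "g' v"]
      linear_basis_expand[OF assms(5), of "g x"] by simp
qed

text \<open>By the chain rule the derivative is a linear map depending on the point, applied to
  another C^k map. This is the situation of \<open>Ck_on_apply\<close>, and the induction hypothesis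
  is used for the directional derivatives of \<open>g\<close>.\<close>

lemma Ck_on_compose:
  fixes f :: "'a::real_normed_vector \<Rightarrow> 'b::euclidean_space"
  assumes "open S" "open T" "f ` S \<subseteq> T" "Ck_on k S f" "Ck_on k T g"
  shows "Ck_on k S (\<lambda>x. g (f x))"
  using assms(4,5)
proof (induction k arbitrary: g)
  case 0
  then show ?case using assms(3) by (auto intro: continuous_on_compose2)
next
  case (Suc k)
  have g: "g differentiable (at (f x))" if "x \<in> S" for x
    using Suc.prems that assms(3) by auto
  have d: "((\<lambda>x. g (f x)) has_derivative (\<lambda>v. fd g (f x) (fd f x v))) (at x)" if "x \<in> S" for x
    using has_derivative_fd_compose[of f "fd f x" x g] g[OF that] Suc.prems that
    by (simp add: has_derivative_fd)
  have "Ck_on k S (\<lambda>x. fd (\<lambda>x. g (f x)) x v)" for v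
  proof (rule Ck_on_cong[OF assms(1)])
    show "Ck_on k S (\<lambda>x. fd g (f x) (fd f x v))"
    proof (rule Ck_on_apply[OF assms(1)])
      show "Ck_on k S (\<lambda>x. fd g (f x) b)" for b
        by (rule Suc.IH[of "\<lambda>y. fd g y b"]) (use Suc.prems Ck_on_SucD in auto)
    qed (use Suc.prems g linear_fd in auto)
  qed (simp add: fd_eqI[OF d])
  then show ?case using d by (auto simp: differentiable_def)
qed

lemma smooth_onD: "smooth_on S f \<Longrightarrow> Ck_on k S f"
  by (simp add: smooth_on_def)

lemma smooth_on_fd: "smooth_on S f \<Longrightarrow> smooth_on S (\<lambda>x. fd f x v)"
  unfolding smooth_on_def using Ck_on.simps(2) by blast

lemma smooth_on_differentiable: "smooth_on S f \<Longrightarrow> x \<in> S \<Longrightarrow> f differentiable (at x)"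
  unfolding smooth_on_def using Ck_on.simps(2) by blast

lemma smooth_on_cong: "open S \<Longrightarrow> (\<And>x. x \<in> S \<Longrightarrow> f x = g x) \<Longrightarrow> smooth_on S f \<Longrightarrow> smooth_on S g"
  unfolding smooth_on_def using Ck_on_cong by blast

lemma smooth_on_subset: "smooth_on S f \<Longrightarrow> T \<subseteq> S \<Longrightarrow> smooth_on T f"
  unfolding smooth_on_def using Ck_on_subset by blast

lemma smooth_on_compose:
  fixes f :: "'a::real_normed_vector \<Rightarrow> 'b::euclidean_space"
  assumes "open S" "open T" "f ` S \<subseteq> T" "smooth_on S f" "smooth_on T g"
  shows "smooth_on S (\<lambda>x. g (f x))"
  using assms unfolding smooth_on_def by (auto intro: Ck_on_compose[OF assms(1-3)])

lemma smooth_on_apply: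
  fixes g :: "'a::real_normed_vector \<Rightarrow> 'b::euclidean_space"
  assumes "open S" "\<And>x. x \<in> S \<Longrightarrow> linear (E x)" "\<And>b. smooth_on S (\<lambda>x. E x b)" "smooth_on S g"
  shows "smooth_on S (\<lambda>x. E x (g x))"
  using assms unfolding smooth_on_def by (auto intro: Ck_on_apply[OF assms(1,2)])

section \<open>Symmetry of second derivatives\<close>

definition second_difference :: "('a::real_vector \<Rightarrow> real) \<Rightarrow> 'a \<Rightarrow> 'a \<Rightarrow> 'a \<Rightarrow> real \<Rightarrow> real" where
  "second_difference f x v w t
    = f (x + t *\<^sub>R v + t *\<^sub>R w) - f (x + t *\<^sub>R v) - f (x + t *\<^sub>R w) + f x"

text \<open>The second difference is an increment of an increment: the mean value theorem, applied
  in the direction \<open>v\<close> and then in the direction \<open>w\<close>, gives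
  \<open>t\<close> squared times the mixed derivative at an intermediate point, and continuity of
  that derivative does the rest.\<close>

lemma second_difference_limit:
  fixes f :: "'a::real_normed_vector \<Rightarrow> real"
  assumes S: "open S" "x \<in> S" and f: "Ck_on 2 S f" and e: "e > 0"
  obtains d where "d > 0" "\<And>t. 0 < t \<Longrightarrow> t < d \<Longrightarrow>
    \<bar>second_difference f x v w t - t\<^sup>2 * fd (\<lambda>y. fd f y v) x w\<bar> \<le> t\<^sup>2 * e"
proof -
  have f1: "f differentiable (at y)" if "y \<in> S" for y
    using f that by (simp add: numeral_2_eq_2)
  have f2: "(\<lambda>y. fd f y v) differentiable (at y)" if "y \<in> S" for y
    using f that by (simp add: numeral_2_eq_2)
  have f3: "continuous_on S (\<lambda>y. fd (\<lambda>y. fd f y v) y w)"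
    using f by (simp add: numeral_2_eq_2)
  obtain r where r: "r > 0" "ball x r \<subseteq> S" using S open_contains_ball by blast
  have "isCont (\<lambda>y. fd (\<lambda>y. fd f y v) y w) x"
    using f3 S continuous_on_eq_continuous_at by blast
  then obtain r' where r': "r' > 0"
    "\<And>y. dist y x < r' \<Longrightarrow> dist (fd (\<lambda>y. fd f y v) y w) (fd (\<lambda>y. fd f y v) x w) < e"
    unfolding continuous_at_eps_delta using e by blast
  \<comment> \<open>Both intermediate parameters stay below \<open>d\<close>, which keeps the point
    within \<open>r\<close> and \<open>r'\<close> of \<open>x\<close>; the summand 1 avoids a zero
    denominator when \<open>v\<close> and \<open>w\<close> vanish.\<close>
  define d where "d = min r r' / (norm v + norm w + 1)"
  have near: "x + s *\<^sub>R v + q *\<^sub>R w \<in> S \<and> dist (x + s *\<^sub>R v + q *\<^sub>R w) x < r'"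
    if "0 \<le> s" "s < d" "0 \<le> q" "q < d" for s q
  proof -
    have "dist (x + s *\<^sub>R v + q *\<^sub>R w) x = norm (s *\<^sub>R v + q *\<^sub>R w)"
      by (simp add: dist_norm add.assoc)
    also have "\<dots> \<le> s * norm v + q * norm w"
      using norm_triangle_ineq[of "s *\<^sub>R v" "q *\<^sub>R w"] that by simp
    also have "\<dots> \<le> d * norm v + d * norm w"
      using that by (intro add_mono mult_right_mono) auto
    also have "\<dots> < d * (norm v + norm w + 1)"
      using that by (simp add: algebra_simps)
    also have "\<dots> = min r r'"
    proof -
      have "norm v + norm w + 1 \<noteq> 0" using norm_ge_zero[of v] norm_ge_zero[of w] by linarith
      then show ?thesis by (simp add: d_def)
    qed
    finally show ?thesis using r by (auto simp: dist_commute)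
  qed
  have key: "\<bar>second_difference f x v w t - t\<^sup>2 * fd (\<lambda>y. fd f y v) x w\<bar> \<le> t\<^sup>2 * e" if t: "0 < t" "t < d" for t
  proof -
    \<comment> \<open>The term with coefficient 0 gives both values of \<open>f\<close> the shape
      treated in \<open>g1\<close>, once with \<open>q = t\<close> and once with
      \<open>q = 0\<close>, so that the derivative of \<open>g\<close> is again an increment in
      \<open>q\<close>.\<close>
    define g where "g s = f (x + s *\<^sub>R v + t *\<^sub>R w) - f (x + s *\<^sub>R v + 0 *\<^sub>R w)" for s
    have g1: "((\<lambda>s. f (x + s *\<^sub>R v + q *\<^sub>R w)) has_real_derivative
        fd f (x + s *\<^sub>R v + q *\<^sub>R w) v) (at s)" if "0 \<le> s" "s \<le> t" "0 \<le> q" "q \<le> t" for s q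
    proof -
      have "((\<lambda>s. f (x + s *\<^sub>R v + q *\<^sub>R w)) has_derivative
        (\<lambda>h. fd f (x + s *\<^sub>R v + q *\<^sub>R w) (h *\<^sub>R v))) (at s)"
        by (rule has_derivative_fd_compose[OF _ f1])
          (use near that t in \<open>auto intro!: derivative_eq_intros\<close>)
      moreover have "linear (fd f (x + s *\<^sub>R v + q *\<^sub>R w))"
        using near that t by (intro linear_fd f1) auto
      ultimately show ?thesis
        by (simp add: has_field_derivative_def linear_cmul mult.commute[of _ "fd f _ v"])
    qed
    have "(g has_real_derivative fd f (x + s *\<^sub>R v + t *\<^sub>R w) v - fd f (x + s *\<^sub>R v + 0 *\<^sub>R w) v) (at s)"
      if "0 \<le> s" "s \<le> t" for s
      unfolding g_def by (rule DERIV_diff; rule g1) (use that t in auto)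
    from MVT2[OF t(1) this] obtain s where s: "0 < s" "s < t" "g t - g 0 = (t - 0) *
        (fd f (x + s *\<^sub>R v + t *\<^sub>R w) v - fd f (x + s *\<^sub>R v + 0 *\<^sub>R w) v)"
      by auto
    have g2: "((\<lambda>q. fd f (x + s *\<^sub>R v + q *\<^sub>R w) v) has_real_derivative
        fd (\<lambda>y. fd f y v) (x + s *\<^sub>R v + q *\<^sub>R w) w) (at q)" if "0 \<le> q" "q \<le> t" for q
    proof -
      have "((\<lambda>q. fd f (x + s *\<^sub>R v + q *\<^sub>R w) v) has_derivative
        (\<lambda>h. fd (\<lambda>y. fd f y v) (x + s *\<^sub>R v + q *\<^sub>R w) (h *\<^sub>R w))) (at q)"
        by (rule has_derivative_fd_compose[OF _ f2])
          (use near that t s in \<open>auto intro!: derivative_eq_intros\<close>)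
      moreover have "linear (fd (\<lambda>y. fd f y v) (x + s *\<^sub>R v + q *\<^sub>R w))"
        using near that t s by (intro linear_fd f2) auto
      ultimately show ?thesis
        by (simp add: has_field_derivative_def linear_cmul mult.commute[of _ "fd _ _ w"])
    qed
    from MVT2[OF t(1) this] obtain q where q: "0 < q" "q < t"
      "fd f (x + s *\<^sub>R v + t *\<^sub>R w) v - fd f (x + s *\<^sub>R v + 0 *\<^sub>R w) v =
        (t - 0) * fd (\<lambda>y. fd f y v) (x + s *\<^sub>R v + q *\<^sub>R w) w"
      by auto
    have "second_difference f x v w t = g t - g 0"
      by (simp add: second_difference_def g_def)
    also have "\<dots> = t\<^sup>2 * fd (\<lambda>y. fd f y v) (x + s *\<^sub>R v + q *\<^sub>R w) w"
      using s(3) q(3) by (simp add: power2_eq_square)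
    finally have *: "second_difference f x v w t - t\<^sup>2 * fd (\<lambda>y. fd f y v) x w
      = t\<^sup>2 * (fd (\<lambda>y. fd f y v) (x + s *\<^sub>R v + q *\<^sub>R w) w - fd (\<lambda>y. fd f y v) x w)"
      by (simp only: right_diff_distrib)
    have "dist (fd (\<lambda>y. fd f y v) (x + s *\<^sub>R v + q *\<^sub>R w) w) (fd (\<lambda>y. fd f y v) x w) < e"
      by (rule r'(2)) (use near s q t in auto)
    then show ?thesis
      unfolding * abs_mult by (simp add: dist_real_def mult_left_mono)
  qed
  have "d > 0"
    unfolding d_def using r r' by (intro divide_pos_pos) (auto intro: add_nonneg_pos)
  then show thesis using that key by blast
qed

text \<open>The second difference is unchanged when \<open>v\<close> and \<open>w\<close> are
  exchanged, so both mixed derivatives are limits of the same quotient.\<close>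

lemma symmetric_second_derivative_real:
  fixes f :: "'a::real_normed_vector \<Rightarrow> real"
  assumes "open S" "x \<in> S" "Ck_on 2 S f"
  shows "fd (\<lambda>y. fd f y v) x w = fd (\<lambda>y. fd f y w) x v"
proof (rule ccontr)
  define a b where "a = fd (\<lambda>y. fd f y v) x w" and "b = fd (\<lambda>y. fd f y w) x v"
  assume "fd (\<lambda>y. fd f y v) x w \<noteq> fd (\<lambda>y. fd f y w) x v"
  \<comment> \<open>Two errors of one third of the gap cannot bridge the gap.\<close>
  then have e: "\<bar>a - b\<bar> / 3 > 0" by (simp add: a_def b_def)
  obtain d1 where d1: "d1 > 0" "\<And>t. 0 < t \<Longrightarrow> t < d1 \<Longrightarrow> \<bar>second_difference f x v w t - t\<^sup>2 * a\<bar> \<le> t\<^sup>2 * (\<bar>a - b\<bar> / 3)"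
    using second_difference_limit[OF assms e, of v w] unfolding a_def by blast
  obtain d2 where d2: "d2 > 0" "\<And>t. 0 < t \<Longrightarrow> t < d2 \<Longrightarrow>
    \<bar>second_difference f x w v t - t\<^sup>2 * b\<bar> \<le> t\<^sup>2 * (\<bar>a - b\<bar> / 3)"
    using second_difference_limit[OF assms e, of w v] unfolding b_def by blast
  define t where "t = min d1 d2 / 2"
  have t: "0 < t" "t < d1" "t < d2" using d1(1) d2(1) by (auto simp: t_def min_def)
  have "second_difference f x v w t = second_difference f x w v t"
    by (simp add: second_difference_def algebra_simps)
  then have "\<bar>t\<^sup>2 * a - t\<^sup>2 * b\<bar> \<le> t\<^sup>2 * (\<bar>a - b\<bar> / 3) + t\<^sup>2 * (\<bar>a - b\<bar> / 3)"
    using d1(2)[of t] d2(2)[of t] t by linarith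
  moreover have "\<bar>t\<^sup>2 * a - t\<^sup>2 * b\<bar> = t\<^sup>2 * \<bar>a - b\<bar>"
    by (simp add: right_diff_distrib[symmetric] abs_mult)
  moreover have "t\<^sup>2 * \<bar>a - b\<bar> > 0" using t e by simp
  ultimately show False by linarith
qed

lemma symmetric_second_derivative:
  fixes f :: "'a::real_normed_vector \<Rightarrow> 'b::euclidean_space"
  assumes S: "open S" "x \<in> S" and f: "Ck_on 2 S f"
  shows "fd (\<lambda>y. fd f y v) x w = fd (\<lambda>y. fd f y w) x v"
proof (rule euclidean_eqI)
  fix b :: 'b assume "b \<in> Basis"
  have f1: "f differentiable (at y)" if "y \<in> S" for y
    using f that by (simp add: numeral_2_eq_2)
  have 1: "fd (\<lambda>y. f y \<bullet> b) y v = fd f y v \<bullet> b" if "y \<in> S" for y v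
    using fd_eqI[OF has_derivative_inner_left[OF has_derivative_fd[OF f1[OF that]]]] by metis
  have 2: "fd (\<lambda>y. fd (\<lambda>y. f y \<bullet> b) y v) x w = fd (\<lambda>y. fd f y v) x w \<bullet> b" for v w
  proof -
    have "(\<lambda>y. fd f y v) differentiable (at x)" using f S by (simp add: numeral_2_eq_2)
    then have "((\<lambda>y. fd f y v \<bullet> b) has_derivative (\<lambda>w. fd (\<lambda>y. fd f y v) x w \<bullet> b)) (at x)"
      by (intro has_derivative_inner_left has_derivative_fd)
    then have "((\<lambda>y. fd (\<lambda>y. f y \<bullet> b) y v) has_derivative (\<lambda>w. fd (\<lambda>y. fd f y v) x w \<bullet> b)) (at x)"
      by (rule has_derivative_transform_within_open[OF _ S]) (simp add: 1)
    then show ?thesis by (simp add: fd_eqI)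
  qed
  show "fd (\<lambda>y. fd f y v) x w \<bullet> b = fd (\<lambda>y. fd f y w) x v \<bullet> b"
    unfolding 2[symmetric]
    by (rule symmetric_second_derivative_real[OF S Ck_on_inner_left[OF S(1) f]])
qed

section \<open>Inverses of families of linear maps\<close>

text \<open>An injective linear map between finite-dimensional spaces is bounded below by some
  \<open>B\<close>; where the maps differ from \<open>E x0\<close> by less than \<open>B / 2\<close>
  in total on the basis, half of that bound survives.\<close>

lemma linear_family_bounded_below:
  fixes E :: "'a::real_normed_vector \<Rightarrow> 'b::euclidean_space \<Rightarrow> 'c::euclidean_space"
  assumes S: "open S" "x0 \<in> S" and lin: "\<And>x. x \<in> S \<Longrightarrow> linear (E x)" and inj: "inj (E x0)"
    and cont: "\<And>b. isCont (\<lambda>x. E x b) x0"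
  obtains T d where "open T" "x0 \<in> T" "T \<subseteq> S" "d > 0" "\<And>x v. x \<in> T \<Longrightarrow> d * norm v \<le> norm (E x v)"
proof -
  obtain B where B: "B > 0" "\<And>v. B * norm v \<le> norm (E x0 v)"
    using linear_inj_bounded_below_pos[OF lin[OF S(2)] inj] by blast
  have "((\<lambda>x. \<Sum>b\<in>Basis. norm (E x b - E x0 b)) \<longlongrightarrow> (\<Sum>b\<in>Basis. norm (E x0 b - E x0 b))) (at x0)"
    by (intro tendsto_intros) (use cont in \<open>simp add: isCont_def\<close>)
  then have "\<forall>\<^sub>F x in at x0. (\<Sum>b\<in>Basis. norm (E x b - E x0 b)) < B / 2"
    by (rule order_tendstoD(2)) (use B in simp)
  then have "\<forall>\<^sub>F x in nhds x0. (\<Sum>b\<in>Basis. norm (E x b - E x0 b)) < B / 2"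
    unfolding eventually_nhds_conv_at using B by simp
  then obtain T where T: "open T" "x0 \<in> T" "\<And>x. x \<in> T \<Longrightarrow> (\<Sum>b\<in>Basis. norm (E x b - E x0 b)) < B / 2"
    unfolding eventually_nhds by blast
  have "B / 2 * norm v \<le> norm (E x v)" if x: "x \<in> T \<inter> S" for x v
  proof -
    have "E x v - E x0 v = (\<Sum>b\<in>Basis. (v \<bullet> b) *\<^sub>R (E x b - E x0 b))"
      using linear_basis_expand[OF lin, of x v] linear_basis_expand[OF lin[OF S(2)], of v] x
      by (simp add: sum_subtractf scaleR_diff_right)
    also have "norm \<dots> \<le> (\<Sum>b\<in>Basis. norm v * norm (E x b - E x0 b))"
      by (rule sum_norm_le) (simp add: mult_right_mono Basis_le_norm)
    also have "\<dots> \<le> norm v * (B / 2)"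
      unfolding sum_distrib_left[symmetric] using T(3)[of x] x by (intro mult_left_mono) auto
    finally show ?thesis using B(2)[of v] norm_triangle_ineq2[of "E x0 v" "E x v"]
      by (simp add: norm_minus_commute algebra_simps)
  qed
  then show thesis
    using that[of "T \<inter> S" "B / 2"] T S B by auto
qed

text \<open>Because the scalar factor vanishes at \<open>x\<close>, the vector factor need only be
  continuous there. This allows inverses to be differentiated before they are known to be
  differentiable.\<close>

lemma has_derivative_scaleR_zero:
  fixes g :: "'a::real_normed_vector \<Rightarrow> real" and k :: "'a \<Rightarrow> 'b::real_normed_vector"
  assumes g: "(g has_derivative g') (at x)" "g x = 0" and k: "isCont k x"
  shows "((\<lambda>y. g y *\<^sub>R k y) has_derivative (\<lambda>h. g' h *\<^sub>R k x)) (at x)"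
proof -
  have bl: "bounded_linear g'" using g(1) by (rule has_derivative_bounded_linear)
  obtain C where C: "C > 0" "\<And>h. norm (g' h) \<le> norm h * C"
    using bounded_linear.pos_bounded[OF bl] by blast
  have "((\<lambda>y. g y *\<^sub>R (k y - k x)) has_derivative (\<lambda>h. 0)) (at x)"
    unfolding has_derivative_at_alt
  proof (intro conjI allI impI)
    fix e :: real assume e: "e > 0"
    have "\<forall>e>0. \<exists>d>0. \<forall>y. norm (y - x) < d \<longrightarrow> norm (g y - g x - g' (y - x)) \<le> e * norm (y - x)"
      using g(1) unfolding has_derivative_at_alt by simp
    from this[rule_format, OF zero_less_one]
    obtain d1 where d1: "d1 > 0" "\<And>y. norm (y - x) < d1 \<Longrightarrow> norm (g y - g x - g' (y - x)) \<le> 1 * norm (y - x)"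
      by auto
    have "e / (C + 1) > 0" using C e by simp
    with k obtain d2 where d2: "d2 > 0" "\<And>y. dist y x < d2 \<Longrightarrow> dist (k y) (k x) < e / (C + 1)"
      unfolding continuous_at_eps_delta by auto
    have "norm (g y *\<^sub>R (k y - k x)) \<le> e * norm (y - x)" if y: "norm (y - x) < min d1 d2" for y
    proof -
      have "norm (g y) \<le> norm (g' (y - x)) + norm (y - x)"
        using d1(2)[of y] y g(2) by (simp; linarith)
      also have "\<dots> \<le> norm (y - x) * (C + 1)" using C(2)[of "y - x"] by (simp add: algebra_simps)
      finally have "norm (g y) * norm (k y - k x) \<le> (norm (y - x) * (C + 1)) * (e / (C + 1))"
        using d2(2)[of y] y C e by (intro mult_mono) (auto simp: dist_norm)
      also have "\<dots> = e * norm (y - x)" using C by simp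
      finally show ?thesis by simp
    qed
    then show "\<exists>d>0. \<forall>y. norm (y - x) < d \<longrightarrow>
        norm (g y *\<^sub>R (k y - k x) - g x *\<^sub>R (k x - k x) - 0) \<le> e * norm (y - x)"
      using d1 d2 by (intro exI[of _ "min d1 d2"]) auto
  qed simp
  from has_derivative_add[OF this has_derivative_scaleR_left[OF g(1), of "k x"]]
  show ?thesis by (simp add: scaleR_diff_right)
qed

lemma linear_inj_inv:
  fixes f :: "'b::euclidean_space \<Rightarrow> 'b"
  assumes "linear f" "inj f"
  shows "linear (inv f)" "f (inv f y) = y" "inv f (f x) = x"
proof -
  have s: "surj f" using linear_injective_imp_surjective assms by blast
  show 1: "f (inv f y) = y" for y using s by (rule surj_f_inv_f)
  show 2: "inv f (f x) = x" for x using assms by simp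
  show "linear (inv f)"
    by (rule linearI; rule injD[OF assms(2)]) (simp_all add: 1 linear_add[OF assms(1)] linear_cmul[OF assms(1)])
qed

text \<open>The error \<open>inv (E x) w - v\<close> is mapped by \<open>E x\<close> to the small
  vector \<open>E x0 v - E x v\<close>, and \<open>E x\<close> is bounded below uniformly near
  \<open>x0\<close>.\<close>

lemma isCont_inverse_family:
  fixes E :: "'a::real_normed_vector \<Rightarrow> 'b::euclidean_space \<Rightarrow> 'b"
  assumes S: "open S" "x0 \<in> S" and lin: "\<And>x. x \<in> S \<Longrightarrow> linear (E x)"
    and inj: "\<And>x. x \<in> S \<Longrightarrow> inj (E x)" and cont: "\<And>b. isCont (\<lambda>x. E x b) x0"
  shows "isCont (\<lambda>x. inv (E x) w) x0"
proof -
  obtain T d where T: "open T" "x0 \<in> T" "T \<subseteq> S" "d > 0" "\<And>x v. x \<in> T \<Longrightarrow> d * norm v \<le> norm (E x v)"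
    using linear_family_bounded_below[OF S lin inj[OF S(2)] cont] by metis
  define v where "v = inv (E x0) w"
  have v: "E x0 v = w" unfolding v_def using S lin inj by (simp add: linear_inj_inv)
  have b: "norm (inv (E x) w - v) \<le> norm (E x0 v - E x v) / d" if x: "x \<in> T" for x
  proof -
    have "E x (inv (E x) w - v) = E x0 v - E x v"
      using x T lin inj v by (simp add: linear_diff linear_inj_inv subset_iff)
    then have "d * norm (inv (E x) w - v) \<le> norm (E x0 v - E x v)"
      using T(5)[OF x, of "inv (E x) w - v"] by simp
    then show ?thesis using T(4) by (simp add: pos_le_divide_eq mult.commute)
  qed
  have "((\<lambda>x. norm (E x0 v - E x v) / d) \<longlongrightarrow> norm (E x0 v - E x0 v) / d) (at x0)"
    using cont[of v] T(4) by (intro tendsto_intros) (simp_all add: isCont_def)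
  moreover have "\<forall>\<^sub>F x in at x0. norm (inv (E x) w - v) \<le> norm (norm (E x0 v - E x v) / d) * 1"
    unfolding eventually_at_topological using T(1,2,4) b by (intro exI[of _ T]) auto
  ultimately have "((\<lambda>x. inv (E x) w - v) \<longlongrightarrow> 0) (at x0)"
    by (intro tendsto_0_le[of "\<lambda>x. norm (E x0 v - E x v) / d" "at x0" "\<lambda>x. inv (E x) w - v" 1])
      (simp_all only: diff_self norm_zero div_0)
  then show ?thesis unfolding isCont_def v_def by (rule LIM_zero_cancel)
qed

text \<open>Rests on the identity \<open>inv (E x) w = v + inv (E x) (E x0 v - E x v)\<close> with
  \<open>v = inv (E x0) w\<close>. The inner difference vanishes at \<open>x0\<close>, so
  \<open>has_derivative_scaleR_zero\<close> applies to each of its components and continuity of the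
  inverses suffices.\<close>

lemma has_derivative_inverse_family:
  fixes E :: "'a::real_normed_vector \<Rightarrow> 'b::euclidean_space \<Rightarrow> 'b"
  assumes S: "open S" "x0 \<in> S" and lin: "\<And>x. x \<in> S \<Longrightarrow> linear (E x)"
    and inj: "\<And>x. x \<in> S \<Longrightarrow> inj (E x)" and D: "\<And>b. (\<lambda>x. E x b) differentiable (at x0)"
  shows "((\<lambda>x. inv (E x) w) has_derivative
    (\<lambda>h. - inv (E x0) (fd (\<lambda>x. E x (inv (E x0) w)) x0 h))) (at x0)"
proof -
  have cont: "isCont (\<lambda>x. E x b) x0" for b
    using D by (rule differentiable_imp_continuous_within)
  define v where "v = inv (E x0) w"
  have v: "E x0 v = w" unfolding v_def using S lin inj by (simp add: linear_inj_inv)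
  have "((\<lambda>x. (\<Sum>b\<in>Basis. ((E x0 v - E x v) \<bullet> b) *\<^sub>R inv (E x) b) + v) has_derivative
      (\<lambda>h. (\<Sum>b\<in>Basis. ((0 - fd (\<lambda>x. E x v) x0 h) \<bullet> b) *\<^sub>R inv (E x0) b) + 0)) (at x0)"
    by (intro has_derivative_add has_derivative_sum has_derivative_scaleR_zero has_derivative_const
        isCont_inverse_family[OF S lin inj cont] has_derivative_inner_left has_derivative_diff
        has_derivative_fd D) simp_all
  then have "((\<lambda>x. inv (E x) w) has_derivative
      (\<lambda>h. (\<Sum>b\<in>Basis. ((0 - fd (\<lambda>x. E x v) x0 h) \<bullet> b) *\<^sub>R inv (E x0) b) + 0)) (at x0)"
  proof (rule has_derivative_transform_within_open[OF _ S])
    fix x assume x: "x \<in> S"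
    show "(\<Sum>b\<in>Basis. ((E x0 v - E x v) \<bullet> b) *\<^sub>R inv (E x) b) + v = inv (E x) w"
      using linear_basis_expand[of "inv (E x)" "E x0 v - E x v"] x lin inj
      by (simp add: linear_inj_inv v linear_diff diff_eq_eq)
  qed
  then show ?thesis
    using linear_basis_expand[of "inv (E x0)" "0 - fd (\<lambda>x. E x v) x0 h" for h] S lin inj
    by (simp add: linear_inj_inv v_def linear_neg)
qed

lemma linear_fd_family:
  assumes S: "open S" "x \<in> S" and lin: "\<And>y. y \<in> S \<Longrightarrow> linear (E y)"
    and D: "\<And>b. (\<lambda>y. E y b) differentiable (at x)"
  shows "linear (\<lambda>b. fd (\<lambda>y. E y b) x h)"
proof (rule linearI)
  fix b c r
  have "((\<lambda>y. E y (b + c)) has_derivative (\<lambda>h. fd (\<lambda>y. E y b) x h + fd (\<lambda>y. E y c) x h)) (at x)"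
    by (rule has_derivative_transform_within_open[OF
        has_derivative_add[OF has_derivative_fd[OF D] has_derivative_fd[OF D]] S])
      (simp add: linear_add[OF lin])
  then show "fd (\<lambda>y. E y (b + c)) x h = fd (\<lambda>y. E y b) x h + fd (\<lambda>y. E y c) x h"
    by (simp add: fd_eqI)
  have "((\<lambda>y. E y (r *\<^sub>R b)) has_derivative (\<lambda>h. r *\<^sub>R fd (\<lambda>y. E y b) x h)) (at x)"
    by (rule has_derivative_transform_within_open[OF
        has_derivative_scaleR_right[OF has_derivative_fd[OF D]] S])
      (simp add: linear_cmul[OF lin])
  then show "fd (\<lambda>y. E y (r *\<^sub>R b)) x h = r *\<^sub>R fd (\<lambda>y. E y b) x h"
    by (simp add: fd_eqI)
qed

text \<open>A bootstrap: the derivative of the inverse is built from the inverse and one derivative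
  of \<open>E\<close>, so regularity rises one order at a time.\<close>

lemma Ck_on_inverse_family:
  fixes E :: "'a::real_normed_vector \<Rightarrow> 'b::euclidean_space \<Rightarrow> 'b"
  assumes S: "open S" and lin: "\<And>x. x \<in> S \<Longrightarrow> linear (E x)"
    and inj: "\<And>x. x \<in> S \<Longrightarrow> inj (E x)" and E: "\<And>b. Ck_on k S (\<lambda>x. E x b)"
  shows "Ck_on k S (\<lambda>x. inv (E x) w)"
  using E
proof (induction k arbitrary: w)
  case 0
  then have "isCont (\<lambda>x. E x b) x" if "x \<in> S" for x b
    using that S by (simp add: continuous_on_eq_continuous_at)
  then have "isCont (\<lambda>x. inv (E x) w) x" if "x \<in> S" for x
    using isCont_inverse_family[where E = E, OF S that lin inj] that by simp
  then show ?case by (simp add: continuous_at_imp_continuous_on)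
next
  case (Suc k)
  have diff: "(\<lambda>x. E x b) differentiable (at x)" if "x \<in> S" for x b
    using Suc.prems that by simp
  note d = has_derivative_inverse_family[OF S _ lin inj diff]
  have IH: "Ck_on k S (\<lambda>x. inv (E x) w)" for w
    by (rule Suc.IH) (rule Ck_on_SucD[OF Suc.prems])
  have "Ck_on k S (\<lambda>x. fd (\<lambda>x. inv (E x) w) x h)" for h
  proof (rule Ck_on_cong[OF S])
    have "Ck_on k S (\<lambda>x. fd (\<lambda>y. E y (inv (E x) w)) x h)"
    proof (rule Ck_on_apply[where E = "\<lambda>x b. fd (\<lambda>y. E y b) x h", OF S])
      show "linear (\<lambda>b. fd (\<lambda>y. E y b) x h)" if "x \<in> S" for x
        by (rule linear_fd_family[OF S that lin diff[OF that]])
    qed (use Suc.prems IH in auto)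
    from Ck_on_apply[where E = "\<lambda>x. inv (E x)", OF S linear_inj_inv(1)[OF lin inj] IH this]
    have "Ck_on k S (\<lambda>x. inv (E x) (fd (\<lambda>y. E y (inv (E x) w)) x h))" .
    then show "Ck_on k S (\<lambda>x. - inv (E x) (fd (\<lambda>y. E y (inv (E x) w)) x h))"
      by (rule Ck_on_linear_comp[OF bounded_linear_minus[OF bounded_linear_ident] S])
  qed (simp add: fd_eqI[OF d])
  then show ?case using d by (auto simp: differentiable_def)
qed

section \<open>Linear ordinary differential equations\<close>

lemma antiderivative_real:
  fixes f :: "real \<Rightarrow> 'b::banach"
  assumes f: "continuous_on UNIV f"
  shows "\<exists>F. F 0 = 0 \<and> (\<forall>t. (F has_vector_derivative f t) (at t))"
proof -
  \<comment> \<open>At least one of the two integrals is over an empty or one-point interval and is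
    0, so this is the oriented integral from 0 for both signs of \<open>t\<close>.\<close>
  define F where "F t = integral {0..t} f - integral {t..0} f" for t
  have int: "f integrable_on {a..b}" for a b
    by (rule integrable_continuous_real) (rule continuous_on_subset[OF f], simp)
  have "(F has_vector_derivative f t) (at t)" for t
  proof -
    define T where "T = \<bar>t\<bar> + 1"
    have eq: "integral {-T..s} f - integral {-T..0} f = F s" if "s \<in> {-T<..<T}" for s
    proof (cases "s \<ge> 0")
      case True
      then have "integral {-T..0} f + integral {0..s} f = integral {-T..s} f"
        using that by (intro Henstock_Kurzweil_Integration.integral_combine int) auto
      moreover have "integral {s..0} f = 0" using True by (cases "s = 0") auto
      ultimately show ?thesis by (simp add: F_def algebra_simps)
    next
      case False
      then have "integral {-T..s} f + integral {s..0} f = integral {-T..0} f"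
        using that by (intro Henstock_Kurzweil_Integration.integral_combine int) auto
      then show ?thesis using False by (simp add: F_def algebra_simps)
    qed
    have t: "t \<in> {-T<..<T}" by (auto simp: T_def)
    have "((\<lambda>s. integral {-T..s} f) has_vector_derivative f t) (at t within {-T..T})"
      by (rule integral_has_vector_derivative) (use t in \<open>auto intro: continuous_on_subset[OF f]\<close>)
    then have "((\<lambda>s. integral {-T..s} f) has_vector_derivative f t) (at t)"
      using t by (subst (asm) at_within_interior) auto
    then have "((\<lambda>s. integral {-T..s} f - integral {-T..0} f) has_vector_derivative f t) (at t)"
      by (auto intro!: derivative_eq_intros)
    then show ?thesis
      unfolding has_vector_derivative_def
      by (rule has_derivative_transform_within_open[OF _ _ t]) (auto simp: eq)
  qed
  moreover have "F 0 = 0" by (simp add: F_def)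
  ultimately show ?thesis by blast
qed

lemma linear_family_bounded:
  fixes L :: "real \<Rightarrow> 'x::euclidean_space \<Rightarrow> 'y::real_normed_vector"
  assumes lin: "\<And>t. linear (L t)" and cont: "\<And>b. continuous_on UNIV (\<lambda>t. L t b)"
  obtains K where "K \<ge> 0" "\<And>t x. \<bar>t\<bar> \<le> T \<Longrightarrow> norm (L t x) \<le> K * norm x"
proof -
  have "\<exists>B. \<forall>t\<in>{-T..T}. norm (L t b) \<le> B" for b
  proof -
    have "compact ((\<lambda>t. L t b) ` {-T..T})"
      by (intro compact_continuous_image continuous_on_subset[OF cont]) auto
    then have "bounded ((\<lambda>t. L t b) ` {-T..T})" by (rule compact_imp_bounded)
    then obtain B where "\<And>y. y \<in> (\<lambda>t. L t b) ` {-T..T} \<Longrightarrow> norm y \<le> B" unfolding bounded_iff by auto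
    then show ?thesis by auto
  qed
  then obtain B where B: "\<And>b t. t \<in> {-T..T} \<Longrightarrow> norm (L t b) \<le> B b" by metis
  define K where "K = (\<Sum>b\<in>Basis. \<bar>B b\<bar>)"
  have "norm (L t x) \<le> K * norm x" if "\<bar>t\<bar> \<le> T" for t x
  proof -
    have "norm (L t x) = norm (\<Sum>b\<in>Basis. (x \<bullet> b) *\<^sub>R L t b)"
      using linear_basis_expand[OF lin, of t x] by simp
    also have "\<dots> \<le> (\<Sum>b\<in>Basis. norm x * \<bar>B b\<bar>)"
    proof (rule sum_norm_le)
      fix b :: 'x assume b: "b \<in> Basis"
      have "norm (L t b) \<le> B b" by (rule B) (use that in auto)
      then have "norm (L t b) \<le> \<bar>B b\<bar>" by linarith
      then show "norm ((x \<bullet> b) *\<^sub>R L t b) \<le> norm x * \<bar>B b\<bar>"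
        using Basis_le_norm[OF b, of x] by (simp add: mult_mono)
    qed
    finally show ?thesis by (simp add: K_def sum_distrib_left[symmetric] mult.commute)
  qed
  moreover have "K \<ge> 0" by (simp add: K_def sum_nonneg)
  ultimately show thesis using that by blast
qed

text \<open>Gronwall in energy form: on a bounded interval \<open>K\<close> dominates the operator,
  so the squared norm times \<open>exp (-2 * K * s)\<close> does not increase, and times
  \<open>exp (2 * K * s)\<close> does not decrease. The first controls times after
  \<open>t0\<close>, the second those before.\<close>

lemma linear_ode_unique:
  fixes L :: "real \<Rightarrow> 'x::euclidean_space \<Rightarrow> 'x"
  assumes lin: "\<And>t. linear (L t)" and cont: "\<And>b. continuous_on UNIV (\<lambda>t. L t b)"
    and X: "\<And>t. (X has_vector_derivative L t (X t)) (at t)" and z: "X t0 = 0"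
  shows "X t = 0"
proof -
  obtain K where K: "K \<ge> 0" "\<And>s x. \<bar>s\<bar> \<le> max \<bar>t\<bar> \<bar>t0\<bar> \<Longrightarrow> norm (L s x) \<le> K * norm x"
    using linear_family_bounded[of L "max \<bar>t\<bar> \<bar>t0\<bar>"] lin cont by metis
  have d: "((\<lambda>s. exp (c * s) * (X s \<bullet> X s)) has_real_derivative
      exp (c * s) * (c * (X s \<bullet> X s) + 2 * (X s \<bullet> L s (X s)))) (at s)" for s c
  proof -
    have "((\<lambda>s. X s \<bullet> X s) has_real_derivative 2 * (X s \<bullet> L s (X s))) (at s)"
      using bounded_bilinear.has_vector_derivative[OF bounded_bilinear_inner X X, of s]
      by (simp add: has_real_derivative_iff_has_vector_derivative inner_commute)
    then show ?thesis
      by (auto intro!: derivative_eq_intros simp: algebra_simps)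
  qed
  have b: "\<bar>X s \<bullet> L s (X s)\<bar> \<le> K * (X s \<bullet> X s)" if "\<bar>s\<bar> \<le> max \<bar>t\<bar> \<bar>t0\<bar>" for s
  proof -
    have "\<bar>X s \<bullet> L s (X s)\<bar> \<le> norm (X s) * norm (L s (X s))" by (rule Cauchy_Schwarz_ineq2)
    also have "\<dots> \<le> norm (X s) * (K * norm (X s))" using K(2)[OF that] by (intro mult_left_mono) auto
    finally show ?thesis by (simp add: power2_norm_eq_inner[symmetric] power2_eq_square algebra_simps)
  qed
  have "X t \<bullet> X t \<le> 0"
  proof (cases "t0 \<le> t")
    case True
    have "exp (-2 * K * t) * (X t \<bullet> X t) \<le> exp (-2 * K * t0) * (X t0 \<bullet> X t0)"
    proof (rule DERIV_nonpos_imp_nonincreasing[OF True])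
      fix s assume "t0 \<le> s" "s \<le> t"
      then have "\<bar>s\<bar> \<le> max \<bar>t\<bar> \<bar>t0\<bar>" by arith
      then have "exp (-2 * K * s) * (-2 * K * (X s \<bullet> X s) + 2 * (X s \<bullet> L s (X s))) \<le> 0"
        using b[of s] by (intro mult_nonneg_nonpos) (simp_all add: abs_le_iff)
      then show "\<exists>y. ((\<lambda>s. exp (-2 * K * s) * (X s \<bullet> X s)) has_real_derivative y) (at s) \<and> y \<le> 0"
        using d[of "-2 * K" s] by blast
    qed
    then have "exp (-2 * K * t) * (X t \<bullet> X t) \<le> 0" by (simp add: z)
    then show ?thesis by (simp add: mult_le_0_iff not_le[symmetric])
  next
    case False
    have "exp (2 * K * t) * (X t \<bullet> X t) \<le> exp (2 * K * t0) * (X t0 \<bullet> X t0)"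
    proof (rule DERIV_nonneg_imp_nondecreasing[where f = "\<lambda>s. exp (2 * K * s) * (X s \<bullet> X s)" and a = t])
      show "t \<le> t0" using False by simp
      fix s assume "t \<le> s" "s \<le> t0"
      then have "\<bar>s\<bar> \<le> max \<bar>t\<bar> \<bar>t0\<bar>" by arith
      then have "exp (2 * K * s) * (2 * K * (X s \<bullet> X s) + 2 * (X s \<bullet> L s (X s))) \<ge> 0"
        using b[of s] by (intro mult_nonneg_nonneg) (simp_all add: abs_le_iff)
      then show "\<exists>y. ((\<lambda>s. exp (2 * K * s) * (X s \<bullet> X s)) has_real_derivative y) (at s) \<and> y \<ge> 0"
        using d[of "2 * K" s] by blast
    qed
    then have "exp (2 * K * t) * (X t \<bullet> X t) \<le> 0" by (simp add: z)
    then show ?thesis by (simp add: mult_le_0_iff not_le[symmetric])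
  qed
  then show ?thesis using inner_ge_zero[of "X t"] inner_eq_zero_iff[of "X t"] by linarith
qed

text \<open>One step of the Picard estimate: each integration raises the power of the time and
  divides by the new exponent, which is how the factorial arises.\<close>

lemma antiderivative_power_bound:
  fixes F :: "real \<Rightarrow> 'b::real_normed_vector"
  assumes F: "\<And>t. (F has_vector_derivative f t) (at t)" "F 0 = 0"
    and b: "\<And>t. \<bar>t\<bar> \<le> T \<Longrightarrow> norm (f t) \<le> C * \<bar>t\<bar> ^ n" and t: "\<bar>t\<bar> \<le> T"
  shows "norm (F t) \<le> C * \<bar>t\<bar> ^ Suc n / Suc n"
proof -
  have pos: "norm (G r) \<le> C * r ^ Suc n / Suc n"
    if G: "\<And>t. (G has_vector_derivative g t) (at t)" "G 0 = 0"
      and g: "\<And>t. 0 \<le> t \<Longrightarrow> t \<le> T \<Longrightarrow> norm (g t) \<le> C * t ^ n" and r: "0 < r" "r \<le> T"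
    for G :: "real \<Rightarrow> 'b" and g r
  proof -
    have "norm (G r - G 0) \<le> C * r ^ Suc n / Suc n - C * 0 ^ Suc n / Suc n"
    proof (rule differentiable_bound_general[OF r(1)])
      show "continuous_on {0..r} G"
        using G(1) by (meson continuous_at_imp_continuous_on has_vector_derivative_continuous)
      show "continuous_on {0..r} (\<lambda>t. C * t ^ Suc n / Suc n)"
        by (intro continuous_intros) simp
      show "(G has_vector_derivative g x) (at x)" for x by (rule G)
      show "((\<lambda>t. C * t ^ Suc n / Suc n) has_vector_derivative C * x ^ n) (at x)" for x
      proof -
        have "((\<lambda>t. C * t ^ Suc n / Suc n) has_real_derivative
            C * (real (Suc n) * x ^ (Suc n - Suc 0)) / Suc n) (at x)"
          by (intro DERIV_cdivide DERIV_cmult DERIV_pow)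
        then show ?thesis
          by (simp add: has_real_derivative_iff_has_vector_derivative del: power_Suc of_nat_Suc)
      qed
      show "norm (g x) \<le> C * x ^ n" if "0 < x" "x < r" for x using g that r by simp
    qed
    then show ?thesis using G(2) by simp
  qed
  consider "t = 0" | "t > 0" | "t < 0" by linarith
  then show ?thesis
  proof cases
    case 1 then show ?thesis using F by simp
  next
    case 2
    have "norm (F t) \<le> C * t ^ Suc n / Suc n"
    proof (rule pos[OF F])
      show "norm (f s) \<le> C * s ^ n" if "0 \<le> s" "s \<le> T" for s using b[of s] that by simp
    qed (use t 2 in auto)
    then show ?thesis using 2 by simp
  next
    case 3
    \<comment> \<open>Negative times reduce to positive ones by reflection.\<close>
    have "((\<lambda>s. F (- s)) has_vector_derivative - f (- s)) (at s)" for s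
    proof -
      have "(uminus has_vector_derivative - 1) (at s)"
        by (auto intro!: derivative_eq_intros)
      from vector_diff_chain_at[OF this F(1)] show ?thesis by (simp add: o_def)
    qed
    then have "norm (F (- (- t))) \<le> C * (- t) ^ Suc n / Suc n"
    proof (rule pos)
      show "norm (- f (- s)) \<le> C * s ^ n" if "0 \<le> s" "s \<le> T" for s using b[of "- s"] that by simp
    qed (use F t 3 in auto)
    then show ?thesis using 3 by simp
  qed
qed

text \<open>The Picard iterates \<open>X n\<close> are the successive terms of the solution series,
  not its partial sums. Their bound is a term of an exponential series on every bounded interval,
  which makes the solution global in time.\<close>

lemma linear_ode_exists:
  fixes L :: "real \<Rightarrow> 'x::euclidean_space \<Rightarrow> 'x"
  assumes lin: "\<And>t. linear (L t)" and cont: "\<And>b. continuous_on UNIV (\<lambda>t. L t b)"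
  shows "\<exists>X. X t0 = x0 \<and> (\<forall>t. (X has_vector_derivative L t (X t)) (at t))"
proof -
  have zero: "\<exists>X. X 0 = x0 \<and> (\<forall>t. (X has_vector_derivative L t (X t)) (at t))"
    if lin: "\<And>t. linear (L t)" and cont: "\<And>b. continuous_on UNIV (\<lambda>t. L t b)" for L
  proof -
    have c: "continuous_on UNIV (\<lambda>t. L t (g t))" if "continuous_on UNIV g" for g
      using Ck_on_apply[of UNIV L 0 g] lin cont that by simp
    define P where "P f = (SOME F. F 0 = 0 \<and> (\<forall>t. (F has_vector_derivative L t (f t)) (at t)))"
      for f :: "real \<Rightarrow> 'x"
    have P: "P f 0 = 0" "(P f has_vector_derivative L t (f t)) (at t)" if "continuous_on UNIV f" for f t
      using someI_ex[OF antiderivative_real[OF c[OF that]]] by (auto simp: P_def)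
    define X where "X n = (P ^^ n) (\<lambda>t. x0)" for n
    have Xc: "continuous_on UNIV (X n)" for n
    proof (induction n)
      case (Suc n)
      then show ?case using P(2)[OF Suc]
        by (simp add: X_def) (meson continuous_at_imp_continuous_on has_vector_derivative_continuous)
    qed (simp add: X_def)
    have X0: "X 0 t = x0" "X (Suc n) 0 = 0" for n t using P(1)[OF Xc[of n]] by (simp_all add: X_def)
    have XS: "(X (Suc n) has_vector_derivative L t (X n t)) (at t)" for n t
      using P(2)[OF Xc[of n]] by (simp add: X_def)
    define Y where "Y t = (\<Sum>n. X n t)" for t
    have "(Y has_vector_derivative L t (Y t)) (at t)" for t
    proof -
      define T where "T = \<bar>t\<bar> + 1"
      obtain K where K: "K \<ge> 0" "\<And>s x. \<bar>s\<bar> \<le> T \<Longrightarrow> norm (L s x) \<le> K * norm x"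
        using linear_family_bounded[of L T] lin cont by metis
      have bound: "norm (X n s) \<le> norm x0 * K ^ n / fact n * \<bar>s\<bar> ^ n" if "\<bar>s\<bar> \<le> T" for n s
        using that
      proof (induction n arbitrary: s)
        case (Suc n)
        have "norm (X (Suc n) s) \<le> (K * (norm x0 * K ^ n / fact n)) * \<bar>s\<bar> ^ Suc n / Suc n"
        proof (rule antiderivative_power_bound[OF XS X0(2) _ Suc.prems])
          fix s :: real assume s: "\<bar>s\<bar> \<le> T"
          then show "norm (L s (X n s)) \<le> K * (norm x0 * K ^ n / fact n) * \<bar>s\<bar> ^ n"
            using order_trans[OF K(2)[OF s] mult_left_mono[OF Suc.IH[OF s] K(1)]]
            by (simp add: mult.assoc)
        qed
        then show ?case by (simp add: field_simps)
      qed (simp add: X0)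
      have sm: "summable (\<lambda>n. norm x0 * (K * T) ^ n / fact n)"
        using summable_mult[OF summable_exp[of "K * T"], of "norm x0"] by (simp add: field_simps)
      have bT: "norm (X n s) \<le> norm x0 * (K * T) ^ n / fact n" if "s \<in> {-T<..<T}" for n s
      proof -
        have "norm (X n s) \<le> norm x0 * K ^ n / fact n * \<bar>s\<bar> ^ n" using that by (intro bound) auto
        also have "\<dots> \<le> norm x0 * K ^ n / fact n * T ^ n"
          using that K(1) by (intro mult_left_mono power_mono) auto
        finally show ?thesis by (simp add: power_mult_distrib)
      qed
      have ul: "uniform_limit {-T<..<T} (\<lambda>n s. \<Sum>i<n. X i s) Y sequentially"
        unfolding Y_def[abs_def] by (rule Weierstrass_m_test[OF bT sm])
      define X' where "X' n s h = (case n of 0 \<Rightarrow> 0 | Suc n \<Rightarrow> h *\<^sub>R L s (X n s))" for n s h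
      have "\<exists>g. \<forall>s\<in>{-T<..<T}. (\<lambda>n. X n s) sums g s \<and>
          (g has_derivative (\<lambda>h. h *\<^sub>R L s (Y s))) (at s within {-T<..<T})"
      proof (rule has_derivative_series)
        show "(X n has_derivative X' n s) (at s within {-T<..<T})" for n s
        proof (cases n)
          case 0
          then show ?thesis by (simp add: X'_def[abs_def] X0 fun_eq_iff[symmetric] X_def)
        next
          case (Suc m)
          then show ?thesis using XS[of m s]
            by (simp add: X'_def[abs_def] has_vector_derivative_def has_derivative_at_withinI)
        qed
        show "\<forall>\<^sub>F n in sequentially. \<forall>s\<in>{-T<..<T}. \<forall>h.
            norm ((\<Sum>i<n. X' i s h) - h *\<^sub>R L s (Y s)) \<le> e * norm h" if e: "e > 0" for e
        proof -
          have "e / (K + 1) > 0" using e K by simp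
          from uniform_limitD[OF ul this] have "\<forall>\<^sub>F n in sequentially. \<forall>s\<in>{-T<..<T}.
              dist (\<Sum>i<n. X i s) (Y s) < e / (K + 1)" .
          \<comment> \<open>The derivative of \<open>X (Suc n)\<close> is \<open>L\<close> applied
            to \<open>X n\<close>, and that of \<open>X 0\<close> is 0. Differentiating
            \<open>n + 1\<close> terms therefore gives \<open>L\<close> of the first
            \<open>n\<close>, so the claim is proved for \<open>Suc n\<close> and shifted back
            afterwards.\<close>
          then have "\<forall>\<^sub>F n in sequentially. \<forall>s\<in>{-T<..<T}. \<forall>h.
            norm ((\<Sum>i<Suc n. X' i s h) - h *\<^sub>R L s (Y s)) \<le> e * norm h"
          proof (rule eventually_mono, intro ballI allI)
            fix n s and h :: real
            assume a: "\<forall>s\<in>{-T<..<T}. dist (\<Sum>i<n. X i s) (Y s) < e / (K + 1)" and s: "s \<in> {-T<..<T}"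
            have "(\<Sum>i<Suc n. X' i s h) = h *\<^sub>R L s (\<Sum>i<n. X i s)"
              unfolding sum.lessThan_Suc_shift
              by (simp add: X'_def linear_sum[OF lin] scaleR_sum_right)
            then have "norm ((\<Sum>i<Suc n. X' i s h) - h *\<^sub>R L s (Y s))
                = \<bar>h\<bar> * norm (L s ((\<Sum>i<n. X i s) - Y s))"
              by (simp add: linear_diff[OF lin] scaleR_diff_right[symmetric])
            also have "\<dots> \<le> \<bar>h\<bar> * (K * (e / (K + 1)))"
              using a s K by (intro mult_left_mono order_trans[OF K(2)]) (auto simp: dist_norm less_imp_le)
            also have "\<dots> \<le> \<bar>h\<bar> * e"
              using K e by (intro mult_left_mono) (auto simp: field_simps)
            finally show "norm ((\<Sum>i<Suc n. X' i s h) - h *\<^sub>R L s (Y s)) \<le> e * norm h"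
              by (simp add: mult.commute)
          qed
          then show ?thesis by (rule eventually_sequentially_Suc[THEN iffD1])
        qed
        show "0 \<in> {-T<..<T}" by (auto simp: T_def)
        then have "summable (\<lambda>n. X n 0)"
          by (intro summable_comparison_test[OF _ sm]) (use bT in blast)
        then show "(\<lambda>n. X n 0) sums (\<Sum>n. X n 0)" by (rule summable_sums)
      qed (rule convex_real_interval)
      then obtain g where g: "\<And>s. s \<in> {-T<..<T} \<Longrightarrow> (\<lambda>n. X n s) sums g s"
        "\<And>s. s \<in> {-T<..<T} \<Longrightarrow> (g has_derivative (\<lambda>h. h *\<^sub>R L s (Y s))) (at s within {-T<..<T})"
        by blast
      have t: "t \<in> {-T<..<T}" by (auto simp: T_def)
      have "(g has_derivative (\<lambda>h. h *\<^sub>R L t (Y t))) (at t)"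
        using g(2)[OF t] at_within_open[OF t] by simp
      then show ?thesis unfolding has_vector_derivative_def
        by (rule has_derivative_transform_within_open[OF _ _ t])
          (use g(1) sums_unique in \<open>auto simp: Y_def\<close>)
    qed
    moreover have "Y 0 = x0"
    proof -
      have "X n 0 = 0" if "n \<notin> {0}" for n using that X0(2)[of "n - 1"] by (cases n) auto
      then have "Y 0 = (\<Sum>n\<in>{0}. X n 0)" unfolding Y_def by (rule suminf_finite[rotated]) auto
      then show ?thesis by (simp add: X0)
    qed
    ultimately show ?thesis by blast
  qed
  have "continuous_on UNIV (\<lambda>t. L (t + t0) b)" for b
    by (rule continuous_on_compose2[OF cont, of UNIV "\<lambda>t. t + t0"]) (auto intro: continuous_intros)
  then obtain X where X: "X 0 = x0" "\<And>t. (X has_vector_derivative L (t + t0) (X t)) (at t)"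
    using zero[of "\<lambda>t. L (t + t0)"] lin by blast
  have "((\<lambda>t. X (t - t0)) has_vector_derivative L t (X (t - t0))) (at t)" for t
  proof -
    have "((\<lambda>t. t - t0) has_vector_derivative 1) (at t)"
      by (auto intro!: derivative_eq_intros)
    from vector_diff_chain_at[OF this X(2)] show ?thesis by (simp add: o_def)
  qed
  then show ?thesis using X(1) by (intro exI[of _ "\<lambda>t. X (t - t0)"]) simp
qed

section \<open>Symmetric and skew operators on an inner product space\<close>

lemma inner_product_bilinear:
  assumes "inner_product \<kappa>"
  shows "bilinear \<kappa>"
proof -
  have "(\<lambda>x. \<kappa> x y) = \<kappa> y" for y
    using assms by (auto simp: inner_product_def)
  then show ?thesis using assms by (simp add: inner_product_def bilinear_def)
qed

lemma inner_product_nonneg: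
  assumes "inner_product \<kappa>"
  shows "\<kappa> v v \<ge> 0"
  using bilinear_lzero[OF inner_product_bilinear[OF assms], of 0] assms
  by (cases "v = 0") (auto simp: inner_product_def less_imp_le)

lemma inner_product_eqI:
  assumes "inner_product \<kappa>" "\<And>w. \<kappa> u w = \<kappa> v w"
  shows "u = v"
proof -
  have "\<kappa> (u - v) (u - v) = 0"
    by (simp add: bilinear_lsub[OF inner_product_bilinear[OF assms(1)]] assms(2))
  moreover have "u - v \<noteq> 0 \<Longrightarrow> \<kappa> (u - v) (u - v) > 0" using assms(1) by (simp add: inner_product_def)
  ultimately have "u - v = 0" by (metis less_irrefl)
  then show ?thesis by simp
qed

text \<open>The Rayleigh quotient is homogeneous of degree 0, so a maximum over the compact
  Euclidean sphere is global whatever norm \<kappa> defines. That the maximiser is an eigenvector is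
  the vanishing of the first variation, where symmetry of \<open>T\<close> enters.\<close>

lemma rayleigh_maximum:
  fixes T :: "'e::euclidean_space \<Rightarrow> 'e"
  assumes ip: "inner_product \<kappa>" and T: "linear T" and sym: "\<And>u v. \<kappa> (T u) v = \<kappa> u (T v)"
  obtains l v where "v \<noteq> 0" "T v = l *\<^sub>R v" "\<And>w. \<kappa> (T w) w \<le> l * \<kappa> w w"
proof -
  have bil: "bilinear \<kappa>" by (rule inner_product_bilinear[OF ip])
  have comm: "\<kappa> u v = \<kappa> v u" for u v using ip by (simp add: inner_product_def)
  have pos: "\<kappa> v v > 0" if "v \<noteq> 0" for v using ip that by (simp add: inner_product_def)
  note bb = bil[unfolded bilinear_conv_bounded_bilinear]
  have "\<kappa> w w \<noteq> 0" if "w \<in> sphere 0 1" for w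
  proof -
    have "w \<noteq> 0" using that by auto
    then show ?thesis using pos[of w] by simp
  qed
  then have "continuous_on (sphere 0 1) (\<lambda>w. \<kappa> (T w) w / \<kappa> w w)"
    using T linear_conv_bounded_linear
    by (intro continuous_on_divide bounded_bilinear.continuous_on[OF bb] continuous_on_id
        linear_continuous_on) auto
  moreover have "compact (sphere (0::'e) 1)" "sphere (0::'e) 1 \<noteq> {}" by auto
  ultimately obtain v where v: "v \<in> sphere 0 1"
    "\<And>w. w \<in> sphere 0 1 \<Longrightarrow> \<kappa> (T w) w / \<kappa> w w \<le> \<kappa> (T v) v / \<kappa> v v"
    using continuous_attains_sup[of "sphere 0 1" "\<lambda>w. \<kappa> (T w) w / \<kappa> w w"] by blast
  define l where "l = \<kappa> (T v) v / \<kappa> v v"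
  have v0: "v \<noteq> 0" using v(1) by auto
  have max: "\<kappa> (T w) w \<le> l * \<kappa> w w" for w
  proof (cases "w = 0")
    case True
    then show ?thesis using bilinear_rzero[OF bil] by simp
  next
    case False
    define x where "x = (1 / norm w) *\<^sub>R w"
    have w: "w = norm w *\<^sub>R x" and x: "x \<in> sphere 0 1" using False by (auto simp: x_def)
    have x0: "x \<noteq> 0" using x by auto
    have "\<kappa> (T x) x \<le> l * \<kappa> x x"
      using v(2)[OF x] pos[OF x0] by (simp add: l_def[symmetric] pos_divide_le_eq)
    moreover have "\<kappa> (T w) w = (norm w)\<^sup>2 * \<kappa> (T x) x" "\<kappa> w w = (norm w)\<^sup>2 * \<kappa> x x"
      by (subst w, subst (2) w, simp add: linear_cmul[OF T] bilinear_lmul[OF bil] bilinear_rmul[OF bil]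
          power2_eq_square)+
    ultimately show ?thesis
      by (simp add: mult.left_commute[of l] mult_left_mono)
  qed
  have eq: "\<kappa> (l *\<^sub>R v - T v) w = 0" for w
  proof (rule ccontr)
    define B where "B = \<kappa> (l *\<^sub>R v - T v) w"
    define C where "C = l * \<kappa> w w - \<kappa> (T w) w"
    assume "\<kappa> (l *\<^sub>R v - T v) w \<noteq> 0"
    then have B: "B \<noteq> 0" by (simp add: B_def)
    \<comment> \<open>Maximality along the line \<open>v + s w\<close>. A quadratic polynomial in
      \<open>s\<close> without constant term that is nonnegative everywhere has no linear
      term.\<close>
    have q: "0 \<le> 2 * s * B + s\<^sup>2 * C" for s
    proof -
      have "l * \<kappa> v v = \<kappa> (T v) v" using pos[OF v0] by (simp add: l_def)
      moreover have "\<kappa> (T w) v = \<kappa> (T v) w" using sym comm by metis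
      moreover have "\<kappa> w v = \<kappa> v w" by (rule comm)
      ultimately show ?thesis
        using max[of "v + s *\<^sub>R w"]
        by (simp add: B_def C_def linear_add[OF T] linear_cmul[OF T] bilinear_ladd[OF bil]
            bilinear_radd[OF bil] bilinear_lmul[OF bil] bilinear_rmul[OF bil] bilinear_lsub[OF bil]
            algebra_simps power2_eq_square)
    qed
    show False
    proof (cases "C = 0")
      case True
      then show ?thesis using q[of "- B"] B by (simp add: power2_eq_square[symmetric])
    next
      case False
      then have "C > 0" using q[of "1"] q[of "-1"] by simp
      then show ?thesis using q[of "- B / C"] B
        by (simp add: power2_eq_square field_simps) (use not_real_square_gt_zero[of B] in linarith)
    qed
  qed
  have "l *\<^sub>R v = T v"
    by (rule inner_product_eqI[OF ip]) (use eq in \<open>simp add: bilinear_lsub[OF bil]\<close>)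
  then have "T v = l *\<^sub>R v" by simp
  then show thesis using that v0 max by blast
qed

text \<open>Eigenvectors for distinct eigenvalues are \<kappa>-orthogonal, hence independent.
  Finiteness is what gives \<open>Min\<close> and \<open>Max\<close> of the spectrum their
  meaning.\<close>

lemma finite_eigenvalues:
  fixes T :: "'e::euclidean_space \<Rightarrow> 'e"
  assumes ip: "inner_product \<kappa>" and sym: "\<And>u v. \<kappa> (T u) v = \<kappa> u (T v)"
  shows "finite (eigenvalues T)"
proof -
  have bil: "bilinear \<kappa>" by (rule inner_product_bilinear[OF ip])
  have "\<forall>l\<in>eigenvalues T. \<exists>v. v \<noteq> 0 \<and> T v = l *\<^sub>R v" by (simp add: eigenvalues_def)
  from bchoice[OF this] obtain g where g: "\<And>l. l \<in> eigenvalues T \<Longrightarrow> g l \<noteq> 0 \<and> T (g l) = l *\<^sub>R g l"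
    by blast
  have orth: "\<kappa> (g k) (g l) = 0" if "k \<in> eigenvalues T" "l \<in> eigenvalues T" "k \<noteq> l" for k l
  proof -
    have "k * \<kappa> (g k) (g l) = l * \<kappa> (g k) (g l)"
      using sym[of "g k" "g l"] g that by (simp add: bilinear_lmul[OF bil] bilinear_rmul[OF bil])
    then show ?thesis using that by simp
  qed
  have pos: "\<kappa> (g l) (g l) \<noteq> 0" if "l \<in> eigenvalues T" for l
    using ip g[OF that] by (simp add: inner_product_def less_imp_neq[symmetric])
  have inj: "inj_on g (eigenvalues T)"
  proof (rule inj_onI, rule ccontr)
    fix k l assume "k \<in> eigenvalues T" "l \<in> eigenvalues T" "g k = g l" "k \<noteq> l"
    then show False using orth[of k l] pos[of k] by simp
  qed
  have "independent (g ` eigenvalues T)"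
    unfolding independent_explicit_finite_subsets
  proof (intro allI impI ballI)
    fix S :: "'e set" and c v
    assume S: "S \<subseteq> g ` eigenvalues T" "finite S" and s: "(\<Sum>v\<in>S. c v *\<^sub>R v) = 0" and v: "v \<in> S"
    have "0 = \<kappa> (\<Sum>w\<in>S. c w *\<^sub>R w) v" using s bilinear_lzero[OF bil] by simp
    also have "\<dots> = (\<Sum>w\<in>S. c w * \<kappa> w v)"
    proof -
      have "linear (\<lambda>x. \<kappa> x v)" using bil by (simp add: bilinear_def)
      from linear_sum[OF this, of "\<lambda>w. c w *\<^sub>R w"] show ?thesis by (simp add: bilinear_lmul[OF bil])
    qed
    also have "\<dots> = (\<Sum>w\<in>S. if w = v then c v * \<kappa> v v else 0)"
    proof (rule sum.cong)
      fix w assume "w \<in> S"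
      then obtain k where "k \<in> eigenvalues T" "w = g k" using S by blast
      moreover obtain l where "l \<in> eigenvalues T" "v = g l" using S v by blast
      ultimately show "c w * \<kappa> w v = (if w = v then c v * \<kappa> v v else 0)" using orth[of k l] by auto
    qed simp
    also have "\<dots> = c v * \<kappa> v v" using S v by simp
    finally show "c v = 0" using pos S v by auto
  qed
  then have "finite (g ` eigenvalues T)" by (rule finiteI_independent)
  then show ?thesis using inj by (simp add: finite_image_iff)
qed

text \<open>The maximum of the Rayleigh quotient is itself an eigenvalue; the lower bound is the
  same statement for \<open>- T\<close>.\<close>

lemma eigenvalue_bounds:
  fixes T :: "'e::euclidean_space \<Rightarrow> 'e"
  assumes ip: "inner_product \<kappa>" and T: "linear T" and sym: "\<And>u v. \<kappa> (T u) v = \<kappa> u (T v)"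
  shows "eigenvalues T \<noteq> {}" "\<kappa> (T w) w \<le> Max (eigenvalues T) * \<kappa> w w"
    "Min (eigenvalues T) * \<kappa> w w \<le> \<kappa> (T w) w"
proof -
  have bil: "bilinear \<kappa>" by (rule inner_product_bilinear[OF ip])
  have fin: "finite (eigenvalues T)" by (rule finite_eigenvalues[OF ip sym])
  obtain l v where l: "v \<noteq> 0" "T v = l *\<^sub>R v" "\<And>w. \<kappa> (T w) w \<le> l * \<kappa> w w"
    by (rule rayleigh_maximum[OF ip T sym]) blast
  then have "l \<in> eigenvalues T" by (auto simp: eigenvalues_def)
  then show "eigenvalues T \<noteq> {}" by auto
  have "l \<le> Max (eigenvalues T)" using fin \<open>l \<in> _\<close> by simp
  then show "\<kappa> (T w) w \<le> Max (eigenvalues T) * \<kappa> w w"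
    using l(3)[of w] mult_right_mono[OF _ inner_product_nonneg[OF ip, of w]] by (meson order_trans)
  have "linear (\<lambda>x. - T x)" using T by (rule linear_compose_neg)
  moreover have "\<kappa> (- T u) v = \<kappa> u (- T v)" for u v
    by (simp add: bilinear_lneg[OF bil] bilinear_rneg[OF bil] sym)
  ultimately obtain k v where k: "v \<noteq> 0" "- T v = k *\<^sub>R v" "\<And>w. \<kappa> (- T w) w \<le> k * \<kappa> w w"
    by (rule rayleigh_maximum[OF ip]) blast
  then have "T v = (- k) *\<^sub>R v" using k(2) by (metis minus_minus scaleR_minus_left)
  then have "- k \<in> eigenvalues T" using k(1) unfolding eigenvalues_def by blast
  then have "Min (eigenvalues T) \<le> - k" using fin by simp
  then have "Min (eigenvalues T) * \<kappa> w w \<le> - k * \<kappa> w w"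
    by (rule mult_right_mono[OF _ inner_product_nonneg[OF ip]])
  then show "Min (eigenvalues T) * \<kappa> w w \<le> \<kappa> (T w) w"
    using k(3)[of w] by (simp add: bilinear_lneg[OF bil])
qed

text \<open>For skew \<open>M\<close> the symmetric operator \<open>- M (M w)\<close> has the
  quadratic form \<open>\<kappa> (M w) (M w)\<close>, so its largest eigenvalue is the square of the
  operator norm, attained on an eigenvector.\<close>

lemma op_norm_skew:
  fixes M :: "'e::euclidean_space \<Rightarrow> 'e"
  assumes ip: "inner_product \<kappa>" and M: "linear M" and skew: "\<And>u v. \<kappa> (M u) v = - \<kappa> u (M v)"
  shows "op_norm \<kappa> M \<ge> 0" "\<kappa> (M w) (M w) \<le> (op_norm \<kappa> M)\<^sup>2 * \<kappa> w w"
    "\<exists>v. v \<noteq> 0 \<and> M (M v) = - ((op_norm \<kappa> M)\<^sup>2 *\<^sub>R v)"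
proof -
  have bil: "bilinear \<kappa>" by (rule inner_product_bilinear[OF ip])
  have "linear (\<lambda>x. - M (M x))"
    using linear_compose_neg[OF linear_compose[OF M M]] by (simp add: o_def)
  moreover have "\<kappa> (- M (M u)) v = \<kappa> u (- M (M v))" for u v
    by (simp add: bilinear_lneg[OF bil] bilinear_rneg[OF bil] skew)
  ultimately obtain l v where l: "v \<noteq> 0" "- M (M v) = l *\<^sub>R v" "\<And>w. \<kappa> (- M (M w)) w \<le> l * \<kappa> w w"
    by (rule rayleigh_maximum[OF ip]) blast
  have pos: "\<kappa> v v > 0" using ip l(1) by (simp add: inner_product_def)
  have k: "\<kappa> (M w) (M w) = \<kappa> (- M (M w)) w" for w
    by (simp add: bilinear_lneg[OF bil] skew)
  have eq: "\<kappa> (M v) (M v) = l * \<kappa> v v" unfolding k l(2) by (simp add: bilinear_lmul[OF bil])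
  have b: "\<kappa> (M w) (M w) \<le> l * \<kappa> w w" for w unfolding k by (rule l(3))
  have l0: "l \<ge> 0" using eq inner_product_nonneg[OF ip, of "M v"] pos by (simp add: zero_le_mult_iff)
  have "op_norm \<kappa> M = sqrt l"
    unfolding op_norm_def
  proof (rule cSup_eq_maximum)
    have "sqrt (\<kappa> (M v) (M v)) / sqrt (\<kappa> v v) = sqrt l"
      using pos by (simp add: eq real_sqrt_mult)
    then show "sqrt l \<in> range (\<lambda>v. sqrt (\<kappa> (M v) (M v)) / sqrt (\<kappa> v v))"
      by (intro image_eqI[of _ _ v]) simp_all
  next
    fix x assume "x \<in> range (\<lambda>v. sqrt (\<kappa> (M v) (M v)) / sqrt (\<kappa> v v))"
    then obtain w where x: "x = sqrt (\<kappa> (M w) (M w)) / sqrt (\<kappa> w w)" by blast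
    show "x \<le> sqrt l"
    proof (cases "w = 0")
      \<comment> \<open>Here the quotient is 0 / 0, which evaluates to 0, so the zero vector does
        not disturb the supremum.\<close>
      case True
      then show ?thesis using l0 bilinear_lzero[OF bil] by (simp add: x)
    next
      case False
      then have "\<kappa> w w > 0" using ip by (simp add: inner_product_def)
      moreover have "sqrt (\<kappa> (M w) (M w)) \<le> sqrt l * sqrt (\<kappa> w w)"
        using b[of w] by (simp add: real_sqrt_mult[symmetric])
      ultimately show ?thesis by (simp add: x pos_divide_le_eq)
    qed
  qed
  then have sq: "(op_norm \<kappa> M)\<^sup>2 = l" and "op_norm \<kappa> M \<ge> 0" using l0 by simp_all
  then show "op_norm \<kappa> M \<ge> 0" by simp
  show "\<kappa> (M w) (M w) \<le> (op_norm \<kappa> M)\<^sup>2 * \<kappa> w w" unfolding sq by (rule b)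
  have "M (M v) = - (l *\<^sub>R v)" unfolding l(2)[symmetric] by simp
  then show "\<exists>v. v \<noteq> 0 \<and> M (M v) = - ((op_norm \<kappa> M)\<^sup>2 *\<^sub>R v)" unfolding sq using l(1) by blast
qed

section \<open>The linearised Euler-Arnold equation\<close>

locale quadratic_lie_algebra =
  fixes \<kappa> :: "'e::euclidean_space \<Rightarrow> 'e \<Rightarrow> real" and br :: "'e \<Rightarrow> 'e \<Rightarrow> 'e" and \<Lambda> :: "'e \<Rightarrow> 'e"
  assumes ip: "inner_product \<kappa>" and spd: "symmetric_positive_definite \<kappa> \<Lambda>"
    and bil: "bilinear br" and skew: "br a b = - br b a"
    and jacobi: "br a (br b c) = br (br a b) c + br b (br a c)"
    and invariant: "\<kappa> (br a b) c = - \<kappa> b (br a c)"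
begin

lemma lin_\<Lambda>: "linear \<Lambda>" and sym_\<Lambda>: "\<kappa> (\<Lambda> v) w = \<kappa> v (\<Lambda> w)" and pos_\<Lambda>: "v \<noteq> 0 \<Longrightarrow> \<kappa> v (\<Lambda> v) > 0"
  using spd by (auto simp: symmetric_positive_definite_def)

lemma inj_\<Lambda>: "inj \<Lambda>"
  unfolding linear_injective_0[OF lin_\<Lambda>]
proof (intro allI impI, rule ccontr)
  fix v assume "\<Lambda> v = 0" "v \<noteq> 0"
  then show False
    using pos_\<Lambda>[of v] bilinear_rzero[OF inner_product_bilinear[OF ip]] by simp
qed

abbreviation "\<Lambda>i \<equiv> inv \<Lambda>"

lemmas lin_\<Lambda>i = linear_inj_inv(1)[OF lin_\<Lambda> inj_\<Lambda>]
lemmas \<Lambda>_\<Lambda>i = linear_inj_inv(2)[OF lin_\<Lambda> inj_\<Lambda>]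
lemmas \<Lambda>i_\<Lambda> = linear_inj_inv(3)[OF lin_\<Lambda> inj_\<Lambda>]

lemmas bil_\<kappa> = inner_product_bilinear[OF ip]

lemma \<kappa>_commute: "\<kappa> v w = \<kappa> w v"
  using ip by (simp add: inner_product_def)

lemma \<kappa>_pos: "v \<noteq> 0 \<Longrightarrow> \<kappa> v v > 0"
  using ip by (simp add: inner_product_def)

lemmas \<kappa>_simps = bilinear_ladd[OF bil_\<kappa>] bilinear_radd[OF bil_\<kappa>] bilinear_lsub[OF bil_\<kappa>]
  bilinear_rsub[OF bil_\<kappa>] bilinear_lmul[OF bil_\<kappa>] bilinear_rmul[OF bil_\<kappa>]
  bilinear_lneg[OF bil_\<kappa>] bilinear_rneg[OF bil_\<kappa>] bilinear_lzero[OF bil_\<kappa>] bilinear_rzero[OF bil_\<kappa>]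
lemmas br_simps = bilinear_ladd[OF bil] bilinear_radd[OF bil] bilinear_lsub[OF bil]
  bilinear_rsub[OF bil] bilinear_lmul[OF bil] bilinear_rmul[OF bil]
  bilinear_lneg[OF bil] bilinear_rneg[OF bil] bilinear_lzero[OF bil] bilinear_rzero[OF bil]
lemmas \<Lambda>_simps = linear_add[OF lin_\<Lambda>] linear_diff[OF lin_\<Lambda>] linear_cmul[OF lin_\<Lambda>]
  linear_neg[OF lin_\<Lambda>] linear_0[OF lin_\<Lambda>]
lemmas \<Lambda>i_simps = linear_add[OF lin_\<Lambda>i] linear_diff[OF lin_\<Lambda>i] linear_cmul[OF lin_\<Lambda>i]
  linear_neg[OF lin_\<Lambda>i] linear_0[OF lin_\<Lambda>i]

lemmas bb_\<kappa> = bil_\<kappa>[unfolded bilinear_conv_bounded_bilinear]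
lemmas bb_br = bil[unfolded bilinear_conv_bounded_bilinear]

lemma \<kappa>_deriv:
  "(f has_vector_derivative f') (at t) \<Longrightarrow> (g has_vector_derivative g') (at t) \<Longrightarrow>
    ((\<lambda>t. \<kappa> (f t) (g t)) has_real_derivative \<kappa> (f t) g' + \<kappa> f' (g t)) (at t)"
  unfolding has_real_derivative_iff_has_vector_derivative
  by (rule bounded_bilinear.has_vector_derivative[OF bb_\<kappa>])

lemmas br_deriv = bounded_bilinear.has_vector_derivative[OF bb_br]

lemma \<Lambda>_deriv: "(f has_vector_derivative f') F \<Longrightarrow> ((\<lambda>t. \<Lambda> (f t)) has_vector_derivative \<Lambda> f') F"
  by (rule bounded_linear.has_vector_derivative[OF lin_\<Lambda>[unfolded linear_conv_bounded_linear]])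

lemma br_self: "br a a = 0"
  using skew[of a a] by (simp add: eq_neg_iff_add_eq_0 flip: scaleR_2)

lemma \<kappa>_br_self: "\<kappa> (br a b) b = 0"
  using invariant[of a b b] \<kappa>_commute[of b "br a b"] by simp

end

text \<open>A curve in the Lie algebra is called parallel if it solves \<open>a' = - [u, a]\<close>; these are the
  curves of the form \<open>Ad(\<gamma>(t)\<inverse>) a(0)\<close>.\<close>

locale euler_arnold = quadratic_lie_algebra \<kappa> br \<Lambda>
  for \<kappa> :: "'e::euclidean_space \<Rightarrow> 'e \<Rightarrow> real" and br :: "'e \<Rightarrow> 'e \<Rightarrow> 'e" and \<Lambda> :: "'e \<Rightarrow> 'e" +
  fixes u :: "real \<Rightarrow> 'e"
  assumes u_continuous: "continuous_on UNIV u"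
    and momentum: "((\<lambda>t. \<Lambda> (u t)) has_vector_derivative br (\<Lambda> (u t)) (u t)) (at t)"
begin

definition m :: "real \<Rightarrow> 'e" where "m t = \<Lambda> (u t)"

definition parallel :: "(real \<Rightarrow> 'e) \<Rightarrow> bool" where
  "parallel a \<longleftrightarrow> (\<forall>t. (a has_vector_derivative - br (u t) (a t)) (at t))"

lemma parallelD: "parallel a \<Longrightarrow> (a has_vector_derivative - br (u t) (a t)) (at t)"
  by (simp add: parallel_def)

lemma parallel_m: "parallel m"
  unfolding parallel_def m_def[abs_def] using momentum
  by (simp add: skew[of "u t" "\<Lambda> (u t)" for t])

lemma u_br_continuous: "continuous_on UNIV a \<Longrightarrow> continuous_on UNIV (\<lambda>t. br (u t) (a t))"
  by (rule bounded_bilinear.continuous_on[OF bb_br u_continuous])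

lemma parallel_exists: "\<exists>a. a t0 = a0 \<and> parallel a"
  unfolding parallel_def
  by (rule linear_ode_exists[of "\<lambda>t a. - br (u t) a"])
    (auto intro!: linearI u_br_continuous continuous_intros simp: br_simps)

lemma parallel_unique:
  assumes "parallel a" "parallel b" "a t0 = b t0"
  shows "a t = b t"
proof -
  have "((\<lambda>t. a t - b t) has_vector_derivative - br (u t) (a t - b t)) (at t)" for t
    by (rule has_vector_derivative_eq_rhs[OF has_vector_derivative_diff[OF parallelD parallelD]])
      (use assms in \<open>simp_all add: br_simps\<close>)
  then have "a t - b t = 0"
    by (rule linear_ode_unique[of "\<lambda>t a. - br (u t) a", where ?t0.0 = t0, rotated 2])
      (auto intro!: linearI u_br_continuous continuous_intros simp: br_simps assms(3))
  then show ?thesis by simp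
qed

lemma parallel_scaleR: "parallel a \<Longrightarrow> parallel (\<lambda>t. r *\<^sub>R a t)"
  unfolding parallel_def
  by (auto intro!: derivative_eq_intros simp: br_simps)

text \<open>Invariance makes \<open>br (u t)\<close> skew for \<kappa>, so the two contributions to
  the derivative cancel.\<close>

lemma parallel_\<kappa>:
  assumes "parallel a" "parallel b"
  shows "\<kappa> (a t) (b t) = \<kappa> (a s) (b s)"
proof -
  have "((\<lambda>t. \<kappa> (a t) (b t)) has_real_derivative 0) (at t)" for t
  proof (rule DERIV_cong[OF \<kappa>_deriv[OF parallelD parallelD]])
    show "\<kappa> (a t) (- br (u t) (b t)) + \<kappa> (- br (u t) (a t)) (b t) = 0"
      using invariant[of "u t" "a t" "b t"] by (simp add: \<kappa>_simps)
  qed fact+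
  then show ?thesis using DERIV_isconst_all by blast
qed

text \<open>The Jacobi identity says that \<open>br (u t)\<close> is a derivation of the
  bracket.\<close>

lemma parallel_br:
  assumes "parallel a" "parallel b"
  shows "parallel (\<lambda>t. br (a t) (b t))"
  unfolding parallel_def
proof (rule allI, rule has_vector_derivative_eq_rhs[OF br_deriv[OF parallelD parallelD]])
  show "br (a t) (- br (u t) (b t)) + br (- br (u t) (a t)) (b t) = - br (u t) (br (a t) (b t))" for t
    using jacobi[of "u t" "a t" "b t"] by (simp add: br_simps)
qed fact+

text \<open>\<open>jac v w\<close> is the Jacobi equation for the field with left-invariant components \<open>v\<close>,
  written as a first-order system.\<close>

definition jac :: "(real \<Rightarrow> 'e) \<Rightarrow> (real \<Rightarrow> 'e) \<Rightarrow> bool" where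
  "jac v w \<longleftrightarrow> (\<forall>t. (v has_vector_derivative w t - br (u t) (v t)) (at t) \<and>
    (w has_vector_derivative \<Lambda>i (br (m t) (w t) + br (\<Lambda> (w t)) (u t))) (at t))"

lemma jacD: "jac v w \<Longrightarrow> (v has_vector_derivative w t - br (u t) (v t)) (at t)"
  "jac v w \<Longrightarrow> (w has_vector_derivative \<Lambda>i (br (m t) (w t) + br (\<Lambda> (w t)) (u t))) (at t)"
  by (simp_all add: jac_def)

section \<open>The Jacobi equation as a linear system, and its conserved momentum\<close>

definition jac_op :: "real \<Rightarrow> 'e \<times> 'e \<Rightarrow> 'e \<times> 'e" where
  "jac_op t x = (snd x - br (u t) (fst x), \<Lambda>i (br (m t) (snd x) + br (\<Lambda> (snd x)) (u t)))"

lemma linear_jac_op: "linear (jac_op t)"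
  by (rule linearI)
    (simp_all add: jac_op_def br_simps \<Lambda>_simps \<Lambda>i_simps scaleR_diff_right scaleR_add_right)

lemma continuous_jac_op: "continuous_on UNIV (\<lambda>t. jac_op t x)"
proof -
  have m: "continuous_on UNIV m"
    using parallelD[OF parallel_m] by (meson continuous_at_imp_continuous_on has_vector_derivative_continuous)
  show ?thesis unfolding jac_op_def
    by (intro continuous_on_Pair continuous_on_diff continuous_on_const u_br_continuous
        linear_continuous_on_compose[OF _ lin_\<Lambda>i] continuous_on_add
        bounded_bilinear.continuous_on[OF bb_br] m u_continuous)
qed

lemma jac_iff_ode: "jac v w \<longleftrightarrow> (\<forall>t. ((\<lambda>t. (v t, w t)) has_vector_derivative jac_op t (v t, w t)) (at t))"
proof
  assume "jac v w"
  then show "\<forall>t. ((\<lambda>t. (v t, w t)) has_vector_derivative jac_op t (v t, w t)) (at t)"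
    by (auto simp: jac_def jac_op_def intro: has_vector_derivative_Pair)
next
  assume a: "\<forall>t. ((\<lambda>t. (v t, w t)) has_vector_derivative jac_op t (v t, w t)) (at t)"
  show "jac v w" unfolding jac_def
  proof (intro allI conjI)
    fix t
    from bounded_linear.has_vector_derivative[OF bounded_linear_fst a[rule_format]]
    show "(v has_vector_derivative w t - br (u t) (v t)) (at t)" by (simp add: jac_op_def)
    from bounded_linear.has_vector_derivative[OF bounded_linear_snd a[rule_format]]
    show "(w has_vector_derivative \<Lambda>i (br (m t) (w t) + br (\<Lambda> (w t)) (u t))) (at t)"
      by (simp add: jac_op_def)
  qed
qed

lemma jac_exists: "\<exists>v w. jac v w \<and> v 0 = a \<and> w 0 = b"
proof -
  obtain X where X: "X 0 = (a, b)" "\<And>t. (X has_vector_derivative jac_op t (X t)) (at t)"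
    using linear_ode_exists[where L = jac_op, OF linear_jac_op continuous_jac_op, of 0 "(a, b)"] by auto
  then have "jac (\<lambda>t. fst (X t)) (\<lambda>t. snd (X t))" by (simp add: jac_iff_ode)
  then show ?thesis using X(1)
    by (intro exI[of _ "\<lambda>t. fst (X t)"] exI[of _ "\<lambda>t. snd (X t)"]) simp
qed

lemma jac_zero:
  assumes "jac v w" "v t0 = 0" "w t0 = 0"
  shows "v t = 0" "w t = 0"
proof -
  have "(v t, w t) = 0"
    by (rule linear_ode_unique[where L = jac_op and X = "\<lambda>t. (v t, w t)" and ?t0.0 = t0,
          OF linear_jac_op continuous_jac_op])
      (use assms in \<open>simp_all add: jac_iff_ode zero_prod_def\<close>)
  then show "v t = 0" "w t = 0" by (simp_all add: zero_prod_def)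
qed

lemma jac_add: "jac v w \<Longrightarrow> jac v' w' \<Longrightarrow> jac (\<lambda>t. v t + v' t) (\<lambda>t. w t + w' t)"
  unfolding jac_def
  by (auto intro!: has_vector_derivative_eq_rhs[OF has_vector_derivative_add]
      simp: br_simps \<Lambda>_simps \<Lambda>i_simps)

lemma jac_scaleR: "jac v w \<Longrightarrow> jac (\<lambda>t. r *\<^sub>R v t) (\<lambda>t. r *\<^sub>R w t)"
  unfolding jac_def
  by (auto intro!: derivative_eq_intros
      simp: br_simps \<Lambda>_simps \<Lambda>i_simps scaleR_diff_right scaleR_add_right)

lemma jac_unique:
  assumes "jac v w" "jac v' w'" "v t0 = v' t0" "w t0 = w' t0"
  shows "v t = v' t" "w t = w' t"
proof -
  have "jac (\<lambda>t. v t + (-1) *\<^sub>R v' t) (\<lambda>t. w t + (-1) *\<^sub>R w' t)"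
    by (intro jac_add jac_scaleR assms)
  from jac_zero[OF this, of t0 t] show "v t = v' t" "w t = w' t" using assms by simp_all
qed

text \<open>The spatial momentum Ad(\<gamma>) m is constant along a geodesic; the curve here is its
  first variation, read in left-invariant components. In the computation the Jacobi identity
  collects the brackets into a single \<open>br (u t)\<close>.\<close>

lemma linearised_momentum:
  assumes "jac v w"
  shows "((\<lambda>t. \<Lambda> (w t) - br (m t) (v t)) has_vector_derivative
    - br (u t) (\<Lambda> (w t) - br (m t) (v t))) (at t)"
proof (rule has_vector_derivative_eq_rhs[OF has_vector_derivative_diff[OF
      \<Lambda>_deriv[OF jacD(2)[OF assms]] br_deriv[OF parallelD[OF parallel_m] jacD(1)[OF assms]]]])
  show "\<Lambda> (\<Lambda>i (br (m t) (w t) + br (\<Lambda> (w t)) (u t))) -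
      (br (m t) (w t - br (u t) (v t)) + br (- br (u t) (m t)) (v t)) =
      - br (u t) (\<Lambda> (w t) - br (m t) (v t))"
    using jacobi[of "u t" "m t" "v t"] skew[of "\<Lambda> (w t)" "u t"]
    by (simp add: \<Lambda>_\<Lambda>i br_simps algebra_simps)
qed

text \<open>\<open>dx\<close> is the derivative of \<open>x\<close> with respect to d/dt + ad u, and
  against a parallel curve only this part contributes. The field \<open>x\<close> is arbitrary
  because the Wronskian pairs the momentum of one Jacobi field with another.\<close>

lemma \<kappa>_linearised_momentum:
  assumes "jac v w" "(x has_vector_derivative dx - br (u t) (x t)) (at t)"
  shows "((\<lambda>t. \<kappa> (\<Lambda> (w t) - br (m t) (v t)) (x t)) has_real_derivative
    \<kappa> (\<Lambda> (w t) - br (m t) (v t)) dx) (at t)"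
proof (rule DERIV_cong[OF \<kappa>_deriv[OF linearised_momentum[OF assms(1)] assms(2)]])
  show "\<kappa> (\<Lambda> (w t) - br (m t) (v t)) (dx - br (u t) (x t)) +
      \<kappa> (- br (u t) (\<Lambda> (w t) - br (m t) (v t))) (x t) = \<kappa> (\<Lambda> (w t) - br (m t) (v t)) dx"
    using invariant[of "u t" "\<Lambda> (w t) - br (m t) (v t)" "x t"]
    by (simp only: \<kappa>_simps)
qed

section \<open>The operator norm of \<open>ad\<close> of the momentum, constant along the
  geodesic\<close>

definition \<mu> :: real where "\<mu> = op_norm \<kappa> (br (m 0))"

lemma linear_br: "linear (br a)"
  using bil by (simp add: bilinear_def)

lemmas op_norm_br = op_norm_skew[where M = "br (m 0)", OF ip linear_br invariant, folded \<mu>_def]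

lemma \<mu>_nonneg: "\<mu> \<ge> 0"
  by (rule op_norm_br(1))

lemma \<mu>_bound: "\<kappa> (br (m t) x) (br (m t) x) \<le> \<mu>\<^sup>2 * \<kappa> x x"
proof -
  obtain a where a: "a t = x" "parallel a" using parallel_exists by blast
  have "\<kappa> (br (m t) (a t)) (br (m t) (a t)) = \<kappa> (br (m 0) (a 0)) (br (m 0) (a 0))"
    by (rule parallel_\<kappa>) (intro parallel_br parallel_m a)+
  moreover have "\<kappa> (a t) (a t) = \<kappa> (a 0) (a 0)" by (rule parallel_\<kappa>) fact+
  ultimately show ?thesis using a(1) op_norm_br(2)[of "a 0"] by simp
qed

lemma \<mu>_eq_0_iff: "\<mu> = 0 \<longleftrightarrow> (\<forall>v. br (m 0) v = 0)"
proof
  assume \<mu>: "\<mu> = 0"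
  show "\<forall>v. br (m 0) v = 0"
  proof (rule allI, rule ccontr)
    fix v assume "br (m 0) v \<noteq> 0"
    then have "\<kappa> (br (m 0) v) (br (m 0) v) > 0" using ip by (simp add: inner_product_def)
    then show False using \<mu>_bound[of 0 v] \<mu> by simp
  qed
next
  assume z: "\<forall>v. br (m 0) v = 0"
  obtain a where "a \<noteq> 0" "br (m 0) (br (m 0) a) = - (\<mu>\<^sup>2 *\<^sub>R a)" using op_norm_br(3) by auto
  then show "\<mu> = 0" using z by simp
qed

subsection \<open>The lower bound\<close>

text \<open>For a Jacobi field vanishing at \<open>0\<close> and \<open>T\<close>, the function \<open>F\<close> below is nondecreasing
  because \<open>F'\<close> dominates \<open>l\<close> times a square; it vanishes at both ends, so the square vanishes
  identically.  The square is the one completed by the Riccati solution of the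
  constant-coefficient comparison problem \<open>l y'' = [m, y']\<close>, centred at \<open>T/2\<close>.\<close>

lemma early_jacobi_field_zero:
  assumes jac: "jac v w" and v0: "v 0 = 0" "v T = 0" and T: "T > 0"
    and l: "l > 0" "\<And>x. l * \<kappa> x x \<le> \<kappa> (\<Lambda> x) x"
    and K: "K \<ge> 0" "\<mu> \<le> 2 * l * K" "K * T < pi"
  shows "v t = 0"
proof -
  define \<theta> where "\<theta> t = K * tan (K * (t - T / 2))" for t
  \<comment> \<open>The bound \<open>K * T < pi\<close> keeps the tangent finite on the closed
    interval; for \<open>K = \<mu> / (2 * l)\<close> with \<open>\<mu> > 0\<close> it reads
    \<open>T < 2 * pi * l / \<mu>\<close>.\<close>
  have ang: "\<bar>K * (t - T / 2)\<bar> < pi / 2" if "0 \<le> t" "t \<le> T" for t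
  proof -
    have "\<bar>t - T / 2\<bar> \<le> T / 2" using that by (intro abs_leI) linarith+
    then have "\<bar>K\<bar> * \<bar>t - T / 2\<bar> \<le> K * (T / 2)" using K(1) by (intro mult_mono) auto
    then have "\<bar>K * (t - T / 2)\<bar> \<le> K * (T / 2)" by (simp only: abs_mult)
    then show ?thesis using K(3) by simp
  qed
  have cos: "cos (K * (t - T / 2)) > 0" if "0 \<le> t" "t \<le> T" for t
    using ang[OF that] by (intro cos_gt_zero_pi) (auto simp: abs_less_iff)
  have \<theta>': "(\<theta> has_real_derivative K\<^sup>2 + (\<theta> t)\<^sup>2) (at t)" if "0 \<le> t" "t \<le> T" for t
  proof -
    have "((\<lambda>t. tan (K * (t - T / 2))) has_real_derivative
        inverse ((cos (K * (t - T / 2)))\<^sup>2) * K) (at t)"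
      using cos[OF that] by (auto intro!: derivative_eq_intros)
    then have "(\<theta> has_real_derivative K * (inverse ((cos (K * (t - T / 2)))\<^sup>2) * K)) (at t)"
      unfolding \<theta>_def[abs_def] by (rule DERIV_cmult)
    moreover have "inverse ((cos (K * (t - T / 2)))\<^sup>2) = 1 + (tan (K * (t - T / 2)))\<^sup>2"
      using cos[OF that] tan_sec[of "K * (t - T / 2)"] by (simp add: power_inverse)
    ultimately show ?thesis by (simp add: \<theta>_def algebra_simps power2_eq_square)
  qed
  define q where "q t = \<kappa> (v t) (v t)" for t
  have q': "(q has_real_derivative 2 * \<kappa> (w t) (v t)) (at t)" for t
  proof -
    have "(q has_real_derivative \<kappa> (v t) (w t - br (u t) (v t)) + \<kappa> (w t - br (u t) (v t)) (v t)) (at t)"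
      unfolding q_def[abs_def] by (rule \<kappa>_deriv[OF jacD(1)[OF jac] jacD(1)[OF jac]])
    moreover have "\<kappa> (v t) (w t - br (u t) (v t)) + \<kappa> (w t - br (u t) (v t)) (v t) = 2 * \<kappa> (w t) (v t)"
      by (simp add: \<kappa>_simps \<kappa>_br_self \<kappa>_commute[of "v t"])
    ultimately show ?thesis by simp
  qed
  define p where "p t = \<Lambda> (w t) - br (m t) (v t)" for t
  \<comment> \<open>The part with \<open>br (m t) (v t)\<close> absorbs the cross term with
    \<open>w t\<close> and leaves \<open>\<kappa> B B / (4 * l)\<close>, with \<open>B\<close> short
    for that bracket. As \<open>\<mu> \<le> 2 * l * K\<close>, this is at most
    \<open>l * q t\<close> times the square of \<open>K\<close>, the amount supplied by the constant
    in the Riccati equation of \<open>\<theta>\<close>. The product with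
    \<open>\<theta> t *\<^sub>R v t\<close> vanishes because \<open>ad\<close> is skew.\<close>
  define z where "z t = w t - (1 / (2 * l)) *\<^sub>R br (m t) (v t) + \<theta> t *\<^sub>R v t" for t
  define F where "F t = \<kappa> (p t) (v t) + l * (\<theta> t * q t)" for t
  define F' where "F' t = \<kappa> (p t) (w t) + l * (\<theta> t * (2 * \<kappa> (w t) (v t)) + (K\<^sup>2 + (\<theta> t)\<^sup>2) * q t)" for t
  have F': "(F has_real_derivative F' t) (at t)" if "0 \<le> t" "t \<le> T" for t
  proof -
    have "((\<lambda>t. \<kappa> (p t) (v t)) has_real_derivative \<kappa> (p t) (w t)) (at t)"
      unfolding p_def by (rule \<kappa>_linearised_momentum[OF jac jacD(1)[OF jac]])
    moreover have "((\<lambda>t. l * (\<theta> t * q t)) has_real_derivative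
        l * (\<theta> t * (2 * \<kappa> (w t) (v t)) + (K\<^sup>2 + (\<theta> t)\<^sup>2) * q t)) (at t)"
      by (rule DERIV_cmult[OF DERIV_cong[OF DERIV_mult[OF \<theta>'[OF that] q']]]) (simp add: algebra_simps)
    ultimately show ?thesis unfolding F_def[abs_def] F'_def by (rule DERIV_add)
  qed
  have z: "l * \<kappa> (z t) (z t) \<le> F' t" for t
  proof -
    define B where "B = br (m t) (v t)"
    have Bv: "\<kappa> B (v t) = 0" "\<kappa> (v t) B = 0"
      unfolding B_def using \<kappa>_br_self \<kappa>_commute by simp_all
    have "\<kappa> B B \<le> (2 * l * K)\<^sup>2 * q t"
    proof -
      have "\<kappa> B B \<le> \<mu>\<^sup>2 * q t" unfolding B_def q_def by (rule \<mu>_bound)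
      also have "\<dots> \<le> (2 * l * K)\<^sup>2 * q t"
        using K(2) \<mu>_nonneg inner_product_nonneg[OF ip, of "v t"]
        by (intro mult_right_mono power_mono) (auto simp: q_def)
      finally show ?thesis .
    qed
    then have B: "\<kappa> B B / (4 * l) \<le> l * K\<^sup>2 * q t"
      using l(1) by (simp add: field_simps power2_eq_square)
    have "\<kappa> (p t) (w t) = \<kappa> (\<Lambda> (w t)) (w t) - \<kappa> B (w t)"
      by (simp add: p_def B_def \<kappa>_simps)
    moreover have "l * \<kappa> (z t) (z t) = l * \<kappa> (w t) (w t) - \<kappa> B (w t) + \<kappa> B B / (4 * l)
        + l * (\<theta> t * (2 * \<kappa> (w t) (v t)) + (\<theta> t)\<^sup>2 * q t)"
      using l(1) Bv unfolding z_def B_def[symmetric] q_def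
      by (simp add: \<kappa>_simps \<kappa>_commute[of "w t" B] \<kappa>_commute[of "v t" "w t"] field_simps power2_eq_square)
    ultimately show ?thesis using l(2)[of "w t"] B unfolding F'_def by (simp add: algebra_simps)
  qed
  have F'_nonneg: "F' t \<ge> 0" for t
    using z[of t] mult_nonneg_nonneg[OF less_imp_le[OF l(1)] inner_product_nonneg[OF ip, of "z t"]] by linarith
  have F0: "F 0 = 0" "F T = 0" by (simp_all add: F_def q_def v0 \<kappa>_simps)
  have mono: "F s \<le> F t" if "0 \<le> s" "s \<le> t" "t \<le> T" for s t
  proof (rule DERIV_nonneg_imp_nondecreasing[OF that(2)])
    fix x assume "s \<le> x" "x \<le> t"
    then have "(F has_real_derivative F' x) (at x)" using that by (intro F') auto
    then show "\<exists>y. (F has_real_derivative y) (at x) \<and> 0 \<le> y" using F'_nonneg by blast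
  qed
  have F_zero: "F t = 0" if "0 \<le> t" "t \<le> T" for t
    using mono[of 0 t] mono[of t T] F0 that by simp
  have "F' t = 0" if t: "t \<in> {0<..<T}" for t
  proof -
    have "((\<lambda>t. 0) has_real_derivative F' t) (at t)"
      using F'[of t] t has_field_derivative_transform_within_open[of F "F' t" t "{0<..<T}" "\<lambda>_. 0"] F_zero
      by simp
    then show ?thesis using DERIV_unique DERIV_const by blast
  qed
  then have "z t = 0" if t: "t \<in> {0<..<T}" for t
    using z[of t] t l(1) \<kappa>_pos[of "z t"] by (cases "z t = 0") (simp_all add: mult_le_0_iff)
  then have wv: "\<kappa> (w t) (v t) = - \<theta> t * q t" if t: "t \<in> {0<..<T}" for t
  proof -
    have "\<kappa> (z t) (v t) = 0" using \<open>\<And>t. t \<in> {0<..<T} \<Longrightarrow> z t = 0\<close>[OF t] by (simp add: \<kappa>_simps)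
    then show ?thesis by (simp add: z_def \<kappa>_simps \<kappa>_br_self q_def)
  qed
  \<comment> \<open>Where \<open>z\<close> vanishes, both \<open>q\<close> and the square of this
    cosine solve \<open>y' = - 2 * \<theta> * y\<close>; their quotient is constant, and it is 0 at
    time 0.\<close>
  define C where "C t = cos (K * (t - T / 2))" for t
  have C': "(C has_real_derivative - (\<theta> t * C t)) (at t)" if "0 \<le> t" "t \<le> T" for t
  proof -
    have "(C has_real_derivative - sin (K * (t - T / 2)) * K) (at t)"
      unfolding C_def[abs_def] by (auto intro!: derivative_eq_intros)
    moreover have "sin (K * (t - T / 2)) * K = \<theta> t * C t"
      using cos[OF that] by (simp add: \<theta>_def C_def tan_def)
    ultimately show ?thesis by simp
  qed
  have D: "((\<lambda>t. q t / (C t)\<^sup>2) has_real_derivative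
      (2 * \<kappa> (w t) (v t) + 2 * (\<theta> t * q t)) / (C t)\<^sup>2) (at t)" if t: "0 \<le> t" "t \<le> T" for t
  proof -
    have C0: "C t \<noteq> 0" using cos[OF t] by (simp add: C_def)
    have "((\<lambda>t. (C t)\<^sup>2) has_real_derivative 2 * C t * - (\<theta> t * C t)) (at t)"
      by (rule DERIV_cong[OF DERIV_power[OF C'[OF t]]]) simp
    from DERIV_divide[OF q' this] C0
    have "((\<lambda>t. q t / (C t)\<^sup>2) has_real_derivative
      (2 * \<kappa> (w t) (v t) * (C t)\<^sup>2 - q t * (2 * C t * - (\<theta> t * C t))) / ((C t)\<^sup>2 * (C t)\<^sup>2)) (at t)"
      by simp
    then show ?thesis
      by (rule DERIV_cong) (use C0 in \<open>simp add: field_simps power2_eq_square\<close>)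
  qed
  have q0: "q t = 0" if t: "0 \<le> t" "t \<le> T" for t
  proof -
    have "q t / (C t)\<^sup>2 = q 0 / (C 0)\<^sup>2"
    proof (rule DERIV_isconst2[OF T])
      show "continuous_on {0..T} (\<lambda>t. q t / (C t)\<^sup>2)"
        using DERIV_isCont[OF D] by (intro continuous_at_imp_continuous_on) simp
      show "((\<lambda>t. q t / (C t)\<^sup>2) has_real_derivative 0) (at t)" if "0 < t" "t < T" for t
        using D[of t] wv[of t] that by simp
    qed (use t in auto)
    then show ?thesis using cos[OF t] v0 by (simp add: q_def C_def \<kappa>_simps)
  qed
  have v_zero: "v t = 0" if "0 \<le> t" "t \<le> T" for t
    using q0[OF that] \<kappa>_pos[of "v t"] by (cases "v t = 0") (simp_all add: q_def)
  \<comment> \<open>At an interior time the vanishing of \<open>v\<close> on the interval determines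
    its two-sided derivative. There \<open>w\<close> vanishes together with \<open>v\<close>, and
    uniqueness for the system extends this to all times.\<close>
  have mid: "T / 2 \<in> {0<..<T}" using T by simp
  have "((\<lambda>t. 0) has_vector_derivative w (T / 2)) (at (T / 2))"
  proof -
    have "(v has_vector_derivative w (T / 2)) (at (T / 2))"
      using jacD(1)[OF jac, of "T / 2"] v_zero[of "T / 2"] T by (simp add: br_simps)
    then show ?thesis
      unfolding has_vector_derivative_def
      by (rule has_derivative_transform_within_open[OF _ open_greaterThanLessThan mid]) (simp add: v_zero)
  qed
  then have "w (T / 2) = 0"
    by (rule vector_derivative_unique_at[OF _ has_vector_derivative_const])
  then show ?thesis using jac_zero(1)[OF jac, of "T / 2" t] v_zero T by simp
qed

end

context euler_arnold
begin

subsection \<open>Conjugate times and the upper bound\<close>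

text \<open>The fundamental solution for fields vanishing at time 0. In geometric terms
  \<open>V t\<close> is \<open>t\<close> times the differential of the exponential map at
  \<open>t *\<^sub>R u 0\<close>, read in the left-invariant frame.\<close>

definition VW :: "'e \<Rightarrow> (real \<Rightarrow> 'e) \<times> (real \<Rightarrow> 'e)" where
  "VW c = (SOME x. jac (fst x) (snd x) \<and> fst x 0 = 0 \<and> snd x 0 = c)"

definition V :: "real \<Rightarrow> 'e \<Rightarrow> 'e" where "V t c = fst (VW c) t"
definition W :: "real \<Rightarrow> 'e \<Rightarrow> 'e" where "W t c = snd (VW c) t"

lemma VW: "jac (\<lambda>t. V t c) (\<lambda>t. W t c)" "V 0 c = 0" "W 0 c = c"
proof -
  obtain v w where "jac v w" "v 0 = 0" "w 0 = c" using jac_exists by blast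
  then have "\<exists>x. jac (fst x) (snd x) \<and> fst x 0 = 0 \<and> snd x 0 = c"
    by (intro exI[of _ "(v, w)"]) simp
  from someI_ex[OF this] show "jac (\<lambda>t. V t c) (\<lambda>t. W t c)" "V 0 c = 0" "W 0 c = c"
    by (simp_all add: V_def W_def VW_def)
qed

lemma linear_V: "linear (V t)" and linear_W: "linear (W t)"
proof -
  have "V t (c + d) = V t c + V t d" "W t (c + d) = W t c + W t d" for c d
    by (rule jac_unique[OF VW(1) jac_add[OF VW(1) VW(1)], where ?t0.0 = 0]; simp add: VW(2,3))+
  moreover have "V t (r *\<^sub>R c) = r *\<^sub>R V t c" "W t (r *\<^sub>R c) = r *\<^sub>R W t c" for c r
    by (rule jac_unique[OF VW(1) jac_scaleR[OF VW(1)], where ?t0.0 = 0]; simp add: VW(2,3))+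
  ultimately show "linear (V t)" "linear (W t)" by (simp_all add: linearI)
qed

definition conj_time :: "real \<Rightarrow> bool" where
  "conj_time \<tau> \<longleftrightarrow> \<tau> > 0 \<and> (\<exists>v w. jac v w \<and> v 0 = 0 \<and> v \<tau> = 0 \<and> (\<exists>t. v t \<noteq> 0))"

text \<open>A nonzero kernel vector \<open>c\<close> yields a nontrivial field because the
  derivative of \<open>V t c\<close> at time 0 is \<open>c\<close>.\<close>

lemma conj_time_iff: "conj_time \<tau> \<longleftrightarrow> \<tau> > 0 \<and> \<not> inj (V \<tau>)"
proof
  assume "conj_time \<tau>"
  then obtain v w t where v: "\<tau> > 0" "jac v w" "v 0 = 0" "v \<tau> = 0" "v t \<noteq> 0"
    by (auto simp: conj_time_def)
  have "v s = V s (w 0)" for s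
    by (rule jac_unique(1)[OF v(2) VW(1), where ?t0.0 = 0]) (simp_all add: v VW)
  moreover have "w 0 \<noteq> 0" using jac_zero(1)[OF v(2,3)] v(5) by blast
  ultimately show "\<tau> > 0 \<and> \<not> inj (V \<tau>)"
    using v(1,4) linear_injective_0[OF linear_V] by metis
next
  assume a: "\<tau> > 0 \<and> \<not> inj (V \<tau>)"
  then obtain c where c: "V \<tau> c = 0" "c \<noteq> 0" using linear_injective_0[OF linear_V] by blast
  have "\<exists>t. V t c \<noteq> 0"
  proof (rule ccontr)
    assume "\<not> (\<exists>t. V t c \<noteq> 0)"
    then have z: "(\<lambda>t. V t c) = (\<lambda>t. 0)" by auto
    have "((\<lambda>t. V t c) has_vector_derivative c) (at 0)"
      using jacD(1)[OF VW(1), of c 0] by (simp add: VW br_simps)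
    then have "((\<lambda>t. 0) has_vector_derivative c) (at (0::real))" unfolding z .
    then have "c = 0" by (rule vector_derivative_unique_at[OF _ has_vector_derivative_const])
    then show False using c(2) by simp
  qed
  then show "conj_time \<tau>" unfolding conj_time_def using a c VW by blast
qed

lemma V_deriv: "((\<lambda>t. V t c) has_vector_derivative W t c - br (u t) (V t c)) (at t)"
  by (rule jacD(1)[OF VW(1)])

text \<open>Conjugate times are therefore closed among the positive times, so a positive infimum of
  them is attained. The same openness allows \<open>inv (V t)\<close> to be differentiated.\<close>

lemma open_inj_V: "open {t. inj (V t)}"
proof (subst open_subopen, rule ballI)
  fix t assume "t \<in> {t. inj (V t)}"
  then have inj: "inj (V t)" by simp
  have "isCont (\<lambda>t. V t c) t" for c by (rule has_vector_derivative_continuous[OF V_deriv])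
  then obtain T d where T: "open T" "t \<in> T" "d > 0" "\<And>s v. s \<in> T \<Longrightarrow> d * norm v \<le> norm (V s v)"
    using linear_family_bounded_below[where E = V, OF open_UNIV UNIV_I linear_V inj] by metis
  have "T \<subseteq> {t. inj (V t)}"
  proof
    fix s assume s: "s \<in> T"
    have "v = 0" if "V s v = 0" for v
    proof -
      have "d * norm v \<le> 0" using T(4)[OF s, of v] that by simp
      then show ?thesis using T(3) by (simp add: mult_le_0_iff)
    qed
    then show "s \<in> {t. inj (V t)}" using linear_injective_0[OF linear_V] by blast
  qed
  then show "\<exists>T. open T \<and> t \<in> T \<and> T \<subseteq> {t. inj (V t)}" using T by blast
qed

text \<open>The symplectic pairing of two Jacobi fields is constant in time, and it is 0 at time 0,
  where both vanish; the last summand of \<open>w\<close> compensates for the skew first-order term.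
  Rearranged like this, the identity makes the cross terms of the index form part of a total
  derivative.\<close>

lemma wronskian: "\<kappa> (\<Lambda> (W t c)) (V t d) = \<kappa> (\<Lambda> (W t d) - br (m t) (V t d)) (V t c)"
proof -
  define P where "P t c = \<Lambda> (W t c) - br (m t) (V t c)" for t c
  define w where "w t = \<kappa> (P t c) (V t d) - \<kappa> (P t d) (V t c) + \<kappa> (br (m t) (V t c)) (V t d)" for t
  have br': "((\<lambda>t. br (m t) (V t c)) has_vector_derivative br (m t) (W t c) - br (u t) (br (m t) (V t c))) (at t)" for t
  proof (rule has_vector_derivative_eq_rhs[OF br_deriv[OF parallelD[OF parallel_m] V_deriv]])
    show "br (m t) (W t c - br (u t) (V t c)) + br (- br (u t) (m t)) (V t c) =
        br (m t) (W t c) - br (u t) (br (m t) (V t c))"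
      using jacobi[of "u t" "m t" "V t c"] by (simp add: br_simps)
  qed
  have "(w has_real_derivative 0) (at t)" for t
  proof -
    have "((\<lambda>t. \<kappa> (P t a) (V t b)) has_real_derivative \<kappa> (P t a) (W t b)) (at t)" for a b
      unfolding P_def by (rule \<kappa>_linearised_momentum[OF VW(1) V_deriv])
    then have "(w has_real_derivative \<kappa> (P t c) (W t d) - \<kappa> (P t d) (W t c)
        + (\<kappa> (br (m t) (V t c)) (W t d - br (u t) (V t d))
        + \<kappa> (br (m t) (W t c) - br (u t) (br (m t) (V t c))) (V t d))) (at t)"
      unfolding w_def[abs_def] by (intro DERIV_add DERIV_diff \<kappa>_deriv br' V_deriv)
    moreover have "\<kappa> (P t c) (W t d) - \<kappa> (P t d) (W t c)
        + (\<kappa> (br (m t) (V t c)) (W t d - br (u t) (V t d))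
        + \<kappa> (br (m t) (W t c) - br (u t) (br (m t) (V t c))) (V t d)) = 0"
      using invariant[of "m t" "V t d" "W t c"] invariant[of "u t" "br (m t) (V t c)" "V t d"]
        sym_\<Lambda>[of "W t c" "W t d"]
      by (simp add: P_def \<kappa>_simps \<kappa>_commute[of "\<Lambda> (W t d)"] \<kappa>_commute[of "V t d"])
    ultimately show ?thesis by simp
  qed
  then have "w t = w 0" using DERIV_isconst_all by blast
  also have "w 0 = 0" by (simp add: w_def VW \<kappa>_simps br_simps)
  finally show ?thesis by (simp add: w_def P_def \<kappa>_simps)
qed

text \<open>Were \<open>V\<close> injective on \<open>(0, T]\<close>, a field \<open>x = V f\<close> vanishing at \<open>\<epsilon>\<close> and \<open>T\<close> would have
  nonnegative index form: up to the derivative of \<open>F\<close>, the integrand is \<open>\<kappa>(\<Lambda> V f', V f')\<close>.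
  The test field, a circle in a plane on which \<open>ad\<close> of the momentum has its maximal rotation
  speed, makes the index form negative.\<close>

lemma conj_time_exists:
  assumes \<mu>: "\<mu> > 0" and l: "l > 0" "\<And>x. \<kappa> (\<Lambda> x) x \<le> l * \<kappa> x x" and T: "T > 2 * pi * l / \<mu>"
  shows "\<exists>\<tau>\<le>T. conj_time \<tau>"
proof (rule ccontr)
  assume "\<not> (\<exists>\<tau>\<le>T. conj_time \<tau>)"
  then have injV: "inj (V \<tau>)" if "0 < \<tau>" "\<tau> \<le> T" for \<tau>
    using that conj_time_iff by blast
  define S where "S = {t. inj (V t)}"
  have S: "open S" and inj: "\<And>t. t \<in> S \<Longrightarrow> inj (V t)" using open_inj_V by (auto simp: S_def)
  \<comment> \<open>\<open>V 0\<close> is the zero map, so \<open>inv (V t)\<close> is of no use at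
    time 0 and the test field must start later; half of the slack still leaves
    \<open>T - \<epsilon>\<close> above the bound.\<close>
  define \<epsilon> where "\<epsilon> = (T - 2 * pi * l / \<mu>) / 2"
  have \<epsilon>: "\<epsilon> > 0" using T by (simp add: \<epsilon>_def)
  have pos: "2 * pi * l / \<mu> > 0" using l \<mu> by simp
  have T\<epsilon>: "T - \<epsilon> > 2 * pi * l / \<mu>"
  proof -
    have "T - \<epsilon> = 2 * pi * l / \<mu> + \<epsilon>" unfolding \<epsilon>_def by (simp add: field_simps)
    then show ?thesis using \<epsilon> by linarith
  qed
  have T\<epsilon>0: "T - \<epsilon> > 0" using T\<epsilon> pos by linarith
  have sub: "t \<in> S" if "\<epsilon> \<le> t" "t \<le> T" for t using that \<epsilon> injV[of t] by (auto simp: S_def)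
  \<comment> \<open>One full turn between \<open>\<epsilon>\<close> and \<open>T\<close>; the length
    of this interval makes \<open>\<omega>\<close> smaller than \<open>\<mu> / l\<close>.\<close>
  define \<omega> where "\<omega> = 2 * pi / (T - \<epsilon>)"
  have \<omega>: "\<omega> > 0" using T\<epsilon>0 by (simp add: \<omega>_def)

  obtain a0 where a0: "a0 \<noteq> 0" "br (m 0) (br (m 0) a0) = - (\<mu>\<^sup>2 *\<^sub>R a0)" using op_norm_br(3) by auto
  have ka: "\<kappa> a0 a0 > 0" using a0(1) ip by (simp add: inner_product_def)
  define a1 where "a1 = (1 / sqrt (\<kappa> a0 a0)) *\<^sub>R a0"
  have a1: "\<kappa> a1 a1 = 1" "br (m 0) (br (m 0) a1) = - (\<mu>\<^sup>2 *\<^sub>R a1)"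
    using ka a0(2) by (simp_all add: a1_def \<kappa>_simps br_simps)
  obtain a where a: "a 0 = a1" "parallel a" using parallel_exists by blast
  \<comment> \<open>Completes \<open>a\<close> to a parallel orthonormal frame of a plane on which
    \<open>br (m t)\<close> is a quarter turn times \<open>\<mu>\<close>.\<close>
  define b where "b t = (1 / \<mu>) *\<^sub>R br (m t) (a t)" for t
  have b: "parallel b" unfolding b_def[abs_def] by (intro parallel_scaleR parallel_br parallel_m a)
  have ma: "br (m t) (a t) = \<mu> *\<^sub>R b t" for t using \<mu> by (simp add: b_def)
  have mb: "br (m t) (b t) = (- \<mu>) *\<^sub>R a t" for t
    by (rule parallel_unique[where ?t0.0 = 0, OF parallel_br[OF parallel_m b] parallel_scaleR[OF a(2)]])
      (use \<mu> in \<open>simp add: b_def br_simps a(1) a1(2) power2_eq_square\<close>)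
  have aa: "\<kappa> (a t) (a t) = 1" for t using parallel_\<kappa>[OF a(2) a(2), of t 0] a(1) a1(1) by simp
  have ab: "\<kappa> (a t) (b t) = 0" "\<kappa> (b t) (a t) = 0" for t
    using invariant[of "m t" "a t" "a t"] \<kappa>_commute[of "a t" "br (m t) (a t)"]
    by (simp_all add: b_def \<kappa>_simps)
  have bb: "\<kappa> (b t) (b t) = 1" for t
  proof -
    have "\<mu> * \<kappa> (b t) (b t) = \<kappa> (br (m t) (a t)) (b t)" by (simp add: ma \<kappa>_simps)
    also have "\<dots> = \<mu> * \<kappa> (a t) (a t)" by (simp add: invariant mb \<kappa>_simps)
    finally show ?thesis using \<mu> aa by simp
  qed

  \<comment> \<open>A unit circle translated so that it starts and ends at 0. At angular speed
    \<open>\<mu> / l\<close> it would solve the comparison equation with \<Lambda> replaced by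
    \<open>l\<close>; at the slower speed \<open>\<omega>\<close> its index form is
    negative.\<close>
  define x where "x t = (cos (\<omega> * (t - \<epsilon>)) - 1) *\<^sub>R a t + sin (\<omega> * (t - \<epsilon>)) *\<^sub>R b t" for t
  define Dx where "Dx t = (- \<omega> * sin (\<omega> * (t - \<epsilon>))) *\<^sub>R a t + (\<omega> * cos (\<omega> * (t - \<epsilon>))) *\<^sub>R b t" for t
  have x': "(x has_vector_derivative Dx t - br (u t) (x t)) (at t)" for t
  proof -
    have c: "((\<lambda>t. cos (\<omega> * (t - \<epsilon>)) - 1) has_real_derivative - \<omega> * sin (\<omega> * (t - \<epsilon>))) (at t)"
      and s: "((\<lambda>t. sin (\<omega> * (t - \<epsilon>))) has_real_derivative \<omega> * cos (\<omega> * (t - \<epsilon>))) (at t)"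
      by (auto intro!: derivative_eq_intros)
    show ?thesis
      unfolding x_def[abs_def] Dx_def
      by (rule has_vector_derivative_eq_rhs[OF has_vector_derivative_add[OF
            has_vector_derivative_scaleR[OF c parallelD[OF a(2)]]
            has_vector_derivative_scaleR[OF s parallelD[OF b]]]])
        (simp add: br_simps algebra_simps)
  qed
  have x_ends: "x \<epsilon> = 0" "x T = 0"
    using T\<epsilon>0 by (simp_all add: x_def \<omega>_def)

  \<comment> \<open>Variation of constants: the test field becomes a combination of Jacobi fields
    with varying coefficients, the substitution that turns the index form into a square plus a total
    derivative.\<close>
  define f where "f t = inv (V t) (x t)" for t
  have Vf: "V t (f t) = x t" if "t \<in> S" for t
    unfolding f_def using linear_inj_inv(2)[OF linear_V inj[OF that]] .
  have V_diff: "((\<lambda>t. V t c) has_derivative (\<lambda>h. h *\<^sub>R (W t c - br (u t) (V t c)))) (at t)" for t c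
    using V_deriv by (simp add: has_vector_derivative_def)
  have "\<exists>f'. (f has_vector_derivative f') (at t)" if t: "t \<in> S" for t
  proof -
    have d: "(\<lambda>s. V s c) differentiable (at t)" for c using V_diff by (auto simp: differentiable_def)
    have i: "((\<lambda>s. inv (V s) c) has_derivative fd (\<lambda>s. inv (V s) c) t) (at t)" for c
      using has_derivative_inverse_family[where E = V, OF S t linear_V inj d, of c]
      by (intro has_derivative_fd) (auto simp: differentiable_def)
    have "f differentiable (at t)"
      unfolding f_def[abs_def]
    proof (rule has_derivative_apply(2)[where E = "\<lambda>s. inv (V s)", OF S t _ i])
      show "linear (inv (V s))" if "s \<in> S" for s by (rule linear_inj_inv(1)[OF linear_V inj[OF that]])
      then show "linear (\<lambda>b. fd (\<lambda>s. inv (V s) b) t 1)"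
        using i by (intro linear_fd_family[OF S t]) (auto simp: differentiable_def)
      show "(x has_derivative (\<lambda>h. h *\<^sub>R (Dx t - br (u t) (x t)))) (at t)"
        using x' by (simp add: has_vector_derivative_def)
    qed
    then show ?thesis using vector_derivative_works by blast
  qed
  then obtain f' where f': "\<And>t. t \<in> S \<Longrightarrow> (f has_vector_derivative f' t) (at t)" by metis
  have lin_W': "linear (\<lambda>c. h *\<^sub>R (W t c - br (u t) (V t c)))" for h t
    by (rule linearI)
      (simp_all add: linear_add[OF linear_V] linear_add[OF linear_W] linear_cmul[OF linear_V]
        linear_cmul[OF linear_W] br_simps algebra_simps)
  have Dx: "Dx t = V t (f' t) + W t (f t)" if t: "t \<in> S" for t
  proof -
    have fder: "(f has_derivative (\<lambda>h. h *\<^sub>R f' t)) (at t)"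
      using f'[OF t] by (simp add: has_vector_derivative_def)
    have "fd (\<lambda>s. V s (f s)) t 1 = V t (1 *\<^sub>R f' t) + 1 *\<^sub>R (W t (f t) - br (u t) (V t (f t)))"
      by (rule has_derivative_apply(1)[where E = V, OF S t linear_V V_diff lin_W' fder])
    moreover have "((\<lambda>s. V s (f s)) has_derivative (\<lambda>h. h *\<^sub>R (Dx t - br (u t) (x t)))) (at t)"
      using x'[of t] unfolding has_vector_derivative_def
      by (rule has_derivative_transform_within_open[OF _ S t]) (simp add: Vf)
    ultimately show ?thesis using Vf[OF t] fd_eqI by fastforce
  qed

  define P where "P t c = \<Lambda> (W t c) - br (m t) (V t c)" for t c
  have lin_P: "linear (P t)" for t
    by (rule linearI) (simp_all add: P_def linear_add[OF linear_V] linear_add[OF linear_W]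
        linear_cmul[OF linear_V] linear_cmul[OF linear_W] br_simps \<Lambda>_simps algebra_simps)
  have P': "((\<lambda>t. P t c) has_derivative (\<lambda>h. h *\<^sub>R (- br (u t) (P t c)))) (at t)" for t c
    using linearised_momentum[OF VW(1), of c t] by (simp add: has_vector_derivative_def P_def)
  have lin_P': "linear (\<lambda>c. h *\<^sub>R (- br (u t) (P t c)))" for h t
    by (rule linearI) (simp_all add: linear_add[OF lin_P] linear_cmul[OF lin_P] br_simps algebra_simps)
  define F where "F t = \<kappa> (P t (f t)) (x t)" for t
  have F': "(F has_real_derivative \<kappa> (P t (f' t)) (x t) + \<kappa> (P t (f t)) (Dx t)) (at t)" if t: "t \<in> S" for t
  proof -
    have fder: "(f has_derivative (\<lambda>h. h *\<^sub>R f' t)) (at t)"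
      using f'[OF t] by (simp add: has_vector_derivative_def)
    note Pf = has_derivative_apply[where E = P, OF S t lin_P P' lin_P' fder]
    have "fd (\<lambda>s. P s (f s)) t = (\<lambda>h. h *\<^sub>R (P t (f' t) - br (u t) (P t (f t))))"
      by (rule ext) (simp add: Pf(1) linear_cmul[OF lin_P] scaleR_diff_right)
    then have "((\<lambda>s. P s (f s)) has_vector_derivative P t (f' t) - br (u t) (P t (f t))) (at t)"
      using has_derivative_fd[OF Pf(2)] by (simp add: has_vector_derivative_def)
    from \<kappa>_deriv[OF this x'] show ?thesis
      unfolding F_def[abs_def]
      by (rule DERIV_cong) (use invariant[of "u t" "P t (f t)" "x t"] in \<open>simp add: \<kappa>_simps\<close>)
  qed
  have F'_le: "\<kappa> (P t (f' t)) (x t) + \<kappa> (P t (f t)) (Dx t) \<le> \<kappa> (\<Lambda> (Dx t)) (Dx t) - \<kappa> (br (m t) (x t)) (Dx t)"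
    if t: "t \<in> S" for t
  proof -
    \<comment> \<open>\<open>A\<close> carries the derivative of the coefficients, \<open>B\<close>
      the Jacobi part. Expanding the quadratic term gives two equal cross terms: one lies in the
      pairing of \<open>P t (f t)\<close> with \<open>Dx t\<close>, the other is the pairing of
      \<open>P t (f' t)\<close> with \<open>x t\<close> by the Wronskian. The only surplus is
      \<open>\<kappa> (\<Lambda> A) A\<close>.\<close>
    define A B where "A = V t (f' t)" and "B = W t (f t)"
    have w: "\<kappa> (\<Lambda> B) A = \<kappa> (P t (f' t)) (x t)"
      using wronskian[of t "f t" "f' t"] Vf[OF t] by (simp add: A_def B_def P_def)
    have D: "Dx t = A + B" using Dx[OF t] by (simp add: A_def B_def)
    have p: "P t (f t) = \<Lambda> B - br (m t) (x t)" using Vf[OF t] by (simp add: P_def B_def)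
    have "\<kappa> (\<Lambda> (Dx t)) (Dx t) - \<kappa> (br (m t) (x t)) (Dx t)
        = \<kappa> (\<Lambda> A) A + (\<kappa> (P t (f' t)) (x t) + \<kappa> (P t (f t)) (Dx t))"
      unfolding D p w[symmetric] using sym_\<Lambda>[of A B] \<kappa>_commute[of A "\<Lambda> B"]
      by (simp add: \<kappa>_simps \<Lambda>_simps)
    moreover have "\<kappa> (\<Lambda> A) A \<ge> 0"
      using pos_\<Lambda>[of A] \<kappa>_commute[of A "\<Lambda> A"] by (cases "A = 0") (auto simp: \<kappa>_simps less_imp_le)
    ultimately show ?thesis by simp
  qed
  have bound: "\<kappa> (\<Lambda> (Dx t)) (Dx t) - \<kappa> (br (m t) (x t)) (Dx t)
      \<le> l * \<omega>\<^sup>2 - \<mu> * \<omega> + \<mu> * \<omega> * cos (\<omega> * (t - \<epsilon>))" for t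
  proof -
    define c s where "c = cos (\<omega> * (t - \<epsilon>))" and "s = sin (\<omega> * (t - \<epsilon>))"
    have cs: "s\<^sup>2 = 1 - c\<^sup>2" by (simp add: c_def s_def sin_squared_eq)
    have "\<kappa> (Dx t) (Dx t) = \<omega>\<^sup>2 * (c\<^sup>2 + s\<^sup>2)"
      unfolding Dx_def c_def[symmetric] s_def[symmetric]
      by (simp add: \<kappa>_simps aa ab bb algebra_simps power2_eq_square)
    then have "\<kappa> (\<Lambda> (Dx t)) (Dx t) \<le> l * \<omega>\<^sup>2" using l(2)[of "Dx t"] by (simp add: cs)
    moreover have "\<kappa> (br (m t) (x t)) (Dx t) = \<mu> * \<omega> * (s\<^sup>2 + (c - 1) * c)"
      unfolding Dx_def x_def c_def[symmetric] s_def[symmetric]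
      by (simp add: \<kappa>_simps br_simps ma mb aa ab bb algebra_simps power2_eq_square)
    then have "\<kappa> (br (m t) (x t)) (Dx t) = \<mu> * \<omega> - \<mu> * \<omega> * c"
      unfolding cs by (simp add: algebra_simps power2_eq_square)
    ultimately show ?thesis by (simp add: c_def)
  qed
  \<comment> \<open>Subtracting an antiderivative of the bound lets monotonicity replace
    integration. The sine and \<open>F\<close> vanish at both ends, so only the linear term is left
    to give the contradiction.\<close>
  define G where "G t = F t - ((l * \<omega>\<^sup>2 - \<mu> * \<omega>) * t + \<mu> * sin (\<omega> * (t - \<epsilon>)))" for t
  have "G T \<le> G \<epsilon>"
  proof (rule DERIV_nonpos_imp_nonincreasing[where f = G and a = \<epsilon>])
    show "\<epsilon> \<le> T" using T\<epsilon>0 by simp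
    fix t assume t: "\<epsilon> \<le> t" "t \<le> T"
    have "((\<lambda>t. (l * \<omega>\<^sup>2 - \<mu> * \<omega>) * t + \<mu> * sin (\<omega> * (t - \<epsilon>))) has_real_derivative
        (l * \<omega>\<^sup>2 - \<mu> * \<omega>) + \<mu> * \<omega> * cos (\<omega> * (t - \<epsilon>))) (at t)"
      by (auto intro!: derivative_eq_intros)
    from DERIV_diff[OF F'[OF sub[OF t]] this]
    show "\<exists>y. (G has_real_derivative y) (at t) \<and> y \<le> 0"
      unfolding G_def[abs_def] using F'_le[OF sub[OF t]] bound[of t] by (intro exI conjI) auto
  qed
  moreover have "\<omega> * (T - \<epsilon>) = 2 * pi" using T\<epsilon>0 by (simp add: \<omega>_def)
  then have "G T = - ((l * \<omega>\<^sup>2 - \<mu> * \<omega>) * T)"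
    unfolding G_def F_def by (simp only: x_ends) (simp add: \<kappa>_simps)
  moreover have "G \<epsilon> = - ((l * \<omega>\<^sup>2 - \<mu> * \<omega>) * \<epsilon>)"
    unfolding G_def F_def by (simp only: x_ends) (simp add: \<kappa>_simps)
  ultimately have "0 \<le> (l * \<omega>\<^sup>2 - \<mu> * \<omega>) * (T - \<epsilon>)"
    by (simp add: right_diff_distrib)
  then have "0 \<le> \<omega> * (l * \<omega> - \<mu>)"
  proof -
    have "0 \<le> l * \<omega>\<^sup>2 - \<mu> * \<omega>"
      using \<open>0 \<le> (l * \<omega>\<^sup>2 - \<mu> * \<omega>) * (T - \<epsilon>)\<close> T\<epsilon>0 by (simp only: zero_le_mult_iff) linarith
    then show ?thesis by (simp add: algebra_simps power2_eq_square)
  qed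
  then have "\<mu> \<le> l * \<omega>" using \<omega> by (simp add: zero_le_mult_iff)
  then have "\<mu> * (T - \<epsilon>) \<le> 2 * pi * l" using T\<epsilon>0 by (simp add: \<omega>_def field_simps)
  then have "T - \<epsilon> \<le> 2 * pi * l / \<mu>" using \<mu> by (simp add: field_simps)
  then show False using T\<epsilon> by simp
qed

section \<open>Existence of the least conjugate time, and both bounds\<close>

lemma eigenvalue_positive: "l \<in> eigenvalues \<Lambda> \<Longrightarrow> l > 0"
proof -
  assume "l \<in> eigenvalues \<Lambda>"
  then obtain v where v: "v \<noteq> 0" "\<Lambda> v = l *\<^sub>R v" by (auto simp: eigenvalues_def)
  then have "l * \<kappa> v v > 0" using pos_\<Lambda>[of v] by (simp add: \<kappa>_simps)
  then show ?thesis using inner_product_nonneg[OF ip, of v] by (simp add: zero_less_mult_iff)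
qed

lemma conj_time_bounds:
  defines "lm \<equiv> Min (eigenvalues \<Lambda>)" and "lM \<equiv> Max (eigenvalues \<Lambda>)"
  shows "(\<exists>\<tau>. conj_time \<tau>) \<longleftrightarrow> (\<exists>v. br (m 0) v \<noteq> 0)"
    and "(\<exists>\<tau>. conj_time \<tau>) \<Longrightarrow> \<exists>\<tau>. conj_time \<tau> \<and> (\<forall>\<sigma>. conj_time \<sigma> \<longrightarrow> \<tau> \<le> \<sigma>) \<and>
      2 * pi * lm / \<mu> \<le> \<tau> \<and> \<tau> \<le> 2 * pi * lM / \<mu>"
proof -
  note eb = eigenvalue_bounds[where T = \<Lambda>, OF ip lin_\<Lambda> sym_\<Lambda>]
  have fin: "finite (eigenvalues \<Lambda>)" by (rule finite_eigenvalues[where T = \<Lambda>, OF ip sym_\<Lambda>])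
  have lm: "lm > 0" and lM: "lM > 0"
    unfolding lm_def lM_def using Min_in[OF fin eb(1)] Max_in[OF fin eb(1)] eigenvalue_positive by auto
  \<comment> \<open>Kept as a product because \<open>\<mu> > 0\<close> is not yet known; it is
    deduced from this inequality in \<open>\<mu>_conj\<close>.\<close>
  have lower: "2 * pi * lm \<le> \<mu> * \<tau>" if c: "conj_time \<tau>" for \<tau>
  proof (rule ccontr)
    assume n: "\<not> 2 * pi * lm \<le> \<mu> * \<tau>"
    obtain v w t where v: "\<tau> > 0" "jac v w" "v 0 = 0" "v \<tau> = 0" "v t \<noteq> 0"
      using c by (auto simp: conj_time_def)
    \<comment> \<open>The smallest admissible frequency is \<open>\<mu> / (2 * lm)\<close>; the
      negated bound says that its product with \<open>\<tau>\<close> is below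
      \<open>pi\<close>.\<close>
    have "v t = 0"
      by (rule early_jacobi_field_zero[OF v(2,3,4,1) lm, of "\<mu> / (2 * lm)"])
        (use eb(3) lm \<mu>_nonneg n in \<open>auto simp: lm_def[symmetric] field_simps\<close>)
    then show False using v by simp
  qed
  have \<mu>_conj: "\<mu> > 0" if "conj_time \<tau>" for \<tau>
  proof -
    have "\<mu> \<noteq> 0" using lower[OF that] lm by (metis mult_zero_left mult_pos_pos not_le pi_gt_zero zero_less_numeral)
    then show ?thesis using \<mu>_nonneg by simp
  qed
  have upper: "\<exists>\<tau>\<le>T. conj_time \<tau>" if "\<mu> > 0" "T > 2 * pi * lM / \<mu>" for T
    by (rule conj_time_exists[OF that(1) lM _ that(2)]) (use eb(2) in \<open>simp add: lM_def\<close>)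
  show iff: "(\<exists>\<tau>. conj_time \<tau>) \<longleftrightarrow> (\<exists>v. br (m 0) v \<noteq> 0)"
  proof
    assume "\<exists>\<tau>. conj_time \<tau>"
    then have "\<mu> > 0" using \<mu>_conj by blast
    then show "\<exists>v. br (m 0) v \<noteq> 0" using \<mu>_eq_0_iff by auto
  next
    assume "\<exists>v. br (m 0) v \<noteq> 0"
    then have "\<mu> > 0" using \<mu>_eq_0_iff \<mu>_nonneg by (metis less_eq_real_def)
    then show "\<exists>\<tau>. conj_time \<tau>" using upper[of "2 * pi * lM / \<mu> + 1"] by auto
  qed
  assume "\<exists>\<tau>. conj_time \<tau>"
  then obtain \<tau>0 where \<tau>0: "conj_time \<tau>0" by blast
  then have \<mu>: "\<mu> > 0" by (rule \<mu>_conj)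
  have low: "2 * pi * lm / \<mu> \<le> \<sigma>" if "conj_time \<sigma>" for \<sigma>
    using lower[OF that] \<mu> by (simp add: pos_divide_le_eq mult.commute)
  define X where "X = {\<sigma>. conj_time \<sigma>}"
  have X: "X \<noteq> {}" "bdd_below X" using \<tau>0 low by (auto simp: X_def bdd_below_def)
  define \<tau> where "\<tau> = Inf X"
  have ge: "2 * pi * lm / \<mu> \<le> \<tau>" unfolding \<tau>_def by (rule cInf_greatest) (use X low in \<open>auto simp: X_def\<close>)
  \<comment> \<open>The lower bound excludes an accumulation of conjugate times at 0, where
    \<open>V\<close> degenerates for trivial reasons.\<close>
  then have pos: "\<tau> > 0" using lm \<mu> by (meson divide_pos_pos less_le_trans mult_pos_pos pi_gt_zero zero_less_numeral)
  have first: "\<tau> \<le> \<sigma>" if "conj_time \<sigma>" for \<sigma>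
    unfolding \<tau>_def by (rule cInf_lower[OF _ X(2)]) (use that in \<open>simp add: X_def\<close>)
  have "conj_time \<tau>"
  proof (rule ccontr)
    assume "\<not> conj_time \<tau>"
    then have "\<tau> \<in> {t. inj (V t)}" using pos conj_time_iff by simp
    then obtain d where d: "d > 0" "ball \<tau> d \<subseteq> {t. inj (V t)}"
      using open_inj_V open_contains_ball by blast
    obtain \<sigma> where \<sigma>: "\<sigma> \<in> X" "\<sigma> < \<tau> + d"
      using cInf_lessD[OF X(1), of "\<tau> + d"] d(1) unfolding \<tau>_def by auto
    then have "\<sigma> \<in> ball \<tau> d" using first[of \<sigma>] by (simp add: X_def dist_real_def)
    then show False using d(2) \<sigma>(1) conj_time_iff by (auto simp: X_def)
  qed
  moreover have "\<tau> \<le> 2 * pi * lM / \<mu>"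
  \<comment> \<open>\<open>upper\<close> needs a strict excess over the bound; letting the excess
    shrink gives the closed inequality for the least conjugate time.\<close>
  proof (rule field_le_epsilon)
    fix e :: real assume "e > 0"
    then obtain \<sigma> where "\<sigma> \<le> 2 * pi * lM / \<mu> + e" "conj_time \<sigma>" using upper[OF \<mu>, of "2 * pi * lM / \<mu> + e"] by auto
    then show "\<tau> \<le> 2 * pi * lM / \<mu> + e" using first by force
  qed
  ultimately show "\<exists>\<tau>. conj_time \<tau> \<and> (\<forall>\<sigma>. conj_time \<sigma> \<longrightarrow> \<tau> \<le> \<sigma>) \<and>
      2 * pi * lm / \<mu> \<le> \<tau> \<and> \<tau> \<le> 2 * pi * lM / \<mu>" using first ge by blast
qed

end

section \<open>Levi-Civita connection in a frame\<close>

lemma has_derivative_apply2: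
  fixes X :: "'a::real_normed_vector \<Rightarrow> 'b::euclidean_space" and Y :: "'a \<Rightarrow> 'c::euclidean_space"
    and G :: "'a \<Rightarrow> 'b \<Rightarrow> 'c \<Rightarrow> 'd::real_normed_vector"
  assumes S: "open S" "x \<in> S" and bil: "\<And>y. y \<in> S \<Longrightarrow> bilinear (G y)"
    and G: "\<And>b c. (\<lambda>y. G y b c) differentiable (at x)"
    and X: "(X has_derivative X') (at x)" and Y: "(Y has_derivative Y') (at x)"
  shows "fd (\<lambda>y. G y (X y) (Y y)) x h
      = fd (\<lambda>y. G y (X x) (Y x)) x h + G x (X' h) (Y x) + G x (X x) (Y' h)"
    and "(\<lambda>y. G y (X y) (Y y)) differentiable (at x)"
proof -
  have lin1: "linear (\<lambda>b. G y b c)" and lin2: "linear (G y b)" if "y \<in> S" for y b c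
    using bil[OF that] by (simp_all add: bilinear_def)
  have 1: "fd (\<lambda>y. G y (X y) c) x h = G x (X' h) c + fd (\<lambda>y. G y (X x) c) x h"
    and 2: "(\<lambda>y. G y (X y) c) differentiable (at x)" for c h
    by (rule has_derivative_apply[where E = "\<lambda>y b. G y b c", OF S lin1 has_derivative_fd[OF G]
          linear_fd_family[OF S lin1 G] X]; assumption)+
  note 3 = has_derivative_apply[where E = "\<lambda>y. G y (X y)", OF S lin2 has_derivative_fd[OF 2]
      linear_fd_family[OF S lin2 2] Y]
  from 3(1) show "fd (\<lambda>y. G y (X y) (Y y)) x h
      = fd (\<lambda>y. G y (X x) (Y x)) x h + G x (X' h) (Y x) + G x (X x) (Y' h)"
    by (simp add: 1)
  from 3(2) show "(\<lambda>y. G y (X y) (Y y)) differentiable (at x)" by blast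
qed

text \<open>The formula of \<open>christoffel\<close> for a metric given directly on coordinate
  space, which frees the computations in a frame from charts.\<close>

definition christoffel_of :: "('e::real_normed_vector \<Rightarrow> 'e \<Rightarrow> 'e \<Rightarrow> real) \<Rightarrow> 'e \<Rightarrow> 'e \<Rightarrow> 'e \<Rightarrow> 'e" where
  "christoffel_of G x v w = (THE z. \<forall>y. G x z y
    = (fd (\<lambda>p. G p w y) x v + fd (\<lambda>p. G p v y) x w - fd (\<lambda>p. G p v w) x y) / 2)"

definition curvature_of :: "('e::real_normed_vector \<Rightarrow> 'e \<Rightarrow> 'e \<Rightarrow> 'e) \<Rightarrow> 'e \<Rightarrow> 'e \<Rightarrow> 'e \<Rightarrow> 'e \<Rightarrow> 'e" where
  "curvature_of \<Gamma> x u v w = fd (\<lambda>y. \<Gamma> y v w) x u - fd (\<lambda>y. \<Gamma> y u w) x v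
    + \<Gamma> x u (\<Gamma> x v w) - \<Gamma> x v (\<Gamma> x u w)"

text \<open>\<open>E x v\<close> is the value at \<open>x\<close> of the frame field with constant components \<open>v\<close>.\<close>

locale local_frame =
  fixes U :: "'e::euclidean_space set" and E :: "'e \<Rightarrow> 'e \<Rightarrow> 'e" and br :: "'e \<Rightarrow> 'e \<Rightarrow> 'e"
  assumes open_U: "open U" and nonempty_U: "U \<noteq> {}"
    and linear_E: "x \<in> U \<Longrightarrow> linear (E x)" and inj_E: "x \<in> U \<Longrightarrow> inj (E x)"
    and smooth_E: "smooth_on U (\<lambda>x. E x v)"
    and bracket: "x \<in> U \<Longrightarrow> fd (\<lambda>y. E y v) x (E x u) - fd (\<lambda>y. E y u) x (E x v) = E x (br u v)"
begin

lemma E_diff: "x \<in> U \<Longrightarrow> (\<lambda>y. E y v) differentiable (at x)"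
  by (rule smooth_on_differentiable[OF smooth_E])

lemma E_eqD: "x \<in> U \<Longrightarrow> E x u = E x v \<Longrightarrow> u = v"
  by (rule injD[OF inj_E])

lemma linear_DE1: "x \<in> U \<Longrightarrow> linear (fd (\<lambda>y. E y v) x)"
  by (rule linear_fd[OF E_diff])

lemma linear_DE2: "x \<in> U \<Longrightarrow> linear (\<lambda>v. fd (\<lambda>y. E y v) x h)"
  by (rule linear_fd_family[OF open_U _ linear_E E_diff])

lemmas E_simps = linear_add[OF linear_E] linear_diff[OF linear_E] linear_cmul[OF linear_E]
  linear_neg[OF linear_E] linear_0[OF linear_E]
lemmas DE_simps = linear_add[OF linear_DE1] linear_diff[OF linear_DE1] linear_cmul[OF linear_DE1]
  linear_neg[OF linear_DE1] linear_0[OF linear_DE1]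
  linear_add[OF linear_DE2] linear_diff[OF linear_DE2] linear_cmul[OF linear_DE2]
  linear_neg[OF linear_DE2] linear_0[OF linear_DE2]

text \<open>The algebraic laws of \<open>br\<close> can be read off at a single point of
  \<open>U\<close>, since \<open>E x\<close> is injective there.\<close>

lemma br_skew: "br u v = - br v u"
proof -
  obtain x where x: "x \<in> U" using nonempty_U by blast
  have "E x (br u v) = E x (- br v u)"
    unfolding E_simps[OF x] bracket[OF x, symmetric] by simp
  then show ?thesis by (rule E_eqD[OF x])
qed

lemma bilinear_br: "bilinear br"
proof -
  obtain x where x: "x \<in> U" using nonempty_U by blast
  note b = bracket[OF x, symmetric] and s = E_simps[OF x] DE_simps[OF x]
  have "br u (v + w) = br u v + br u w" "br u (r *\<^sub>R v) = r *\<^sub>R br u v" for u v w r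
    by (rule E_eqD[OF x], simp add: b s algebra_simps)+
  then have 1: "linear (br u)" for u by (simp add: linearI)
  moreover have "linear (\<lambda>u. br u v)" for v
    using linear_compose_neg[OF 1] by (simp add: br_skew[of _ v])
  ultimately show ?thesis by (simp add: bilinear_def)
qed

lemma second_derivative_E:
  assumes x: "x \<in> U"
  shows "fd (\<lambda>y. fd (\<lambda>z. E z w) y (E y v)) x h
      = fd (\<lambda>y. fd (\<lambda>z. E z w) y (E x v)) x h + fd (\<lambda>z. E z w) x (fd (\<lambda>y. E y v) x h)"
    and "(\<lambda>y. fd (\<lambda>z. E z w) y (E y v)) differentiable (at x)"
proof -
  have d: "(\<lambda>y. fd (\<lambda>z. E z w) y a) differentiable (at x)" for a
    by (rule smooth_on_differentiable[OF smooth_on_fd[OF smooth_E] x])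
  note a = has_derivative_apply[where E = "\<lambda>y. fd (\<lambda>z. E z w) y", OF open_U x linear_DE1
      has_derivative_fd[OF d] linear_fd_family[OF open_U x linear_DE1 d] has_derivative_fd[OF E_diff[OF x]]]
  show "fd (\<lambda>y. fd (\<lambda>z. E z w) y (E y v)) x h
      = fd (\<lambda>y. fd (\<lambda>z. E z w) y (E x v)) x h + fd (\<lambda>z. E z w) x (fd (\<lambda>y. E y v) x h)"
    using a(1) by simp
  show "(\<lambda>y. fd (\<lambda>z. E z w) y (E y v)) differentiable (at x)" by (rule a(2))
qed

lemma second_derivative_E_commute:
  "x \<in> U \<Longrightarrow> fd (\<lambda>y. fd (\<lambda>z. E z w) y a) x b = fd (\<lambda>y. fd (\<lambda>z. E z w) y b) x a"
  by (rule symmetric_second_derivative[OF open_U _ smooth_onD[OF smooth_E]])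

text \<open>The Jacobi identity for vector fields, expanded: since \<open>br v w\<close> is
  constant, \<open>E x (br v w)\<close> can be differentiated as a frame field. The second
  derivatives \<open>S\<close> are symmetric and cancel in the combination, as do the remaining
  first-order terms.\<close>

lemma br_jacobi: "br u (br v w) = br (br u v) w + br v (br u w)"
proof -
  obtain x where x: "x \<in> U" using nonempty_U by blast
  define n where "n a v = fd (\<lambda>y. E y v) x a" for a v
  define N where "N u v = n (E x u) v" for u v
  define S where "S w u v = fd (\<lambda>y. fd (\<lambda>z. E z w) y (E x u)) x (E x v)" for w u v
  have S: "S w u v = S w v u" for u v w unfolding S_def by (rule second_derivative_E_commute[OF x])
  have n_simps: "n (a - b) v = n a v - n b v" for a b v by (simp add: n_def DE_simps[OF x])
  have E_br: "E x (br v w) = N v w - N w v" for v w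
    using bracket[OF x] by (simp add: N_def n_def)
  have D: "N u (br v w) = S w v u + n (N u v) w - (S v w u + n (N u w) v)" for u v w
  proof -
    have "N u (br v w) = fd (\<lambda>y. fd (\<lambda>z. E z w) y (E y v) - fd (\<lambda>z. E z v) y (E y w)) x (E x u)"
      unfolding N_def n_def
      by (rule fun_cong[OF frechet_derivative_transform_within_open[OF E_diff[OF x] open_U x]])
        (simp add: bracket)
    also have "\<dots> = fd (\<lambda>y. fd (\<lambda>z. E z w) y (E y v)) x (E x u) - fd (\<lambda>y. fd (\<lambda>z. E z v) y (E y w)) x (E x u)"
      using second_derivative_E(2)[OF x]
      by (intro fun_cong[OF fd_eqI] has_derivative_diff has_derivative_fd)
    finally show ?thesis
      by (simp add: second_derivative_E(1)[OF x] S_def n_def N_def)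
  qed
  have T: "E x (br u (br v w)) = S w v u + n (N u v) w - (S v w u + n (N u w) v) - n (N v w) u + n (N w v) u"
    for u v w
    by (simp add: E_br D) (simp add: N_def E_br[unfolded N_def] n_simps)
  have "E x (br u (br v w)) = E x (br (br u v) w + br v (br u w))"
    by (simp only: E_simps[OF x] br_skew[of "br u v" w] T)
      (simp add: S[of _ u] S[of _ v w] algebra_simps)
  then show ?thesis by (rule E_eqD[OF x])
qed

end

text \<open>\<open>B\<close> stands for the Levi-Civita connection on frame fields. The metric has
  constant components \<open>H\<close> in the frame, so Koszul's formula contains no derivatives of
  the metric.\<close>

locale metric_frame = local_frame +
  fixes G :: "'e::euclidean_space \<Rightarrow> 'e \<Rightarrow> 'e \<Rightarrow> real" and H :: "'e \<Rightarrow> 'e \<Rightarrow> real" and B :: "'e \<Rightarrow> 'e \<Rightarrow> 'e"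
  assumes ip_G: "x \<in> U \<Longrightarrow> inner_product (G x)" and smooth_G: "smooth_on U (\<lambda>x. G x v w)"
    and G_E: "x \<in> U \<Longrightarrow> G x (E x u) (E x v) = H u v"
    and bilinear_B: "bilinear B"
    and koszul: "2 * H (B u v) w = H (br u v) w - H (br v w) u + H (br w u) v"
begin

abbreviation "\<Gamma> \<equiv> christoffel_of G"

lemma surj_E: "x \<in> U \<Longrightarrow> \<exists>v. E x v = a"
  using linear_inj_inv(2)[OF linear_E inj_E] by blast

text \<open>Constancy of the metric components expresses the derivatives of \<open>G\<close> through
  those of the frame; by \<open>bracket\<close> they combine into Koszul's formula, and
  nondegeneracy of \<open>G x\<close> settles the \<open>THE\<close>. The content is that the
  covariant derivative of one frame field along another is given by \<open>B\<close>.\<close>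

lemma christoffel_frame:
  assumes x: "x \<in> U"
  shows "\<Gamma> x (E x u) (E x v) = E x (B u v) - fd (\<lambda>y. E y v) x (E x u)"
proof -
  define N where "N u v = fd (\<lambda>y. E y v) x (E x u)" for u v
  have bilG: "bilinear (G y)" if "y \<in> U" for y by (rule inner_product_bilinear[OF ip_G[OF that]])
  note G_simps = bilinear_ladd[OF bilG[OF x]] bilinear_radd[OF bilG[OF x]] bilinear_lsub[OF bilG[OF x]]
    bilinear_rsub[OF bilG[OF x]]
  have Gc: "G x a b = G x b a" for a b using ip_G[OF x] by (simp add: inner_product_def)
  have E_br: "N v w = N w v + E x (br v w)" for v w
    using bracket[OF x, of w v] by (simp add: N_def algebra_simps)
  \<comment> \<open>The arguments are frozen at \<open>x\<close>, as in the definition of the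
    Christoffel symbols; the product rule compares this with the constant function
    \<open>G p (E p v) (E p w)\<close>.\<close>
  have D: "fd (\<lambda>p. G p (E x v) (E x w)) x (E x u) = - G x (N u v) (E x w) - G x (E x v) (N u w)" for u v w
  proof -
    have "fd (\<lambda>p. G p (E p v) (E p w)) x (E x u)
      = fd (\<lambda>p. G p (E x v) (E x w)) x (E x u) + G x (N u v) (E x w) + G x (E x v) (N u w)"
      unfolding N_def
      by (rule has_derivative_apply2(1)[OF open_U x bilG smooth_on_differentiable[OF smooth_G x]
            has_derivative_fd[OF E_diff[OF x]] has_derivative_fd[OF E_diff[OF x]]])
    moreover have "fd (\<lambda>p. G p (E p v) (E p w)) x = (\<lambda>_. 0)"
      by (rule fd_eqI, rule has_derivative_transform_within_open[OF has_derivative_const open_U x, of "H v w"])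
        (simp add: G_E)
    ultimately show ?thesis by (simp add: fun_eq_iff algebra_simps)
  qed
  have eq: "G x (E x (B u v) - N u v) y = (fd (\<lambda>p. G p (E x v) y) x (E x u)
      + fd (\<lambda>p. G p (E x u) y) x (E x v) - fd (\<lambda>p. G p (E x u) (E x v)) x y) / 2" for y
  proof -
    obtain w where y: "y = E x w" using surj_E[OF x] by metis
    have k: "2 * G x (E x (B u v)) (E x w) = G x (E x (br u v)) (E x w) - G x (E x (br v w)) (E x u)
        + G x (E x (br w u)) (E x v)"
      unfolding G_E[OF x] by (rule koszul)
    show ?thesis
      unfolding y D using k
      by (simp add: E_br[of v w] E_br[of w u] E_br[of u v] G_simps Gc[of "E x v"] Gc[of "E x u"]
          Gc[of "E x w"] field_simps)
  qed
  show ?thesis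
    unfolding christoffel_of_def N_def[symmetric]
  proof (rule the_equality)
    fix z assume "\<forall>y. G x z y = (fd (\<lambda>p. G p (E x v) y) x (E x u)
      + fd (\<lambda>p. G p (E x u) y) x (E x v) - fd (\<lambda>p. G p (E x u) (E x v)) x y) / 2"
    then show "z = E x (B u v) - N u v"
      by (intro inner_product_eqI[OF ip_G[OF x]]) (simp add: eq)
  qed (simp add: eq)
qed

abbreviation "Ei x \<equiv> inv (E x)"

lemma E_Ei: "x \<in> U \<Longrightarrow> E x (Ei x a) = a"
  by (simp add: linear_inj_inv(2) linear_E inj_E)

lemma linear_Ei: "x \<in> U \<Longrightarrow> linear (Ei x)"
  by (simp add: linear_inj_inv(1) linear_E inj_E)

lemma smooth_Ei: "smooth_on U (\<lambda>x. Ei x v)"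
  unfolding smooth_on_def
  by (intro allI Ck_on_inverse_family[OF open_U linear_E inj_E smooth_onD[OF smooth_E]])

lemma christoffel_eq:
  assumes x: "x \<in> U"
  shows "\<Gamma> x a b = E x (B (Ei x a) (Ei x b)) - fd (\<lambda>y. E y (Ei x b)) x a"
  using christoffel_frame[OF x, of "Ei x a" "Ei x b"] by (simp add: E_Ei[OF x])

lemma bilinear_christoffel:
  assumes x: "x \<in> U"
  shows "bilinear (\<Gamma> x)"
  unfolding bilinear_def
  by (intro conjI allI linearI)
    (simp_all add: christoffel_eq[OF x] E_simps[OF x] DE_simps[OF x] linear_add[OF linear_Ei[OF x]]
      linear_cmul[OF linear_Ei[OF x]] bilinear_ladd[OF bilinear_B] bilinear_radd[OF bilinear_B]
      bilinear_lmul[OF bilinear_B] bilinear_rmul[OF bilinear_B] algebra_simps)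

lemma christoffel_diff:
  assumes x: "x \<in> U"
  shows "(\<lambda>y. \<Gamma> y a b) differentiable (at x)"
proof -
  have EiD: "(\<lambda>y. Ei y c) differentiable (at x)" for c
    by (rule smooth_on_differentiable[OF smooth_Ei x])
  have "((\<lambda>y. B (Ei y a) (Ei y b)) has_derivative
      (\<lambda>h. B (Ei x a) (fd (\<lambda>y. Ei y b) x h) + B (fd (\<lambda>y. Ei y a) x h) (Ei x b))) (at x)"
    by (rule bounded_bilinear.FDERIV[OF bilinear_B[unfolded bilinear_conv_bounded_bilinear]
          has_derivative_fd[OF EiD] has_derivative_fd[OF EiD]])
  note has_derivative_apply(2)[where E = E, OF open_U x linear_E has_derivative_fd[OF E_diff[OF x]]
          linear_DE2[OF x] this]
  then have 1: "(\<lambda>y. E y (B (Ei y a) (Ei y b))) differentiable (at x)" .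
  have d: "(\<lambda>y. fd (\<lambda>z. E z c) y a) differentiable (at x)" for c
    by (rule smooth_on_differentiable[OF smooth_on_fd[OF smooth_E] x])
  have 2: "(\<lambda>y. fd (\<lambda>z. E z (Ei y b)) y a) differentiable (at x)"
    by (rule has_derivative_apply(2)[where E = "\<lambda>y c. fd (\<lambda>z. E z c) y a", OF open_U x linear_DE2
          has_derivative_fd[OF d] linear_fd_family[OF open_U x linear_DE2 d] has_derivative_fd[OF EiD]])
  have "(\<lambda>y. E y (B (Ei y a) (Ei y b)) - fd (\<lambda>z. E z (Ei y b)) y a) differentiable (at x)"
    using 1 2 by (rule differentiable_diff)
  then show ?thesis
    unfolding differentiable_def
    using has_derivative_transform_within_open[OF _ open_U x, of _ _ UNIV "\<lambda>y. \<Gamma> y a b"] christoffel_eq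
    by (metis (no_types, lifting))
qed

text \<open>Differentiating \<open>christoffel_frame\<close> along the frame produces second
  derivatives of the frame, whose symmetry removes them from the antisymmetrised expression, and
  first-order terms, which cancel or combine into \<open>B (br u v) w\<close>.\<close>

lemma curvature_frame:
  assumes x: "x \<in> U"
  shows "curvature_of \<Gamma> x (E x u) (E x v) (E x w) = E x (B u (B v w) - B v (B u w) - B (br u v) w)"
proof -
  define n where "n a v = fd (\<lambda>y. E y v) x a" for a v
  define N where "N u v = n (E x u) v" for u v
  define S where "S w u v = fd (\<lambda>y. fd (\<lambda>z. E z w) y (E x u)) x (E x v)" for w u v
  have S: "S w u v = S w v u" for u v w unfolding S_def by (rule second_derivative_E_commute[OF x])
  have n_simps: "n (a - b) v = n a v - n b v" for a b v by (simp add: n_def DE_simps[OF x])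
  have E_br: "E x (br v w) = N v w - N w v" for v w
    using bracket[OF x] by (simp add: N_def n_def)
  have C: "\<Gamma> x (E x u) (E x v) = E x (B u v) - N u v" for u v
    unfolding N_def n_def by (rule christoffel_frame[OF x])
  note \<Gamma>_simps = bilinear_lsub[OF bilinear_christoffel[OF x]] bilinear_rsub[OF bilinear_christoffel[OF x]]
  have D: "fd (\<lambda>y. \<Gamma> y (E x v) (E x w)) x (E x u) = N u (B v w) - S w v u - n (N u v) w
      - \<Gamma> x (N u v) (E x w) - \<Gamma> x (E x v) (N u w)" for u v w
  proof -
    have "fd (\<lambda>y. \<Gamma> y (E y v) (E y w)) x (E x u) = fd (\<lambda>y. \<Gamma> y (E x v) (E x w)) x (E x u)
        + \<Gamma> x (N u v) (E x w) + \<Gamma> x (E x v) (N u w)"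
      unfolding N_def n_def
      by (rule has_derivative_apply2(1)[OF open_U x bilinear_christoffel christoffel_diff[OF x]
            has_derivative_fd[OF E_diff[OF x]] has_derivative_fd[OF E_diff[OF x]]])
    moreover have "fd (\<lambda>y. \<Gamma> y (E y v) (E y w)) x (E x u) = N u (B v w) - (S w v u + n (N u v) w)"
    proof -
      have "((\<lambda>y. E y (B v w) - fd (\<lambda>z. E z w) y (E y v)) has_derivative
          (\<lambda>h. fd (\<lambda>y. E y (B v w)) x h - fd (\<lambda>y. fd (\<lambda>z. E z w) y (E y v)) x h)) (at x)"
        by (intro has_derivative_diff has_derivative_fd E_diff second_derivative_E(2) x)
      then have "((\<lambda>y. \<Gamma> y (E y v) (E y w)) has_derivative
          (\<lambda>h. fd (\<lambda>y. E y (B v w)) x h - fd (\<lambda>y. fd (\<lambda>z. E z w) y (E y v)) x h)) (at x)"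
        by (rule has_derivative_transform_within_open[OF _ open_U x]) (simp add: christoffel_frame)
      from fd_eqI[OF this] show ?thesis
        by (simp add: second_derivative_E(1)[OF x] S_def n_def N_def)
    qed
    ultimately show ?thesis by (simp add: algebra_simps)
  qed
  have G2: "\<Gamma> x (E x u) (\<Gamma> x (E x v) (E x w)) = E x (B u (B v w)) - N u (B v w) - \<Gamma> x (E x u) (N v w)" for u v w
    by (simp add: C \<Gamma>_simps)
  have G3: "\<Gamma> x (N u v) (E x w) - \<Gamma> x (N v u) (E x w) = E x (B (br u v) w) - (n (N u v) w - n (N v u) w)"
    using C[of "br u v" w] by (simp add: E_br \<Gamma>_simps) (simp add: N_def E_br[unfolded N_def] n_simps)
  show ?thesis
    unfolding curvature_of_def D G2 using G3 S[of w u v]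
    by (simp add: E_simps[OF x] algebra_simps)
qed

lemma covariant_derivative_frame:
  assumes x: "x t \<in> U" and x': "(x has_vector_derivative E (x t) u) (at t)"
    and v: "(v has_vector_derivative v') (at t)"
  shows "vector_derivative (\<lambda>s. E (x s) (v s)) (at t) + \<Gamma> (x t) (E (x t) u) (E (x t) (v t))
    = E (x t) (v' + B u (v t))"
proof -
  define D where "D = fd (\<lambda>y. E y (v t)) (x t) (E (x t) u) + E (x t) v'"
  have cont: "isCont x t" using x' by (rule has_vector_derivative_continuous)
  obtain S where S: "open S" "t \<in> S" "\<And>s. s \<in> S \<Longrightarrow> x s \<in> U"
    using cont open_U x unfolding continuous_at_open by metis
  have xd: "(x has_derivative (\<lambda>h. h *\<^sub>R E (x t) u)) (at t)" and vd: "(v has_derivative (\<lambda>h. h *\<^sub>R v')) (at t)"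
    using x' v by (simp_all add: has_vector_derivative_def)
  have Ed: "((\<lambda>s. E (x s) b) has_derivative (\<lambda>h. fd (\<lambda>y. E y b) (x t) (h *\<^sub>R E (x t) u))) (at t)" for b
    by (rule has_derivative_fd_compose[OF xd E_diff[OF x]])
  note a = has_derivative_apply[where E = "\<lambda>s. E (x s)", OF S(1,2) linear_E[OF S(3)] Ed linear_DE2[OF x] vd]
  have "fd (\<lambda>s. E (x s) (v s)) t = (\<lambda>h. h *\<^sub>R D)"
    by (rule ext) (simp add: a(1) D_def E_simps[OF x] DE_simps[OF x] scaleR_add_right)
  then have "((\<lambda>s. E (x s) (v s)) has_vector_derivative D) (at t)"
    using has_derivative_fd[OF a(2)] by (simp add: has_vector_derivative_def)
  then have "vector_derivative (\<lambda>s. E (x s) (v s)) (at t) = D" by (rule vector_derivative_at)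
  then show ?thesis by (simp add: D_def christoffel_frame[OF x] E_simps[OF x])
qed

end

section \<open>Smooth maps in charts\<close>

text \<open>The coordinate expression of \<open>f\<close>, meaningful on \<open>cset\<close>. For
  the identity it is a transition map, so tangent maps and changes of coordinates obey one chain
  rule.\<close>

definition crep :: "('m, 'e) chart \<Rightarrow> ('n, 'f) chart \<Rightarrow> ('m \<Rightarrow> 'n) \<Rightarrow> 'e \<Rightarrow> 'f" where
  "crep c d f x = cmap d (f (cinv c x))"

definition cset :: "('m, 'e) chart \<Rightarrow> ('n, 'f) chart \<Rightarrow> ('m \<Rightarrow> 'n) \<Rightarrow> 'e set" where
  "cset c d f = cmap c ` (cdom c \<inter> f -` cdom d)"

locale manifold =
  fixes A :: "('m::{t2_space, second_countable_topology}, 'e::euclidean_space) chart set"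
  assumes smooth_atlas: "smooth_atlas A"
begin

lemma chart_at: "chart_at A p \<in> A" "p \<in> cdom (chart_at A p)"
proof -
  have "p \<in> (\<Union>c\<in>A. cdom c)" using smooth_atlas by (simp add: smooth_atlas_def)
  then have "\<exists>c. c \<in> A \<and> p \<in> cdom c" by blast
  from someI_ex[OF this] show "chart_at A p \<in> A" "p \<in> cdom (chart_at A p)"
    by (simp_all add: chart_at_def)
qed

lemma
  assumes "c \<in> A"
  shows open_cdom: "open (cdom c)" and open_cimg: "open (cimg c)"
    and cinv_cmap: "p \<in> cdom c \<Longrightarrow> cinv c (cmap c p) = p"
    and cmap_cinv: "x \<in> cimg c \<Longrightarrow> cmap c (cinv c x) = x"
    and cinv_cdom: "x \<in> cimg c \<Longrightarrow> cinv c x \<in> cdom c"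
    and continuous_cinv: "continuous_on (cimg c) (cinv c)"
proof -
  have 1: "open (cdom c)" "open (cimg c)" "homeomorphism (cdom c) (cimg c) (cmap c) (cinv c)"
    using smooth_atlas assms by (auto simp: smooth_atlas_def)
  then show "open (cdom c)" "open (cimg c)" by simp_all
  show "x \<in> cimg c \<Longrightarrow> cmap c (cinv c x) = x" by (rule f_inv_into_f)
  show "p \<in> cdom c \<Longrightarrow> cinv c (cmap c p) = p"
    "continuous_on (cimg c) (cinv c)"
    using 1(3) by (simp_all add: homeomorphism_def)
  show "x \<in> cimg c \<Longrightarrow> cinv c x \<in> cdom c" by (rule inv_into_into)
qed

lemma cset_eq:
  assumes "c \<in> A"
  shows "cset c d f = {x \<in> cimg c. f (cinv c x) \<in> cdom d}"
  using cinv_cmap[OF assms] cmap_cinv[OF assms] cinv_cdom[OF assms]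
  unfolding cset_def by force

lemma open_cset:
  fixes d :: "('n::topological_space, 'f) chart"
  assumes "c \<in> A" "open (cdom d)" "continuous_on UNIV f"
  shows "open (cset c d f)"
proof -
  have "open (f -` cdom d)" using assms by (simp add: open_vimage)
  then have "open (cimg c \<inter> cinv c -` (f -` cdom d))"
    by (rule continuous_open_preimage[OF continuous_cinv[OF assms(1)] open_cimg[OF assms(1)]])
  moreover have "cset c d f = cimg c \<inter> cinv c -` (f -` cdom d)" by (auto simp: cset_eq[OF assms(1)])
  ultimately show ?thesis by simp
qed

lemma smooth_crep:
  fixes B :: "('n::topological_space, 'f::real_normed_vector) chart set"
  assumes "smooth_map A B f" "c \<in> A" "d \<in> B"
  shows "smooth_on (cset c d f) (crep c d f)"
proof -
  have "crep c d f = cmap d \<circ> f \<circ> cinv c" by (simp add: crep_def fun_eq_iff)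
  then show ?thesis using assms unfolding smooth_map_def cset_def by metis
qed

lemma smooth_map_id: "smooth_map A A (\<lambda>x. x)"
  using smooth_atlas by (simp add: smooth_map_def smooth_atlas_def comp_def)

lemma crep_diff:
  assumes "smooth_map A A f" "c \<in> A" "d \<in> A" "x \<in> cimg c" "f (cinv c x) \<in> cdom d"
  shows "crep c d f differentiable (at x)"
  by (rule smooth_on_differentiable[OF smooth_crep[OF assms(1-3)]])
    (use assms in \<open>simp add: cset_eq\<close>)

lemma fd_crep_compose:
  assumes f: "smooth_map A A f" and g: "smooth_map A A g" and c: "c \<in> A" "d \<in> A" "k \<in> A"
    and x: "x \<in> cimg c" "f (cinv c x) \<in> cdom d" "g (f (cinv c x)) \<in> cdom k"
  shows "fd (crep c k (\<lambda>p. g (f p))) x v = fd (crep d k g) (crep c d f x) (fd (crep c d f) x v)"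
proof -
  have cinv: "cinv d (crep c d f x) = f (cinv c x)"
    using x c by (simp add: crep_def cinv_cmap)
  have "crep d k g differentiable (at (crep c d f x))"
    using x c cinv by (intro crep_diff[OF g]) (simp_all add: crep_def)
  then have "((\<lambda>y. crep d k g (crep c d f y)) has_derivative
      (\<lambda>v. fd (crep d k g) (crep c d f x) (fd (crep c d f) x v))) (at x)"
    using has_derivative_fd_compose[of "crep c d f" "fd (crep c d f) x" x "crep d k g"]
      has_derivative_fd[OF crep_diff[OF f c(1,2) x(1,2)]] by blast
  moreover have "open (cset c d f)"
    using f c by (intro open_cset open_cdom) (simp_all add: smooth_map_def)
  moreover have "x \<in> cset c d f" using x c by (simp add: cset_eq)
  ultimately have "(crep c k (\<lambda>p. g (f p)) has_derivative
      (\<lambda>v. fd (crep d k g) (crep c d f x) (fd (crep c d f) x v))) (at x)"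
    by (rule has_derivative_transform_within_open) (use c in \<open>simp add: cset_eq crep_def cinv_cmap\<close>)
  then show ?thesis by (simp add: fd_eqI)
qed

lemma fd_crep_id:
  assumes "c \<in> A" "x \<in> cimg c"
  shows "fd (crep c c (\<lambda>p. p)) x = (\<lambda>v. v)"
  by (rule fd_eqI, rule has_derivative_transform_within_open[OF has_derivative_ident open_cimg[OF assms(1)] assms(2)])
    (simp add: crep_def cmap_cinv[OF assms(1)])

lemma coord_change_eq: "coord_change c d p v = fd (crep c d (\<lambda>q. q)) (cmap c p) v"
  by (simp add: coord_change_def crep_def[abs_def] comp_def)

lemma tangent_map_eq:
  "tangent_map A A f p v = fd (crep (chart_at A p) (chart_at A (f p)) f) (cmap (chart_at A p) p) v"
  by (simp add: tangent_map_def crep_def[abs_def] comp_def)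

lemma coord_change_crep:
  assumes f: "smooth_map A A f" and c: "c \<in> A" "d \<in> A" "k \<in> A"
    and p: "p \<in> cdom c" "f p \<in> cdom d" "f p \<in> cdom k"
  shows "coord_change d k (f p) (fd (crep c d f) (cmap c p) v) = fd (crep c k f) (cmap c p) v"
  using fd_crep_compose[OF f smooth_map_id c, of "cmap c p" v] p c
  by (simp add: coord_change_eq cinv_cmap crep_def)

lemma linear_coord_change:
  assumes "c \<in> A" "d \<in> A" "p \<in> cdom c" "p \<in> cdom d"
  shows "linear (coord_change c d p)"
proof -
  have "linear (fd (crep c d (\<lambda>q. q)) (cmap c p))"
    by (rule linear_fd[OF crep_diff[OF smooth_map_id]]) (use assms in \<open>simp_all add: cinv_cmap\<close>)
  then show ?thesis by (simp add: coord_change_eq[abs_def])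
qed

end

section \<open>Left-invariant frames\<close>

context lie_group
begin

sublocale manifold A
  by unfold_locales (rule atlas)

abbreviation "c0 \<equiv> chart_at A e"
abbreviation "x0 \<equiv> cmap c0 e"

lemma x0_cimg: "x0 \<in> cimg c0"
  using chart_at(2) by simp

lemma continuous_mult: "continuous_on UNIV (\<lambda>(p, q). mul p q)"
  using smooth_mult by (simp add: smooth_map_def)

text \<open>Multiplication is kept as a map on pairs of coordinates: smoothness of the
  left-invariant frame in its base point needs joint smoothness, not only that of each
  translation.\<close>

definition mrep :: "('g, 'e) chart \<Rightarrow> ('g, 'e) chart \<Rightarrow> ('g, 'e) chart \<Rightarrow> 'e \<times> 'e \<Rightarrow> 'e" where
  "mrep c d k z = cmap k (mul (cinv c (fst z)) (cinv d (snd z)))"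

definition mset :: "('g, 'e) chart \<Rightarrow> ('g, 'e) chart \<Rightarrow> ('g, 'e) chart \<Rightarrow> ('e \<times> 'e) set" where
  "mset c d k = {z. fst z \<in> cimg c \<and> snd z \<in> cimg d \<and> mul (cinv c (fst z)) (cinv d (snd z)) \<in> cdom k}"

lemma open_mset:
  assumes c: "c \<in> A" "d \<in> A" "k \<in> A"
  shows "open (mset c d k)"
proof -
  have "continuous_on (cimg c \<times> cimg d) (\<lambda>z. (cinv c (fst z), cinv d (snd z)))"
    by (intro continuous_on_Pair continuous_on_compose2[OF continuous_cinv[OF c(1)]]
        continuous_on_compose2[OF continuous_cinv[OF c(2)]] continuous_on_fst continuous_on_snd
        continuous_on_id) auto
  from continuous_on_compose2[OF continuous_mult this]
  have "continuous_on (cimg c \<times> cimg d) (\<lambda>z. mul (cinv c (fst z)) (cinv d (snd z)))" by simp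
  from continuous_open_preimage[OF this open_Times[OF open_cimg open_cimg] open_cdom] c
  have "open ((cimg c \<times> cimg d) \<inter> (\<lambda>z. mul (cinv c (fst z)) (cinv d (snd z))) -` cdom k)" by simp
  moreover have "mset c d k = (cimg c \<times> cimg d) \<inter> (\<lambda>z. mul (cinv c (fst z)) (cinv d (snd z))) -` cdom k"
    by (auto simp: mset_def)
  ultimately show ?thesis by simp
qed

lemma smooth_mrep:
  assumes c: "c \<in> A" "d \<in> A" "k \<in> A"
  shows "smooth_on (mset c d k) (mrep c d k)"
proof -
  define pc where "pc = (cdom c \<times> cdom d, map_prod (cmap c) (cmap d))"
  have "pc \<in> prod_atlas A A" unfolding prod_atlas_def pc_def using c by blast
  then have s: "smooth_on (cmap pc ` (cdom pc \<inter> (\<lambda>(p, q). mul p q) -` cdom k))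
      (cmap k \<circ> (\<lambda>(p, q). mul p q) \<circ> cinv pc)"
    using smooth_mult c(3) unfolding smooth_map_def by blast
  have inj: "inj_on (cmap pc) (cdom pc)"
    by (rule inj_onI) (use cinv_cmap c in \<open>auto simp: pc_def; metis\<close>)
  have set: "cmap pc ` (cdom pc \<inter> (\<lambda>(p, q). mul p q) -` cdom k) = mset c d k"
  proof (intro equalityI subsetI)
    fix z assume "z \<in> cmap pc ` (cdom pc \<inter> (\<lambda>(p, q). mul p q) -` cdom k)"
    then show "z \<in> mset c d k" using c by (auto simp: pc_def mset_def cinv_cmap)
  next
    fix z assume z: "z \<in> mset c d k"
    then have "z = cmap pc (cinv c (fst z), cinv d (snd z))"
      using c by (simp add: pc_def mset_def cmap_cinv)
    moreover have "(cinv c (fst z), cinv d (snd z)) \<in> cdom pc \<inter> (\<lambda>(p, q). mul p q) -` cdom k"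
      using z c by (simp add: pc_def mset_def cinv_cdom)
    ultimately show "z \<in> cmap pc ` (cdom pc \<inter> (\<lambda>(p, q). mul p q) -` cdom k)" by (rule image_eqI)
  qed
  have eq: "(cmap k \<circ> (\<lambda>(p, q). mul p q) \<circ> cinv pc) z = mrep c d k z" if z: "z \<in> mset c d k" for z
  proof -
    have "cmap pc (cinv c (fst z), cinv d (snd z)) = z" "(cinv c (fst z), cinv d (snd z)) \<in> cdom pc"
      using z c by (simp_all add: pc_def mset_def cmap_cinv cinv_cdom)
    then have "cinv pc z = (cinv c (fst z), cinv d (snd z))" by (metis inj inv_into_f_f)
    then show ?thesis by (simp add: mrep_def)
  qed
  show ?thesis by (rule smooth_on_cong[OF open_mset[OF c] eq s[unfolded set]])
qed

lemma smooth_on_Pair_const: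
  assumes S: "open S"
  shows "smooth_on S (\<lambda>x. (a, x))" "smooth_on S (\<lambda>x. (x, a))"
proof -
  have "Ck_on k S (\<lambda>x. (a, 0) + (0, x))" "Ck_on k S (\<lambda>x. (0, a) + (x, 0))" for k
    by (intro Ck_on_add S Ck_on_const Ck_on_linear bounded_linear_Pair bounded_linear_zero bounded_linear_ident)+
  then show "smooth_on S (\<lambda>x. (a, x))" "smooth_on S (\<lambda>x. (x, a))" by (simp_all add: smooth_on_def)
qed

lemma smooth_map_mul_left: "smooth_map A A (mul a)" and smooth_map_mul_right: "smooth_map A A (\<lambda>q. mul q a)"
proof -
  have cl: "continuous_on UNIV (mul a)" and cr: "continuous_on UNIV (\<lambda>q. mul q a)"
    using continuous_on_compose2[OF continuous_mult, of UNIV "\<lambda>q. (a, q)"]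
      continuous_on_compose2[OF continuous_mult, of UNIV "\<lambda>q. (q, a)"]
    by (simp_all add: continuous_on_Pair continuous_on_const continuous_on_id)
  define k where "k = chart_at A a"
  have k: "k \<in> A" "a \<in> cdom k" unfolding k_def by (rule chart_at)+
  have "smooth_on (cset c d (mul a)) (cmap d \<circ> mul a \<circ> cinv c)"
    and "smooth_on (cset c d (\<lambda>q. mul q a)) (cmap d \<circ> (\<lambda>q. mul q a) \<circ> cinv c)"
    if c: "c \<in> A" "d \<in> A" for c d
  proof -
    have o: "open (cset c d (mul a))" "open (cset c d (\<lambda>q. mul q a))"
      by (intro open_cset open_cdom c cl cr)+
    have "smooth_on (cset c d (mul a)) (\<lambda>x. mrep k c d (cmap k a, x))"
      by (rule smooth_on_compose[OF o(1) open_mset[OF k(1) c] _ smooth_on_Pair_const(1)[OF o(1)] smooth_mrep[OF k(1) c]])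
        (use k c in \<open>auto simp: mset_def cset_eq cinv_cmap\<close>)
    moreover have "(\<lambda>x. mrep k c d (cmap k a, x)) = cmap d \<circ> mul a \<circ> cinv c"
      using k by (simp add: mrep_def fun_eq_iff cinv_cmap)
    ultimately show "smooth_on (cset c d (mul a)) (cmap d \<circ> mul a \<circ> cinv c)" by simp
    have "smooth_on (cset c d (\<lambda>q. mul q a)) (\<lambda>x. mrep c k d (x, cmap k a))"
      by (rule smooth_on_compose[OF o(2) open_mset[OF c(1) k(1) c(2)] _ smooth_on_Pair_const(2)[OF o(2)] smooth_mrep[OF c(1) k(1) c(2)]])
        (use k c in \<open>auto simp: mset_def cset_eq cinv_cmap\<close>)
    moreover have "(\<lambda>x. mrep c k d (x, cmap k a)) = cmap d \<circ> (\<lambda>q. mul q a) \<circ> cinv c"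
      using k by (simp add: mrep_def fun_eq_iff cinv_cmap)
    ultimately show "smooth_on (cset c d (\<lambda>q. mul q a)) (cmap d \<circ> (\<lambda>q. mul q a) \<circ> cinv c)" by simp
  qed
  then show "smooth_map A A (mul a)" "smooth_map A A (\<lambda>q. mul q a)"
    using cl cr by (simp_all add: smooth_map_def cset_def)
qed

text \<open>The left-invariant field of \<open>u\<close> in one fixed chart, where it depends
  smoothly on the point; the values of \<open>left_invariant_field\<close> refer to a chart that
  varies with the point.\<close>

definition frame :: "('g, 'e) chart \<Rightarrow> 'e \<Rightarrow> 'e \<Rightarrow> 'e" where
  "frame c x u = fd (crep c0 c (mul (cinv c x))) x0 u"

lemma to_chart_left_invariant_field:
  assumes c: "c \<in> A" "p \<in> cdom c"
  shows "to_chart A c p (left_invariant_field mul e A u p) = frame c (cmap c p) u"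
  using coord_change_crep[of "mul p" c0 "chart_at A p" c e u, OF smooth_map_mul_left chart_at(1) chart_at(1) c(1)]
    c chart_at(2)
  by (simp add: to_chart_def left_invariant_field_def tangent_map_eq frame_def cinv_cmap)

lemma left_invariant_field_eq:
  "left_invariant_field mul e A u p = frame (chart_at A p) (cmap (chart_at A p) p) u"
  by (simp add: left_invariant_field_def tangent_map_eq frame_def cinv_cmap[OF chart_at])

lemma from_chart_frame:
  assumes c: "c \<in> A" "p \<in> cdom c"
  shows "from_chart A c p (frame c (cmap c p) u) = left_invariant_field mul e A u p"
  using coord_change_crep[of "mul p" c0 c "chart_at A p" e u, OF smooth_map_mul_left chart_at(1) c(1) chart_at(1)]
    c chart_at(2)
  by (simp add: from_chart_def left_invariant_field_def tangent_map_eq frame_def cinv_cmap)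

text \<open>Associativity: translation by \<open>cinv c x\<close> followed by translation by
  \<open>a\<close> is translation by the product, and the chain rule does the rest.\<close>

lemma frame_mul:
  assumes c: "c \<in> A" "d \<in> A" and x: "x \<in> cimg c" "mul a (cinv c x) \<in> cdom d"
  shows "frame d (crep c d (mul a) x) v = fd (crep c d (mul a)) x (frame c x v)"
proof -
  have 1: "cinv d (crep c d (mul a) x) = mul a (cinv c x)"
    using c x by (simp add: crep_def cinv_cmap)
  have 2: "crep c0 c (mul (cinv c x)) x0 = x"
    using c x chart_at by (simp add: crep_def cinv_cmap cmap_cinv)
  have "mul (mul a (cinv c x)) = (\<lambda>q. mul a (mul (cinv c x) q))" by (simp add: fun_eq_iff assoc)
  then show ?thesis
    unfolding frame_def[of d] 1 frame_def[of c]
    using fd_crep_compose[of "mul (cinv c x)" "mul a" c0 c d x0 v,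
        OF smooth_map_mul_left smooth_map_mul_left chart_at(1) c x0_cimg]
      x c chart_at by (simp add: 2 cinv_cmap cinv_cdom)
qed

lemma frame_x0: "frame c0 x0 v = v"
proof -
  have "mul e = (\<lambda>p. p)" by (simp add: fun_eq_iff)
  then show ?thesis
    using fd_crep_id[OF chart_at(1) x0_cimg] by (simp add: frame_def cinv_cmap chart_at)
qed

lemma linear_frame:
  assumes "c \<in> A" "x \<in> cimg c"
  shows "linear (frame c x)"
proof -
  have "crep c0 c (mul (cinv c x)) differentiable (at x0)"
    using assms chart_at by (intro crep_diff smooth_map_mul_left) (simp_all add: cinv_cmap cinv_cdom)
  then show ?thesis by (simp add: frame_def[abs_def] linear_fd)
qed

text \<open>Translation by the inverse element carries the frame at \<open>x\<close> back to the
  frame at the group identity, which is the identity map by \<open>frame_x0\<close>.\<close>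

lemma inj_frame:
  assumes c: "c \<in> A" and x: "x \<in> cimg c"
  shows "inj (frame c x)"
proof (rule inj_on_inverseI)
  fix v
  let ?a = "iv (cinv c x)"
  have a: "mul ?a (cinv c x) = e" by simp
  have "crep c c0 (mul ?a) x = x0" by (simp add: crep_def)
  then show "fd (crep c c0 (mul ?a)) x (frame c x v) = v"
    using frame_mul[OF c chart_at(1) x, of ?a e v] chart_at(2)[of e] frame_x0 by simp
qed

text \<open>A partial derivative in the second factor: the dependence on \<open>x\<close> sits only
  in the point at which a jointly smooth map is differentiated, whence
  \<open>smooth_frame\<close>.\<close>

lemma frame_eq_fd_mrep:
  assumes c: "c \<in> A" and x: "x \<in> cimg c"
  shows "frame c x v = fd (mrep c c0 c) (x, x0) (0, v)"
proof -
  have m: "(x, x0) \<in> mset c c0 c" using c x chart_at by (simp add: mset_def cinv_cmap cinv_cdom)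
  have "mrep c c0 c differentiable (at (x, x0))"
    by (rule smooth_on_differentiable[OF smooth_mrep[OF c chart_at(1) c] m])
  then have "((\<lambda>y. mrep c c0 c (x, y)) has_derivative (\<lambda>v. fd (mrep c c0 c) (x, x0) (0, v))) (at x0)"
    by (intro has_derivative_fd_compose has_derivative_Pair has_derivative_const has_derivative_ident)
  moreover have "(\<lambda>y. mrep c c0 c (x, y)) = crep c0 c (mul (cinv c x))"
    by (simp add: fun_eq_iff mrep_def crep_def)
  ultimately show ?thesis by (simp add: frame_def fd_eqI)
qed

lemma smooth_frame:
  assumes c: "c \<in> A"
  shows "smooth_on (cimg c) (\<lambda>x. frame c x v)"
proof (rule smooth_on_cong[OF open_cimg[OF c]])
  show "fd (mrep c c0 c) (x, x0) (0, v) = frame c x v" if "x \<in> cimg c" for x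
    using frame_eq_fd_mrep[OF c that] by simp
  show "smooth_on (cimg c) (\<lambda>x. fd (mrep c c0 c) (x, x0) (0, v))"
    by (rule smooth_on_compose[OF open_cimg[OF c] open_mset[OF c chart_at(1) c] _
          smooth_on_Pair_const(2)[OF open_cimg[OF c]]
          smooth_on_fd[OF smooth_mrep[OF c chart_at(1) c]]])
      (use c chart_at in \<open>auto simp: mset_def cinv_cmap\<close>)
qed

abbreviation "br \<equiv> lie_bracket mul e A"

lemma lie_bracket_eq: "br u v = fd (\<lambda>y. frame c0 y v) x0 u - fd (\<lambda>y. frame c0 y u) x0 v"
proof -
  have f: "fd (\<lambda>y. frame c0 y w) x0 = fd (field_in_chart A (left_invariant_field mul e A w) c0) x0" for w
  proof (rule frechet_derivative_transform_within_open[OF _ open_cimg[OF chart_at(1)] x0_cimg])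
    show "(\<lambda>y. frame c0 y w) differentiable (at x0)"
      by (rule smooth_on_differentiable[OF smooth_frame[OF chart_at(1)] x0_cimg])
    show "frame c0 y w = field_in_chart A (left_invariant_field mul e A w) c0 y" if "y \<in> cimg c0" for y
      using to_chart_left_invariant_field[OF chart_at(1) cinv_cdom[OF chart_at(1) that], of w]
        cmap_cinv[OF chart_at(1) that]
      by (simp add: field_in_chart_def)
  qed
  show ?thesis
    by (simp add: lie_bracket_def vf_bracket_def Let_def f left_invariant_field_eq frame_x0)
qed

text \<open>Left translation \<open>\<phi>\<close> carries the frame to itself. Differentiating this
  relation (\<open>nat\<close>) adds a second derivative of \<open>\<phi>\<close>, which is
  symmetric in \<open>u\<close> and \<open>v\<close> and drops out of the bracket, so the bracket is
  transported from the identity.\<close>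

lemma frame_bracket:
  assumes c: "c \<in> A" and x: "x \<in> cimg c"
  shows "fd (\<lambda>y. frame c y v) x (frame c x u) - fd (\<lambda>y. frame c y u) x (frame c x v) = frame c x (br u v)"
proof -
  define \<phi> where "\<phi> = crep c0 c (mul (cinv c x))"
  define S where "S = cset c0 c (mul (cinv c x))"
  have "continuous_on UNIV (mul a)" for a using smooth_map_mul_left[of a] by (simp add: smooth_map_def)
  then have S: "open S" unfolding S_def by (intro open_cset open_cdom chart_at c)
  have S: "open S" "x0 \<in> S"
    using S c x chart_at by (simp_all add: S_def cset_eq cinv_cmap cinv_cdom)
  have \<phi>: "smooth_on S \<phi>" unfolding S_def \<phi>_def by (intro smooth_crep[where B = A] smooth_map_mul_left chart_at c)
  have \<phi>x: "\<phi> x0 = x" using c x chart_at by (simp add: \<phi>_def crep_def cinv_cmap cmap_cinv)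
  have \<phi>': "fd \<phi> x0 v = frame c x v" for v by (simp add: \<phi>_def frame_def)
  have d2: "(\<lambda>y. fd \<phi> y a) differentiable (at x0)" for a
    by (rule smooth_on_differentiable[OF smooth_on_fd[OF \<phi>] S(2)])
  have fr: "(\<lambda>y. frame c0 y v) differentiable (at x0)" for v
    by (rule smooth_on_differentiable[OF smooth_frame[OF chart_at(1)] x0_cimg])
  have nat: "frame c (\<phi> y) v = fd \<phi> y (frame c0 y v)" if "y \<in> S" for y v
    using that chart_at c unfolding S_def \<phi>_def by (intro frame_mul) (simp_all add: cset_eq)
  have "fd (\<lambda>y. frame c y v) x (frame c x u)
      = fd (\<lambda>y. fd \<phi> y v) x0 u + frame c x (fd (\<lambda>y. frame c0 y v) x0 u)" for u v
  proof -
    have "((\<lambda>y. frame c (\<phi> y) v) has_derivative (\<lambda>u. fd (\<lambda>y. frame c y v) (\<phi> x0) (fd \<phi> x0 u))) (at x0)"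
      by (rule has_derivative_fd_compose[OF has_derivative_fd])
        (use smooth_on_differentiable[OF \<phi> S(2)] smooth_on_differentiable[OF smooth_frame[OF c] x]
          in \<open>simp_all add: \<phi>x\<close>)
    then have "((\<lambda>y. fd \<phi> y (frame c0 y v)) has_derivative
        (\<lambda>u. fd (\<lambda>y. frame c y v) (\<phi> x0) (fd \<phi> x0 u))) (at x0)"
      by (rule has_derivative_transform_within_open[OF _ S nat])
    moreover have lin: "linear (fd \<phi> y)" if "y \<in> S" for y
      by (rule linear_fd[OF smooth_on_differentiable[OF \<phi> that]])
    have "fd (\<lambda>y. fd \<phi> y (frame c0 y v)) x0 u
        = fd \<phi> x0 (fd (\<lambda>y. frame c0 y v) x0 u) + fd (\<lambda>y. fd \<phi> y (frame c0 x0 v)) x0 u"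
      by (rule has_derivative_apply(1)[where E = "fd \<phi>", OF S lin has_derivative_fd[OF d2]
            linear_fd_family[OF S lin d2] has_derivative_fd[OF fr]])
    ultimately show ?thesis by (simp add: fd_eqI \<phi>x \<phi>' frame_x0)
  qed
  moreover have "fd (\<lambda>y. fd \<phi> y v) x0 u = fd (\<lambda>y. fd \<phi> y u) x0 v"
    by (rule symmetric_second_derivative[OF S smooth_onD[OF \<phi>]])
  ultimately show ?thesis
    by (simp add: lie_bracket_eq linear_diff[OF linear_frame[OF c x]])
qed

lemma local_frame: "c \<in> A \<Longrightarrow> cdom c \<noteq> {} \<Longrightarrow> local_frame (cimg c) (frame c) br"
  by (rule local_frame.intro) (auto intro: open_cimg linear_frame inj_frame smooth_frame frame_bracket)

section \<open>The left-invariant metric in the frame\<close>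

lemma metric_in_chart_frame:
  assumes h: "left_invariant mul A h" and c: "c \<in> A" and x: "x \<in> cimg c"
  shows "metric_in_chart A h c x (frame c x u) (frame c x v) = h e u v"
proof -
  have p: "cinv c x \<in> cdom c" "cmap c (cinv c x) = x" using c x by (simp_all add: cinv_cdom cmap_cinv)
  have "metric_in_chart A h c x (frame c x u) (frame c x v)
      = h (cinv c x) (left_invariant_field mul e A u (cinv c x)) (left_invariant_field mul e A v (cinv c x))"
    using from_chart_frame[OF c p(1)] by (simp add: metric_in_chart_def p(2))
  also have "\<dots> = h e u v"
    using h[unfolded left_invariant_def, rule_format, of "cinv c x" e u v]
    by (simp add: left_invariant_field_def)
  finally show ?thesis .
qed

lemma inner_product_metric_in_chart:
  assumes h: "riemannian_metric A h" "left_invariant mul A h" and c: "c \<in> A" and x: "x \<in> cimg c"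
  shows "inner_product (metric_in_chart A h c x)"
  unfolding inner_product_def
proof (intro conjI allI impI)
  have ip: "inner_product (h p)" for p using h(1) by (simp add: riemannian_metric_def)
  have "linear (from_chart A c (cinv c x))"
    unfolding from_chart_def[abs_def] by (intro linear_coord_change c chart_at cinv_cdom x)
  then show "linear (metric_in_chart A h c x u)" for u
    using linear_compose[of "from_chart A c (cinv c x)" "h (cinv c x) (from_chart A c (cinv c x) u)"] ip
    by (simp add: metric_in_chart_def[abs_def] inner_product_def comp_def)
  show "metric_in_chart A h c x u v = metric_in_chart A h c x v u" for u v
    using ip by (simp add: metric_in_chart_def inner_product_def)
  fix v :: 'e assume v: "v \<noteq> 0"
  define w where "w = inv (frame c x) v"
  have w: "frame c x w = v"
    unfolding w_def by (rule linear_inj_inv(2)[OF linear_frame[OF c x] inj_frame[OF c x]])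
  then have "w \<noteq> 0" using v linear_0[OF linear_frame[OF c x]] by auto
  then show "metric_in_chart A h c x v v > 0"
    using metric_in_chart_frame[OF h(2) c x, of w w] w ip[of e] by (simp add: inner_product_def)
qed

end

context lie_group
begin

text \<open>Left and right translation both pull the metric back to \<open>\<beta> e\<close>; differentiating the two
  identities at the identity and subtracting gives the invariance of \<open>\<beta> e\<close> under \<open>ad\<close>, because
  the derivatives of the left- and right-invariant fields are the two mixed second derivatives
  of the multiplication.\<close>

lemma ad_invariant:
  assumes \<beta>: "riemannian_metric A \<beta>" "left_invariant mul A \<beta>" "right_invariant mul A \<beta>"
  shows "\<beta> e (br w u) v = - \<beta> e u (br w v)"
proof -
  note c0 = chart_at(1)[of e]
  define G where "G = metric_in_chart A \<beta> c0"
  define M where "M = mrep c0 c0 c0"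
  define l where "l x u = frame c0 x u" for x u
  define r where "r x u = fd (crep c0 c0 (\<lambda>q. mul q (cinv c0 x))) x0 u" for x u
  have M: "smooth_on (mset c0 c0 c0) M" unfolding M_def by (intro smooth_mrep c0)
  have z0: "(x0, x0) \<in> mset c0 c0 c0" using chart_at by (simp add: mset_def cinv_cmap)
  have bil: "bilinear (G x)" if "x \<in> cimg c0" for x
    unfolding G_def by (rule inner_product_bilinear[OF inner_product_metric_in_chart[OF \<beta>(1,2) c0 that]])
  have Gd: "(\<lambda>x. G x a b) differentiable (at x0)" for a b
    by (rule smooth_on_differentiable[OF _ x0_cimg])
      (use \<beta>(1) c0 in \<open>simp add: riemannian_metric_def G_def\<close>)
  have G0: "G x0 a b = \<beta> e a b" for a b
    using metric_in_chart_frame[OF \<beta>(2) c0 x0_cimg, of a b] by (simp add: G_def frame_x0)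
  have r_eq: "r x u = fd M (x0, x) (u, 0)" if x: "x \<in> cimg c0" for x u
  proof -
    have m: "(x0, x) \<in> mset c0 c0 c0" using c0 x chart_at by (simp add: mset_def cinv_cmap cinv_cdom)
    have "M differentiable (at (x0, x))" by (rule smooth_on_differentiable[OF M m])
    then have "((\<lambda>y. M (y, x)) has_derivative (\<lambda>v. fd M (x0, x) (v, 0))) (at x0)"
      by (intro has_derivative_fd_compose has_derivative_Pair has_derivative_const has_derivative_ident)
    moreover have "(\<lambda>y. M (y, x)) = crep c0 c0 (\<lambda>q. mul q (cinv c0 x))"
      by (simp add: fun_eq_iff M_def mrep_def crep_def)
    ultimately show ?thesis by (simp add: r_def fd_eqI)
  qed
  have M2: "(\<lambda>z. fd M z a) differentiable (at (x0, x0))" for a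
    by (rule smooth_on_differentiable[OF smooth_on_fd[OF M] z0])
  have l': "((\<lambda>x. l x u) has_derivative (\<lambda>w. fd (\<lambda>z. fd M z (0, u)) (x0, x0) (w, 0))) (at x0)" for u
  proof (rule has_derivative_transform_within_open[OF _ open_cimg[OF c0] x0_cimg])
    show "((\<lambda>x. fd M (x, x0) (0, u)) has_derivative (\<lambda>w. fd (\<lambda>z. fd M z (0, u)) (x0, x0) (w, 0))) (at x0)"
      by (rule has_derivative_fd_compose[where g = "\<lambda>z. fd M z (0, u)",
            OF has_derivative_Pair[OF has_derivative_ident has_derivative_const] M2])
  qed (simp add: l_def frame_eq_fd_mrep[OF c0] M_def)
  have r': "((\<lambda>x. r x u) has_derivative (\<lambda>w. fd (\<lambda>z. fd M z (u, 0)) (x0, x0) (0, w))) (at x0)" for u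
  proof (rule has_derivative_transform_within_open[OF _ open_cimg[OF c0] x0_cimg])
    show "((\<lambda>x. fd M (x0, x) (u, 0)) has_derivative (\<lambda>w. fd (\<lambda>z. fd M z (u, 0)) (x0, x0) (0, w))) (at x0)"
      by (rule has_derivative_fd_compose[where g = "\<lambda>z. fd M z (u, 0)",
            OF has_derivative_Pair[OF has_derivative_const has_derivative_ident] M2])
  qed (simp add: r_eq)
  have sym: "fd (\<lambda>z. fd M z (u, 0)) (x0, x0) (0, w) = fd (\<lambda>z. fd M z (0, w)) (x0, x0) (u, 0)" for u w
    by (rule symmetric_second_derivative[OF open_mset[OF c0 c0 c0] z0 smooth_onD[OF M]])
  define D where "D u w = fd (\<lambda>z. fd M z (0, u)) (x0, x0) (w, 0)" for u w
  have br_D: "br w u = D u w - D w u" for u w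
    using fd_eqI[OF l'] by (simp add: lie_bracket_eq l_def D_def)
  have l0: "l x0 u = u" for u by (simp add: l_def frame_x0)
  have r0: "r x0 u = u" for u
    using fd_crep_id[OF c0 x0_cimg] chart_at by (simp add: r_def cinv_cmap)
  have Gl: "G x (l x u) (l x v) = \<beta> e u v" if "x \<in> cimg c0" for x u v
    unfolding G_def l_def by (rule metric_in_chart_frame[OF \<beta>(2) c0 that])
  have Gr: "G x (r x u) (r x v) = \<beta> e u v" if x: "x \<in> cimg c0" for x u v
  proof -
    define p where "p = cinv c0 x"
    have p: "p \<in> cdom c0" "cmap c0 p = x" using c0 x by (simp_all add: p_def cinv_cdom cmap_cinv)
    have "from_chart A c0 p (r x u) = tangent_map A A (\<lambda>q. mul q p) e u" for u
      using coord_change_crep[of "\<lambda>q. mul q p" c0 c0 "chart_at A p" e u, OF smooth_map_mul_right c0 c0 chart_at(1)]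
        p chart_at(2)
      by (simp add: from_chart_def r_def tangent_map_eq p_def[symmetric])
    then show ?thesis
      using \<beta>(3)[unfolded right_invariant_def, rule_format, of e p u v]
      by (simp add: G_def metric_in_chart_def p_def[symmetric])
  qed
  have zero: "fd (\<lambda>x. G x (f x u) (f x v)) x0 w = 0"
    if "\<And>x. x \<in> cimg c0 \<Longrightarrow> G x (f x u) (f x v) = \<beta> e u v" for f
  proof -
    have "((\<lambda>x. G x (f x u) (f x v)) has_derivative (\<lambda>_. 0)) (at x0)"
      by (rule has_derivative_transform_within_open[OF has_derivative_const open_cimg[OF c0] x0_cimg])
        (simp add: that)
    then show ?thesis by (simp add: fd_eqI)
  qed
  have "0 = fd (\<lambda>x. G x u v) x0 w + \<beta> e (D u w) v + \<beta> e u (D v w)"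
    using has_derivative_apply2(1)[OF open_cimg[OF c0] x0_cimg bil Gd l' l', of u v w] zero[OF Gl]
    by (simp add: l0 G0 D_def)
  moreover have "0 = fd (\<lambda>x. G x u v) x0 w + \<beta> e (D w u) v + \<beta> e u (D w v)"
    using has_derivative_apply2(1)[OF open_cimg[OF c0] x0_cimg bil Gd r' r', of u v w] zero[OF Gr]
    by (simp add: r0 G0 D_def sym)
  moreover have bil: "bilinear (\<beta> e)"
    using \<beta>(1) by (intro inner_product_bilinear) (simp add: riemannian_metric_def)
  ultimately show ?thesis
    unfolding br_D bilinear_lsub[OF bil] bilinear_rsub[OF bil] by linarith
qed

end

section \<open>Geodesics and Jacobi fields in left-invariant components\<close>

lemma has_vector_derivative_smooth:
  fixes f :: "real \<Rightarrow> 'b::real_normed_vector"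
  assumes "smooth_on S f" "t \<in> S"
  shows "(f has_vector_derivative fd f t 1) (at t)"
proof -
  have d: "(f has_derivative fd f t) (at t)"
    by (intro has_derivative_fd smooth_on_differentiable[OF assms])
  have "fd f t h = h *\<^sub>R fd f t 1" for h
    using linear_cmul[OF has_derivative_linear[OF d], of h 1] by simp
  then have "fd f t = (\<lambda>h. h *\<^sub>R fd f t 1)" by (rule ext)
  then show ?thesis using d by (simp add: has_vector_derivative_def)
qed

lemma Ck_on_SucI:
  fixes f :: "real \<Rightarrow> 'b::real_normed_vector"
  assumes "\<And>t. (f has_vector_derivative f' t) (at t)" "Ck_on k UNIV f'"
  shows "Ck_on (Suc k) UNIV f"
proof -
  have d: "(f has_derivative (\<lambda>h. h *\<^sub>R f' t)) (at t)" for t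
    using assms(1) by (simp add: has_vector_derivative_def)
  have "Ck_on k UNIV (\<lambda>t. v *\<^sub>R f' t)" for v
    by (rule Ck_on_linear_comp[OF bounded_linear_scaleR_right open_UNIV assms(2)])
  then show ?thesis using d by (auto simp: fd_eqI[OF d] differentiable_def)
qed

locale left_invariant_geodesic = lie_group mul e iv A
  for mul :: "'g \<Rightarrow> 'g \<Rightarrow> 'g::{t2_space, second_countable_topology}" and e iv
    and A :: "('g, 'e::euclidean_space) chart set" +
  fixes \<beta> h :: "('g, 'e) metric_field" and \<Lambda> :: "'e \<Rightarrow> 'e" and \<gamma> :: "real \<Rightarrow> 'g"
  assumes \<beta>: "riemannian_metric A \<beta>" "left_invariant mul A \<beta>" "right_invariant mul A \<beta>"
    and spd: "symmetric_positive_definite (\<beta> e) \<Lambda>"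
    and h: "riemannian_metric A h" "left_invariant mul A h" "h e u v = \<beta> e u (\<Lambda> v)"
    and geo: "geodesic A h \<gamma>"
begin

abbreviation "\<kappa> \<equiv> \<beta> e"

definition lcomp :: "'g \<Rightarrow> 'e \<Rightarrow> 'e" where
  "lcomp p a = inv (frame (chart_at A p) (cmap (chart_at A p) p)) a"

abbreviation "E u p \<equiv> left_invariant_field mul e A u p"

lemma E_lcomp: "E (lcomp p a) p = a" and lcomp_E: "lcomp p (E u p) = u"
  and E_eq_0_iff: "E u p = 0 \<longleftrightarrow> u = 0" and E_add: "E (u + v) p = E u p + E v p"
proof -
  have x: "cmap (chart_at A p) p \<in> cimg (chart_at A p)" using chart_at(2) by simp
  note l = linear_frame[OF chart_at(1) x] and i = inj_frame[OF chart_at(1) x]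
  show "E (lcomp p a) p = a" "lcomp p (E u p) = u"
    by (simp_all add: lcomp_def left_invariant_field_eq linear_inj_inv[OF l i])
  show "E u p = 0 \<longleftrightarrow> u = 0" "E (u + v) p = E u p + E v p"
    using linear_injective_0[OF l] i linear_0[OF l] by (auto simp: left_invariant_field_eq linear_add[OF l])
qed

lemma smooth_\<gamma>: "c \<in> A \<Longrightarrow> smooth_on (\<gamma> -` cdom c) (\<lambda>t. cmap c (\<gamma> t))"
  and open_\<gamma>: "c \<in> A \<Longrightarrow> open (\<gamma> -` cdom c)"
proof -
  assume c: "c \<in> A"
  have s: "smooth_map vs_atlas A \<gamma>" using geo by (simp add: geodesic_def)
  then show "open (\<gamma> -` cdom c)" using open_cdom[OF c] by (simp add: smooth_map_def open_vimage)
  have "cinv (UNIV, \<lambda>x::real. x) = (\<lambda>x. x)" by (simp add: fun_eq_iff inv_into_f_f[of "\<lambda>x. x" UNIV, simplified])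
  moreover have "smooth_on ((\<lambda>x. x) ` (UNIV \<inter> \<gamma> -` cdom c)) (cmap c \<circ> \<gamma> \<circ> cinv (UNIV, \<lambda>x::real. x))"
    using s c unfolding smooth_map_def vs_atlas_def by force
  ultimately show "smooth_on (\<gamma> -` cdom c) (\<lambda>t. cmap c (\<gamma> t))" by (simp add: comp_def)
qed

definition u :: "real \<Rightarrow> 'e" where "u t = lcomp (\<gamma> t) (velocity A \<gamma> t)"

lemma E_u: "E (u t) (\<gamma> t) = velocity A \<gamma> t"
  by (simp add: u_def E_lcomp)

abbreviation "fr c t \<equiv> frame c (cmap c (\<gamma> t))"

text \<open>\<open>velocity\<close> refers to the chart chosen at \<open>\<gamma> t\<close>; the
  chain rule for the transition map moves it to a fixed chart, which can serve for a whole interval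
  of times.\<close>

lemma curve_derivative:
  assumes c: "c \<in> A" "\<gamma> t \<in> cdom c"
  shows "((\<lambda>t. cmap c (\<gamma> t)) has_vector_derivative fr c t (u t)) (at t)"
proof -
  define d where "d = chart_at A (\<gamma> t)"
  have d: "d \<in> A" "\<gamma> t \<in> cdom d" unfolding d_def by (rule chart_at)+
  have v: "((\<lambda>t. cmap d (\<gamma> t)) has_vector_derivative velocity A \<gamma> t) (at t)"
    using smooth_on_differentiable[OF smooth_\<gamma>[OF d(1)], of t] d
    by (simp add: velocity_def d_def[symmetric] comp_def vector_derivative_works[symmetric])
  have "crep d c (\<lambda>p. p) differentiable (at (cmap d (\<gamma> t)))"
    using c d by (intro crep_diff smooth_map_id) (simp_all add: cinv_cmap)
  with v have "((\<lambda>s. crep d c (\<lambda>p. p) (cmap d (\<gamma> s))) has_derivative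
      (\<lambda>r. fd (crep d c (\<lambda>p. p)) (cmap d (\<gamma> t)) (r *\<^sub>R velocity A \<gamma> t))) (at t)"
    unfolding has_vector_derivative_def by (rule has_derivative_fd_compose)
  then have "((\<lambda>s. cmap c (\<gamma> s)) has_derivative
      (\<lambda>r. fd (crep d c (\<lambda>p. p)) (cmap d (\<gamma> t)) (r *\<^sub>R velocity A \<gamma> t))) (at t)"
    by (rule has_derivative_transform_within_open[OF _ open_\<gamma>[OF d(1)]])
      (use d in \<open>simp_all add: crep_def cinv_cmap\<close>)
  moreover have "fd (crep d c (\<lambda>p. p)) (cmap d (\<gamma> t)) (r *\<^sub>R velocity A \<gamma> t)
      = r *\<^sub>R fr c t (u t)" for r
  proof -
    have "coord_change d c (\<gamma> t) (velocity A \<gamma> t) = fr c t (u t)"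
      using to_chart_left_invariant_field[OF c, of "u t"] by (simp add: to_chart_def E_u d_def)
    then show ?thesis
      using linear_cmul[OF linear_coord_change[OF d(1) c(1) d(2) c(2)]] by (simp add: coord_change_eq)
  qed
  ultimately show ?thesis by (simp add: has_vector_derivative_def)
qed

lemma smooth_frame_\<gamma>:
  assumes c: "c \<in> A"
  shows "smooth_on (\<gamma> -` cdom c) (\<lambda>t. fr c t b)"
  by (rule smooth_on_compose[OF open_\<gamma>[OF c] open_cimg[OF c] _ smooth_\<gamma>[OF c] smooth_frame[OF c]]) auto

text \<open>In every chart the frame and its inverse are smooth along the curve, so the chartwise
  notion becomes ordinary smoothness of one function into the Lie algebra.\<close>

lemma smooth_field_along_iff:
  "smooth_field_along A \<gamma> (\<lambda>t. E (v t) (\<gamma> t)) \<longleftrightarrow> smooth_on UNIV v"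
proof -
  have eq: "to_chart A c (\<gamma> t) (E (v t) (\<gamma> t)) = fr c t (v t)"
    if "c \<in> A" "t \<in> \<gamma> -` cdom c" for c t
    using that by (intro to_chart_left_invariant_field) auto
  have lin: "linear (fr c t)" and inj: "inj (fr c t)"
    if "c \<in> A" "t \<in> \<gamma> -` cdom c" for c t
    using that by (auto intro!: linear_frame inj_frame)
  show ?thesis
  proof
    assume s: "smooth_field_along A \<gamma> (\<lambda>t. E (v t) (\<gamma> t))"
    show "smooth_on UNIV v" unfolding smooth_on_def
    proof (intro allI Ck_on_local)
      fix k and t :: real
      define c where "c = chart_at A (\<gamma> t)"
      have c: "c \<in> A" "t \<in> \<gamma> -` cdom c" unfolding c_def using chart_at by auto
      have "smooth_on (\<gamma> -` cdom c) (\<lambda>t. to_chart A c (\<gamma> t) (E (v t) (\<gamma> t)))"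
        using s c by (simp add: smooth_field_along_def)
      then have 1: "Ck_on k (\<gamma> -` cdom c) (\<lambda>t. fr c t (v t))"
        using Ck_on_cong[OF open_\<gamma>[OF c(1)] eq[OF c(1)]] by (simp add: smooth_on_def)
      have 2: "Ck_on k (\<gamma> -` cdom c) (\<lambda>t. inv (fr c t) b)" for b
        by (rule Ck_on_inverse_family[where E = "fr c",
              OF open_\<gamma>[OF c(1)] lin[OF c(1)] inj[OF c(1)] smooth_onD[OF smooth_frame_\<gamma>[OF c(1)]]])
      have "linear (inv (fr c t))" if "t \<in> \<gamma> -` cdom c" for t
        by (rule linear_inj_inv(1)[OF lin[OF c(1) that] inj[OF c(1) that]])
      note 3 = Ck_on_apply[where E = "\<lambda>t. inv (fr c t)", OF open_\<gamma>[OF c(1)] this 2 1]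
      have "Ck_on k (\<gamma> -` cdom c) v"
        by (rule Ck_on_cong[OF open_\<gamma>[OF c(1)] _ 3])
          (rule linear_inj_inv(3)[OF lin[OF c(1)] inj[OF c(1)]])
      then show "\<exists>T. open T \<and> t \<in> T \<and> Ck_on k T v" using c open_\<gamma> by blast
    qed
  next
    assume v: "smooth_on UNIV v"
    show "smooth_field_along A \<gamma> (\<lambda>t. E (v t) (\<gamma> t))" unfolding smooth_field_along_def
    proof
      fix c assume c: "c \<in> A"
      have "smooth_on (\<gamma> -` cdom c) (\<lambda>t. fr c t (v t))"
        by (rule smooth_on_apply[where E = "fr c",
              OF open_\<gamma>[OF c] lin[OF c] smooth_frame_\<gamma>[OF c] smooth_on_subset[OF v subset_UNIV]])
      then show "smooth_on (\<gamma> -` cdom c) (\<lambda>t. to_chart A c (\<gamma> t) (E (v t) (\<gamma> t)))"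
        using smooth_on_cong[OF open_\<gamma>[OF c], of "\<lambda>t. fr c t (v t)"
            "\<lambda>t. to_chart A c (\<gamma> t) (E (v t) (\<gamma> t))"] eq[OF c] by simp
    qed
  qed
qed

lemma smooth_u: "smooth_on UNIV u"
proof -
  have "smooth_field_along A \<gamma> (\<lambda>t. E (u t) (\<gamma> t))"
    unfolding smooth_field_along_def
  proof
    fix c assume c: "c \<in> A"
    show "smooth_on (\<gamma> -` cdom c) (\<lambda>t. to_chart A c (\<gamma> t) (E (u t) (\<gamma> t)))"
    proof (rule smooth_on_cong[OF open_\<gamma>[OF c] _ smooth_on_fd[OF smooth_\<gamma>[OF c], of 1]])
      fix t assume t: "t \<in> \<gamma> -` cdom c"
      have "fd (\<lambda>t. cmap c (\<gamma> t)) t = (\<lambda>h. h *\<^sub>R fr c t (u t))"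
        using curve_derivative[OF c, of t] t by (intro fd_eqI) (simp add: has_vector_derivative_def)
      then show "fd (\<lambda>t. cmap c (\<gamma> t)) t 1 = to_chart A c (\<gamma> t) (E (u t) (\<gamma> t))"
        using to_chart_left_invariant_field[OF c, of "\<gamma> t" "u t"] t by simp
    qed
  qed
  then show ?thesis by (simp add: smooth_field_along_iff)
qed

lemma inner_product_\<kappa>: "inner_product \<kappa>"
  using \<beta>(1) by (simp add: riemannian_metric_def)

sublocale lie_algebra: local_frame "cimg c0" "frame c0" br
  using chart_at[of e] by (intro local_frame) auto

sublocale quadratic_lie_algebra \<kappa> br \<Lambda>
  by unfold_locales (intro inner_product_\<kappa> spd lie_algebra.bilinear_br lie_algebra.br_skew
      lie_algebra.br_jacobi ad_invariant \<beta>)+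

text \<open>The Levi-Civita connection of \<open>h\<close> on left-invariant fields, read off from Koszul's formula.\<close>

definition B :: "'e \<Rightarrow> 'e \<Rightarrow> 'e" where
  "B a b = \<Lambda>i ((1 / 2) *\<^sub>R (\<Lambda> (br a b) + br b (\<Lambda> a) + br a (\<Lambda> b)))"

lemma \<Lambda>_B: "\<Lambda> (B a b) = (1 / 2) *\<^sub>R (\<Lambda> (br a b) + br b (\<Lambda> a) + br a (\<Lambda> b))"
  by (simp add: B_def \<Lambda>_\<Lambda>i)

lemma bilinear_B: "bilinear B"
  unfolding bilinear_def
  by (intro conjI allI linearI) (simp_all add: B_def br_simps \<Lambda>_simps \<Lambda>i_simps algebra_simps)

lemmas B_simps = bilinear_ladd[OF bilinear_B] bilinear_radd[OF bilinear_B] bilinear_lsub[OF bilinear_B]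
  bilinear_rsub[OF bilinear_B] bilinear_lneg[OF bilinear_B] bilinear_rneg[OF bilinear_B]

text \<open>Torsion-freeness of the connection: the last two terms of \<open>B\<close> are together
  symmetric.\<close>

lemma B_diff: "B a b - B b a = br a b"
proof (rule injD[OF inj_\<Lambda>])
  show "\<Lambda> (B a b - B b a) = \<Lambda> (br a b)"
    by (simp add: \<Lambda>_simps \<Lambda>_B skew[of b a] flip: scaleR_diff_right)
qed

lemma koszul: "2 * h e (B a b) w = h e (br a b) w - h e (br b w) a + h e (br w a) b"
proof -
  have "2 * h e (B a b) w = \<kappa> (\<Lambda> (br a b)) w + \<kappa> (br b (\<Lambda> a)) w + \<kappa> (br a (\<Lambda> b)) w"
    by (simp add: h(3) sym_\<Lambda>[symmetric] \<Lambda>_B \<kappa>_simps)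
  moreover have "h e (br b w) a = - \<kappa> (br b (\<Lambda> a)) w"
    by (simp add: h(3) invariant \<kappa>_commute[of w])
  moreover have "h e (br w a) b = \<kappa> (br a (\<Lambda> b)) w"
    by (simp add: h(3) skew[of w a] \<kappa>_simps invariant[of a w] \<kappa>_commute[of w])
  ultimately show ?thesis by (simp add: h(3) sym_\<Lambda>)
qed

lemma metric_frame:
  assumes c: "c \<in> A" "cdom c \<noteq> {}"
  shows "metric_frame (cimg c) (frame c) br (metric_in_chart A h c) (h e) B"
proof (rule metric_frame.intro[OF local_frame[OF c]])
  show "metric_frame_axioms (cimg c) (frame c) br (metric_in_chart A h c) (h e) B"
  proof
    show "smooth_on (cimg c) (\<lambda>x. metric_in_chart A h c x v w)" for v w
      using h(1) c by (simp add: riemannian_metric_def)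
  qed (use inner_product_metric_in_chart[OF h(1,2) c(1)] metric_in_chart_frame[OF h(2) c(1)]
      bilinear_B koszul in auto)
qed

lemma christoffel_chart: "christoffel A h c = christoffel_of (metric_in_chart A h c)"
  by (intro ext) (simp add: christoffel_def christoffel_of_def Let_def)

lemma cov_deriv_E:
  assumes v: "(v has_vector_derivative v') (at t)"
  shows "cov_deriv A h \<gamma> (\<lambda>t. E (v t) (\<gamma> t)) t = E (v' + B (u t) (v t)) (\<gamma> t)"
proof -
  define c where "c = chart_at A (\<gamma> t)"
  have c: "c \<in> A" "\<gamma> t \<in> cdom c" unfolding c_def by (rule chart_at)+
  interpret metric_frame "cimg c" "frame c" br "metric_in_chart A h c" "h e" B
    using c by (intro metric_frame) auto
  have "\<forall>\<^sub>F s in nhds t. s \<in> UNIV \<longrightarrow>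
      to_chart A c (\<gamma> s) (E (v s) (\<gamma> s)) = fr c s (v s)"
    unfolding eventually_nhds using open_\<gamma>[OF c(1)] c
    by (intro exI[of _ "\<gamma> -` cdom c"]) (auto intro: to_chart_left_invariant_field)
  then have 1: "vector_derivative (\<lambda>s. to_chart A c (\<gamma> s) (E (v s) (\<gamma> s))) (at t)
      = vector_derivative (\<lambda>s. fr c s (v s)) (at t)"
    by (rule vector_derivative_cong_eq) auto
  have E: "E a (\<gamma> t) = fr c t a" for a
    by (simp add: left_invariant_field_eq c_def)
  have "vector_derivative (\<lambda>s. fr c s (v s)) (at t)
      + christoffel A h c (cmap c (\<gamma> t)) (velocity A \<gamma> t) (E (v t) (\<gamma> t)) = E (v' + B (u t) (v t)) (\<gamma> t)"
    unfolding christoffel_chart E_u[symmetric] E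
    by (rule covariant_derivative_frame[where x = "\<lambda>t. cmap c (\<gamma> t)", OF _ curve_derivative[OF c] v])
      (use c in simp)
  then show ?thesis by (simp add: cov_deriv_def Let_def c_def[symmetric] 1)
qed

lemma curvature_E:
  "curvature A h p (E a p) (E b p) (E c p) = E (B a (B b c) - B b (B a c) - B (br a b) c) p"
proof -
  define k where "k = chart_at A p"
  have k: "k \<in> A" "p \<in> cdom k" unfolding k_def by (rule chart_at)+
  interpret metric_frame "cimg k" "frame k" br "metric_in_chart A h k" "h e" B
    using k by (intro metric_frame) auto
  have "curvature A h p x y z = curvature_of (christoffel_of (metric_in_chart A h k)) (cmap k p) x y z" for x y z
    by (simp add: curvature_def curvature_of_def Let_def k_def[symmetric] christoffel_chart)
  moreover have "E a p = frame k (cmap k p) a" for a by (simp add: left_invariant_field_eq k_def)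
  ultimately show ?thesis using curvature_frame[of "cmap k p" a b c] k by simp
qed

lemma u_deriv: "(u has_vector_derivative - B (u t) (u t)) (at t)"
proof -
  have d: "(u has_vector_derivative fd u t 1) (at t)" by (rule has_vector_derivative_smooth[OF smooth_u]) simp
  have "velocity A \<gamma> = (\<lambda>t. E (u t) (\<gamma> t))" by (simp add: E_u fun_eq_iff)
  then have "cov_deriv A h \<gamma> (\<lambda>t. E (u t) (\<gamma> t)) t = 0" using geo by (simp add: geodesic_def)
  then have "fd u t 1 + B (u t) (u t) = 0" by (simp add: cov_deriv_E[OF d] E_eq_0_iff)
  then show ?thesis using d by (simp add: eq_neg_iff_add_eq_0[symmetric])
qed

sublocale euler_arnold \<kappa> br \<Lambda> u
proof
  show "continuous_on UNIV u" using smooth_onD[OF smooth_u, of 0] by simp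
  show "((\<lambda>t. \<Lambda> (u t)) has_vector_derivative br (\<Lambda> (u t)) (u t)) (at t)" for t
  proof -
    have "((\<lambda>t. \<Lambda> (u t)) has_vector_derivative \<Lambda> (- B (u t) (u t))) (at t)"
      by (rule \<Lambda>_deriv[OF u_deriv])
    moreover have "\<Lambda> (- B (u t) (u t)) = br (\<Lambda> (u t)) (u t)"
      by (simp add: \<Lambda>_simps \<Lambda>_B br_self skew[of "\<Lambda> (u t)"] flip: scaleR_2)
    ultimately show ?thesis by simp
  qed
qed

text \<open>A bootstrap through the linear system, whose coefficients are smooth because
  \<open>u\<close> is.\<close>

lemma jac_smooth:
  assumes "jac v w"
  shows "smooth_on UNIV v" "smooth_on UNIV w"
proof -
  have u: "Ck_on k UNIV u" for k by (rule smooth_onD[OF smooth_u])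
  have bl: "bounded_linear \<Lambda>" "bounded_linear \<Lambda>i"
    using lin_\<Lambda> lin_\<Lambda>i by (simp_all add: linear_conv_bounded_linear)
  have "Ck_on k UNIV v \<and> Ck_on k UNIV w" for k
  proof (induction k)
    case 0
    then show ?case
      using jacD[OF assms] by (auto intro!: continuous_at_imp_continuous_on has_vector_derivative_continuous)
  next
    case (Suc k)
    have "Ck_on k UNIV (\<lambda>t. w t + br (v t) (u t))"
      using Suc u by (intro Ck_on_add Ck_on_bilinear[OF bb_br]) auto
    then have "Ck_on k UNIV (\<lambda>t. w t - br (u t) (v t))"
      by (simp add: skew[of "v _"])
    moreover have "Ck_on k UNIV (\<lambda>t. \<Lambda>i (br (m t) (w t) + br (\<Lambda> (w t)) (u t)))"
      unfolding m_def using Suc u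
      by (intro Ck_on_linear_comp[OF bl(2)] Ck_on_add Ck_on_bilinear[OF bb_br] Ck_on_linear_comp[OF bl(1)]) auto
    ultimately show ?case using Ck_on_SucI[OF jacD(1)[OF assms]] Ck_on_SucI[OF jacD(2)[OF assms]] by simp
  qed
  then show "smooth_on UNIV v" "smooth_on UNIV w" by (simp_all add: smooth_on_def)
qed

text \<open>With the variation of the velocity \<open>w = v' + br u v\<close>, the Jacobi operator
  becomes \<open>w' + B u w + B w u\<close>, the linearisation of the geodesic equation
  \<open>u' + B u u = 0\<close>; applying \<open>\<Lambda>\<close> gives the system
  \<open>jac\<close>.\<close>

lemma jacobi_field_iff:
  "jacobi_field A h \<gamma> (\<lambda>t. E (v t) (\<gamma> t)) \<longleftrightarrow> (\<exists>w. jac v w)"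
proof (cases "smooth_on UNIV v")
  \<comment> \<open>Both sides fail: Jacobi fields are smooth by definition, solutions of
    \<open>jac\<close> by regularity of the system.\<close>
  case False
  then show ?thesis using jac_smooth(1) by (auto simp: jacobi_field_def smooth_field_along_iff)
next
  case smooth: True
  define v' where "v' t = fd v t 1" for t
  define v'' where "v'' t = fd v' t 1" for t
  have smooth': "smooth_on UNIV v'" unfolding v'_def[abs_def] by (rule smooth_on_fd[OF smooth])
  have v: "(v has_vector_derivative v' t) (at t)" and v': "(v' has_vector_derivative v'' t) (at t)" for t
    unfolding v'_def v''_def
    by (rule has_vector_derivative_smooth[OF smooth UNIV_I],
        rule has_vector_derivative_smooth[OF smooth'[unfolded v'_def[abs_def]] UNIV_I])
  define u' where "u' t = - B (u t) (u t)" for t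
  have u: "(u has_vector_derivative u' t) (at t)" for t unfolding u'_def by (rule u_deriv)
  note bbB = bilinear_B[unfolded bilinear_conv_bounded_bilinear]
  note B_deriv = bounded_bilinear.has_vector_derivative[OF bbB]
  define w where "w t = v' t + br (u t) (v t)" for t
  define w' where "w' t = v'' t + (br (u t) (v' t) + br (u' t) (v t))" for t
  have w: "(w has_vector_derivative w' t) (at t)" for t
    unfolding w_def[abs_def] w'_def by (intro has_vector_derivative_add v' br_deriv u v)
  have cov: "cov_deriv A h \<gamma> (\<lambda>t. E (v t) (\<gamma> t)) = (\<lambda>t. E (v' t + B (u t) (v t)) (\<gamma> t))"
    by (rule ext) (rule cov_deriv_E[OF v])
  have v1: "((\<lambda>t. v' t + B (u t) (v t)) has_vector_derivative
      v'' t + (B (u t) (v' t) + B (u' t) (v t))) (at t)" for t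
    by (intro has_vector_derivative_add v' B_deriv u v)
  have lhs: "cov_deriv A h \<gamma> (cov_deriv A h \<gamma> (\<lambda>t. E (v t) (\<gamma> t))) t
      + curvature A h (\<gamma> t) (E (v t) (\<gamma> t)) (velocity A \<gamma> t) (velocity A \<gamma> t)
      = E (w' t + B (u t) (w t) + B (w t) (u t)) (\<gamma> t)" for t
  proof -
    \<comment> \<open>Only torsion-freeness, skewness and \<open>u' = - B u u\<close> enter.
      Brackets become differences of values of \<open>B\<close>, except the one inside
      \<open>B (br (v t) (u t)) (u t)\<close>, which matches on both sides.\<close>
    have "B (u t) (br (u t) (v t)) = B (u t) (B (u t) (v t)) - B (u t) (B (v t) (u t))"
      by (simp add: B_diff[symmetric] B_simps)
    moreover have "br (u' t) (v t) = B (u' t) (v t) - B (v t) (u' t)" by (simp add: B_diff)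
    moreover have "br (u t) (v' t) = B (u t) (v' t) - B (v' t) (u t)" by (simp add: B_diff)
    moreover have "B (br (u t) (v t)) (u t) = - B (br (v t) (u t)) (u t)"
      by (simp add: skew[of "u t" "v t"] B_simps)
    ultimately have "v'' t + (B (u t) (v' t) + B (u' t) (v t)) + B (u t) (v' t + B (u t) (v t))
        + (B (v t) (B (u t) (u t)) - B (u t) (B (v t) (u t)) - B (br (v t) (u t)) (u t))
        = w' t + B (u t) (w t) + B (w t) (u t)"
      by (simp add: w_def w'_def B_simps u'_def algebra_simps)
    then show ?thesis
      unfolding cov cov_deriv_E[OF v1] E_u[symmetric] curvature_E E_add[symmetric] by simp
  qed
  \<comment> \<open>\<open>\<Lambda>\<close> is injective, and in the symmetric sum of the two
    \<open>B\<close> terms the antisymmetric parts cancel, leaving only brackets with a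
    momentum.\<close>
  have eq: "w' t + B (u t) (w t) + B (w t) (u t) = 0 \<longleftrightarrow> w' t = \<Lambda>i (br (m t) (w t) + br (\<Lambda> (w t)) (u t))" for t
  proof -
    have B2: "\<Lambda> (B (u t) (w t) + B (w t) (u t)) = - (br (m t) (w t) + br (\<Lambda> (w t)) (u t))"
    proof -
      have "\<Lambda> (B (u t) (w t) + B (w t) (u t)) = (1 / 2) *\<^sub>R ((br (u t) (\<Lambda> (w t)) + br (w t) (\<Lambda> (u t)))
          + (br (u t) (\<Lambda> (w t)) + br (w t) (\<Lambda> (u t))))"
        unfolding \<Lambda>_simps \<Lambda>_B scaleR_add_right[symmetric]
        by (simp add: skew[of "w t" "u t"] \<Lambda>_simps algebra_simps)
      also have "\<dots> = - (br (m t) (w t) + br (\<Lambda> (w t)) (u t))"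
        unfolding scaleR_half_double m_def by (simp add: skew[of "\<Lambda> _"])
      finally show ?thesis .
    qed
    have "w' t + B (u t) (w t) + B (w t) (u t) = 0 \<longleftrightarrow> \<Lambda> (w' t + B (u t) (w t) + B (w t) (u t)) = 0"
      using linear_injective_0[OF lin_\<Lambda>] inj_\<Lambda> linear_0[OF lin_\<Lambda>] by metis
    also have "\<dots> \<longleftrightarrow> \<Lambda> (w' t) = br (m t) (w t) + br (\<Lambda> (w t)) (u t)"
    proof -
      have "\<Lambda> (w' t + B (u t) (w t) + B (w t) (u t)) = \<Lambda> (w' t) - (br (m t) (w t) + br (\<Lambda> (w t)) (u t))"
        using B2 by (simp add: \<Lambda>_simps add.assoc)
      then show ?thesis by simp
    qed
    also have "\<dots> \<longleftrightarrow> w' t = \<Lambda>i (br (m t) (w t) + br (\<Lambda> (w t)) (u t))"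
      using \<Lambda>_\<Lambda>i \<Lambda>i_\<Lambda> by metis
    finally show ?thesis .
  qed
  have "jacobi_field A h \<gamma> (\<lambda>t. E (v t) (\<gamma> t)) \<longleftrightarrow>
      (\<forall>t. w' t = \<Lambda>i (br (m t) (w t) + br (\<Lambda> (w t)) (u t)))"
    unfolding jacobi_field_def smooth_field_along_iff lhs E_eq_0_iff eq using smooth by simp
  also have "\<dots> \<longleftrightarrow> (\<exists>w. jac v w)"
  proof
    assume "\<forall>t. w' t = \<Lambda>i (br (m t) (w t) + br (\<Lambda> (w t)) (u t))"
    then have "jac v w" using v w by (simp add: jac_def w_def)
    then show "\<exists>w. jac v w" by blast
  next
    assume "\<exists>w. jac v w"
    then obtain z where z: "jac v z" by blast
    have "z t = w t" for t
      using vector_derivative_unique_at[OF v jacD(1)[OF z, of t]] by (simp add: w_def)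
    then have "z = w" by (rule ext)
    then show "\<forall>t. w' t = \<Lambda>i (br (m t) (w t) + br (\<Lambda> (w t)) (u t))"
      using vector_derivative_unique_at[OF w jacD(2)[OF z[unfolded \<open>z = w\<close>]]] by blast
  qed
  finally show ?thesis .
qed

lemma conjugate_time_iff: "conjugate_time A h \<gamma> \<tau> \<longleftrightarrow> conj_time \<tau>"
proof
  assume "conjugate_time A h \<gamma> \<tau>"
  then obtain J t where J: "\<tau> > 0" "jacobi_field A h \<gamma> J" "J t \<noteq> 0" "J 0 = 0" "J \<tau> = 0"
    by (auto simp: conjugate_time_def)
  define v where "v t = lcomp (\<gamma> t) (J t)" for t
  have E: "E (v t) (\<gamma> t) = J t" for t by (simp add: v_def E_lcomp)
  then have "J = (\<lambda>t. E (v t) (\<gamma> t))" by (simp add: fun_eq_iff)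
  then obtain w where "jac v w" using J(2) jacobi_field_iff by metis
  moreover have "v s = 0 \<longleftrightarrow> J s = 0" for s using E_eq_0_iff[of "v s" "\<gamma> s"] by (simp add: E)
  ultimately show "conj_time \<tau>" unfolding conj_time_def using J by blast
next
  assume "conj_time \<tau>"
  then obtain v w t where v: "\<tau> > 0" "jac v w" "v 0 = 0" "v \<tau> = 0" "v t \<noteq> 0"
    by (auto simp: conj_time_def)
  show "conjugate_time A h \<gamma> \<tau>"
    unfolding conjugate_time_def
    using v jacobi_field_iff[of v] by (intro conjI exI[of _ "\<lambda>t. E (v t) (\<gamma> t)"]) (auto simp: E_eq_0_iff)
qed

end

text \<open>A least conjugate time is unique, so the existential over \<open>\<tau>\<close> is the
  claim about the first conjugate time. When there is a conjugate point the operator norm is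
  positive, so both quotients are genuine.\<close>

theorem corollary3p5:
  fixes mul :: "'g \<Rightarrow> 'g \<Rightarrow> 'g::{t2_space, second_countable_topology}"
    and e :: 'g and iv :: "'g \<Rightarrow> 'g"
    and A :: "('g, 'e::euclidean_space) chart set"
    and \<beta> h :: "('g, 'e) metric_field"
    and \<kappa> :: "'e \<Rightarrow> 'e \<Rightarrow> real"
    and \<Lambda> :: "'e \<Rightarrow> 'e" and u0 :: 'e and \<gamma> :: "real \<Rightarrow> 'g"
  assumes lie: "lie_group mul e iv A"
    and bi: "riemannian_metric A \<beta>" "left_invariant mul A \<beta>" "right_invariant mul A \<beta>"
    and kappa: "\<kappa> = \<beta> e"
    and Lambda: "symmetric_positive_definite \<kappa> \<Lambda>"
    and h: "riemannian_metric A h" "left_invariant mul A h" "\<And>u v. h e u v = \<kappa> u (\<Lambda> v)"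
    and geo: "geodesic A h \<gamma>" "\<gamma> 0 = e" "velocity A \<gamma> 0 = u0"
  shows "(has_conjugate_point A h \<gamma> \<longleftrightarrow> \<Lambda> u0 \<notin> lie_center mul e A) \<and>
    (has_conjugate_point A h \<gamma> \<longrightarrow>
      (\<exists>\<tau>. first_conjugate_time A h \<gamma> \<tau> \<and>
         2 * pi * Min (eigenvalues \<Lambda>) / op_norm \<kappa> (lie_bracket mul e A (\<Lambda> u0)) \<le> \<tau> \<and>
         \<tau> \<le> 2 * pi * Max (eigenvalues \<Lambda>) / op_norm \<kappa> (lie_bracket mul e A (\<Lambda> u0))))"
proof -
  interpret lie_group mul e iv A by (rule lie)
  interpret left_invariant_geodesic mul e iv A \<beta> h \<Lambda> \<gamma>
    by unfold_locales (use bi h geo(1) Lambda kappa in auto)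
  \<comment> \<open>The frame at the group identity is the identity map, so the initial velocity is
    its own left-invariant component.\<close>
  have "u 0 = u0"
    using lcomp_E[of e u0] \<open>\<gamma> 0 = e\<close> \<open>velocity A \<gamma> 0 = u0\<close> by (simp add: u_def left_invariant_field_eq frame_x0)
  then have m0: "m 0 = \<Lambda> u0" by (simp add: m_def)
  show ?thesis
    using conj_time_bounds
    by (simp add: has_conjugate_point_def first_conjugate_time_def conjugate_time_iff lie_center_def
        \<mu>_def m0 kappa)
qed

end
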